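(* Let $k$ be an algebraically closed field of characteristic zero and $P=k[x_1,\ldots,x_n]$. Let $J\subseteq P$ be an ideal generated by monomials of degree 2, let $f_1\neq f_2$ be monomials of degree 2, let $I=J+(f_1+f_2)$, and let $R=P/I$. Assume that $\dim_k(R_2)\neq n-1$. Then a general linear form is not part of a pair of homogeneous exact zero divisors in $R$; that is, there is a nonempty Zariski open set $\mathcal U\subseteq k^n$ such that for every $(a_1,\ldots,a_n)\in\mathcal U$, with $\ell=\sum_{i=1}^n a_ix_i$, there is no homogeneous $Q\in R$ such that $(\ell,Q)$ is a pair of exact zero divisors in $R$.
   Context: $P$ has the standard grading, and $R_i$ denotes the degree-$i$ graded piece of $R=P/I$. The same symbol denotes an element of $P$ and its image in $R$. A pair $(x,y)$ of elements of $R$ is a pair of exact zero divisors if $\mathrm{Ann}_R(x)=(y)$ and $\mathrm{Ann}_R(y)=(x)$, where $(x),(y)$ are the ideals of $R$ generated by $x,y$. A statement holds for a general linear form if it holds for all $\ell=\sum_{i=1}^n a_ix_i$ with $(a_1,\ldots,a_n)$ in some nonempty Zariski open subset of $k^n$. *)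

theory Defs
  imports
    "HOL-Algebra.Algebraic_Closure_Type"
    "HOL-Library.Poly_Mapping"
begin

text \<open>
  Polynomials over \<open>'k\<close> in the variables \<open>x\<^sub>i\<close>, \<open>i :: 'n\<close>, with \<open>n = card (UNIV :: 'n set)\<close>:
  finitely supported maps from exponent vectors to coefficients. The multiplication
  of \<^typ>\<open>'a \<Rightarrow>\<^sub>0 'b\<close> is convolution.
\<close>

type_synonym ('n, 'k) mpoly = "('n \<Rightarrow>\<^sub>0 nat) \<Rightarrow>\<^sub>0 'k"

abbreviation mpoly_ring :: "('n, 'k :: comm_ring_1) mpoly ring"
  where "mpoly_ring \<equiv> ring_of_type_algebra"

definition exponent_degree :: "('n :: finite \<Rightarrow>\<^sub>0 nat) \<Rightarrow> nat"
  where "exponent_degree m = (\<Sum>i\<in>UNIV. Poly_Mapping.lookup m i)"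

definition monomials :: "nat \<Rightarrow> ('n :: finite, 'k :: comm_ring_1) mpoly set"
  where "monomials d = {Poly_Mapping.single m 1 | m. exponent_degree m = d}"

definition const :: "'k :: comm_ring_1 \<Rightarrow> ('n, 'k) mpoly"
  where "const c = Poly_Mapping.single 0 c"

definition indet :: "'n \<Rightarrow> ('n, 'k :: comm_ring_1) mpoly"
  where "indet i = Poly_Mapping.single (Poly_Mapping.single i 1) 1"

definition linear_form :: "('n :: finite \<Rightarrow> 'k :: comm_ring_1) \<Rightarrow> ('n, 'k) mpoly"
  where "linear_form a = (\<Sum>i\<in>UNIV. const (a i) * indet i)"

definition eval_poly :: "('n :: finite, 'k :: comm_ring_1) mpoly \<Rightarrow> ('n \<Rightarrow> 'k) \<Rightarrow> 'k"
  where "eval_poly p a = (\<Sum>m\<in>Poly_Mapping.keys p.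
           Poly_Mapping.lookup p m * (\<Prod>i\<in>UNIV. a i ^ Poly_Mapping.lookup m i))"

text \<open>Affine space \<open>k\<^sup>n\<close> is \<^typ>\<open>'n \<Rightarrow> 'k\<close>; its Zariski open sets are the
  complements of the common zero sets of sets of polynomials.\<close>

definition zariski_open :: "('n :: finite \<Rightarrow> 'k :: comm_ring_1) set \<Rightarrow> bool"
  where "zariski_open U \<longleftrightarrow>
    (\<exists>S :: ('n, 'k) mpoly set. U = - {a. \<forall>p\<in>S. eval_poly p a = 0})"

definition homogeneous_part :: "nat \<Rightarrow> ('n :: finite, 'k :: comm_ring_1) mpoly set"
  where "homogeneous_part d = {p. \<forall>m\<in>Poly_Mapping.keys p. exponent_degree m = d}"

definition residue_class ::
    "('n, 'k :: comm_ring_1) mpoly set \<Rightarrow> ('n, 'k) mpoly \<Rightarrow> ('n, 'k) mpoly set"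
  where "residue_class I p = I +>\<^bsub>mpoly_ring\<^esub> p"

definition graded_piece ::
    "('n :: finite, 'k :: comm_ring_1) mpoly set \<Rightarrow> nat \<Rightarrow> ('n, 'k) mpoly set set"
  where "graded_piece I d = residue_class I ` homogeneous_part d"

text \<open>The image of \<open>k\<close> in \<open>P/I\<close>. The library measures dimensions over a subfield
  contained in the ring; for proper \<open>I\<close> this is a copy of \<open>k\<close> acting on \<open>P/I\<close> by the
  usual scalar multiplication.\<close>

definition scalars :: "('n, 'k :: comm_ring_1) mpoly set \<Rightarrow> ('n, 'k) mpoly set set"
  where "scalars I = residue_class I ` range const"

definition annihilator :: "('a, 'b) ring_scheme \<Rightarrow> 'a \<Rightarrow> 'a set"
  where "annihilator R x = {r \<in> carrier R. r \<otimes>\<^bsub>R\<^esub> x = \<zero>\<^bsub>R\<^esub>}"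

definition exact_zero_divisors :: "('a, 'b) ring_scheme \<Rightarrow> 'a \<Rightarrow> 'a \<Rightarrow> bool"
  where "exact_zero_divisors R x y \<longleftrightarrow>
    x \<in> carrier R \<and> y \<in> carrier R \<and>
    annihilator R x = PIdl\<^bsub>R\<^esub> y \<and> annihilator R y = PIdl\<^bsub>R\<^esub> x"

end

theory Submission
  imports Defs
begin

text \<open>
  Let \<open>(l, Q)\<close> be a pair of exact zero divisors, \<open>l\<close> general and \<open>Q\<close> homogeneous of degree \<open>d\<close>.

  Suppose first that \<open>I\<close> is a monomial ideal. In high degrees \<open>l\<close> is a nonzerodivisor modulo \<open>I\<close> (look at
  the terms with the highest power of a variable that occurs squared), so \<open>Q\<close> kills \<open>R\<close> in high degrees, and
  exactness makes \<open>R\<close> artinian. If \<open>d \<ge> 2\<close>, exactness of the pair modulo all ideals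
  \<open>I + (x\<^sub>i | i \<in> T)\<close> descends from high degrees to degree \<open>0\<close>, where it says \<open>1 \<in> (l, x\<^sub>1, \<dots>, x\<^sub>n)\<close>. If
  \<open>d = 1\<close>, comparing coefficients in \<open>l Q\<close> shows \<open>R\<^sub>3 = 0\<close>; then \<open>Q R\<^sub>2 = 0\<close>, so \<open>R\<^sub>2 = l R\<^sub>1\<close> has
  dimension \<open>n - 1\<close>.

  Otherwise put \<open>K = (I : f\<^sub>1)\<close>, so that \<open>0 \<rightarrow> P/K \<rightarrow> P/I \<rightarrow> P/(I, f\<^sub>1) \<rightarrow> 0\<close> with a monomial
  quotient. Either \<open>l\<close> and some variable are nonzerodivisors modulo \<open>K\<close>, contradicting that \<open>R\<close> is
  artinian, or \<open>K\<close> is generated by variables and quadratic monomials. In the latter case there are two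
  variables in \<open>K\<close> that span a subspace of square zero modulo \<open>(I, f\<^sub>1)\<close>; dividing by them
  twists the descent so that it still works, by a dimension count.
\<close>

text \<open>Dividing by a variable trades degrees: extending exactness of \<open>A\<close> in degree
  j to further variables needs exactness of its partner in degree j + deg A - 1. For A = l the
  degree stays, for A = Q it rises by d - 1, so a full round of the descent gains d - 1. This is why
  d = 1 needs an argument of its own.

  In the binomial case colon ideals of I by variables leave the class of ideals under control, so
  the descent runs over the monomial ideal (I, f1). There exactness of the pair is not given even
  without further variables; the defect is moved into P/K through multiplication by f1, and the two
  special variables serve to remove it.

  The open set requires nonzero coordinates and excludes the ratios 1, -1, 2, -2, 1/2, -1/2 between
  the values of the two monomials. At 1 and -1 the form l degenerates modulo x_i + x_j and x_i^2 +
  x_j^2. For linear Q, equality of the coefficients of both monomials in l Q can force one of 1,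
  1/2, -1/2, or an inverse when the monomials are exchanged.\<close>

abbreviation cf :: "('a \<Rightarrow>\<^sub>0 'b::zero) \<Rightarrow> 'a \<Rightarrow> 'b" where "cf \<equiv> Poly_Mapping.lookup"
abbreviation ks :: "('a \<Rightarrow>\<^sub>0 'b::zero) \<Rightarrow> 'a set" where "ks \<equiv> Poly_Mapping.keys"
abbreviation ee :: "'n \<Rightarrow> 'n \<Rightarrow>\<^sub>0 nat" where "ee i \<equiv> Poly_Mapping.single i (Suc 0)"

section \<open>Monomials, coefficients of products, contraction and truncation\<close>

definition xmon :: "('n \<Rightarrow>\<^sub>0 nat) \<Rightarrow> ('n, 'k::comm_ring_1) mpoly" where "xmon s = Poly_Mapping.single s 1"

definition divs :: "('n \<Rightarrow>\<^sub>0 nat) \<Rightarrow> ('n \<Rightarrow>\<^sub>0 nat) \<Rightarrow> bool" (infix "\<preceq>" 50)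
  where "s \<preceq> m \<longleftrightarrow> (\<forall>i. cf s i \<le> cf m i)"

lemma lookup_minus_nat [simp]: "cf (m - s) i = cf m i - (cf s i :: nat)"
  by transfer simp

lemma divs_iff: "s \<preceq> m \<longleftrightarrow> (\<exists>t. m = t + s)"
proof
  assume "s \<preceq> m"
  then have "m = (m - s) + s" by (intro poly_mapping_eqI) (simp add: divs_def lookup_add)
  then show "\<exists>t. m = t + s" by blast
qed (auto simp: divs_def lookup_add)

lemma divs_refl [simp]: "s \<preceq> s" and divs_add1 [simp]: "s \<preceq> t + s" and divs_add2 [simp]: "s \<preceq> s + t"
  by (auto simp: divs_def lookup_add)

lemma divs_trans: "a \<preceq> b \<Longrightarrow> b \<preceq> c \<Longrightarrow> a \<preceq> c"
  by (meson divs_def le_trans)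

lemma ee_divs_iff: "ee i \<preceq> m \<longleftrightarrow> 0 < cf m i"
  by (auto simp: divs_def lookup_single when_def)

lemma cf_xmon_mult_add [simp]: "cf (xmon s * p) (t + s) = cf p t"
proof -
  have "cf (xmon s * p) (t + s) = (\<Sum>l. (1 when s = l) * (\<Sum>q. cf p q when t + s = l + q))"
    by (simp add: lookup_mult xmon_def lookup_single)
  also have "\<dots> = (\<Sum>l. (\<Sum>q. cf p q when t + s = l + q) when l = s)"
    by (intro Sum_any.cong) (auto simp: when_def)
  also have "\<dots> = (\<Sum>q. cf p q when t + s = s + q)" by simp
  also have "\<dots> = (\<Sum>q. cf p q when q = t)"
    by (intro Sum_any.cong) (auto simp: when_def add.commute[of t s])
  finally show ?thesis by simp
qed

lemma cf_xmon_mult_0: "\<not> s \<preceq> m \<Longrightarrow> cf (xmon s * p) m = 0"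
proof -
  assume a: "\<not> s \<preceq> m"
  have "cf (xmon s * p) m = (\<Sum>l. (1 when s = l) * (\<Sum>q. cf p q when m = l + q))"
    by (simp add: lookup_mult xmon_def lookup_single)
  also have "\<dots> = (\<Sum>l. (\<Sum>q. cf p q when m = l + q) when l = s)"
    by (intro Sum_any.cong) (auto simp: when_def)
  also have "\<dots> = (\<Sum>q. cf p q when m = s + q)" by simp
  also have "\<dots> = 0"
    using a by (auto simp: when_def divs_iff add.commute)
  finally show ?thesis .
qed

lemma cf_xmon_mult: "cf (xmon s * p) m = (if s \<preceq> m then cf p (m - s) else 0)"
  using cf_xmon_mult_0[of s m p] cf_xmon_mult_add[of s p]
  by (auto simp: divs_iff)

lemma xmon_add: "xmon (s + t) = xmon s * xmon t"
  by (simp add: xmon_def mult_single)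

lemma xmon_0 [simp]: "xmon 0 = 1" by (simp add: xmon_def)

lemma keys_xmon [simp]: "ks (xmon s :: ('n,'k::comm_ring_1) mpoly) = {s}" by (simp add: xmon_def)

lemma indet_eq: "indet i = xmon (ee i)" by (simp add: indet_def xmon_def)

lemma const_mult_cf [simp]: "cf (const c * p) m = c * cf p m"
proof -
  have "const c * p = Poly_Mapping.map ((*) c) p" by (simp add: mult_map_scale_conv_mult const_def)
  then show ?thesis by (simp add: Poly_Mapping.map.rep_eq when_def)
qed

lemma poly_expand: "p = (\<Sum>m\<in>ks p. const (cf p m) * xmon m)"
proof (rule poly_mapping_eqI)
  fix m
  have "cf (\<Sum>m\<in>ks p. const (cf p m) * xmon m) m = (\<Sum>m'\<in>ks p. cf p m' * (1 when m' = m))"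
    by (simp add: lookup_sum xmon_def lookup_single)
  also have "\<dots> = (\<Sum>m'\<in>ks p. if m' = m then cf p m' else 0)"
    by (intro sum.cong) (auto simp: when_def)
  also have "\<dots> = cf p m" by (simp add: sum.delta in_keys_iff)
  finally show "cf p m = cf (\<Sum>m\<in>ks p. const (cf p m) * xmon m) m" by simp
qed

text \<open>Contraction: division by \<open>xmon s\<close> on the terms that allow it, all other
  terms being dropped. Unlike a partial derivative it has no numerical factors, so it is a left
  inverse of multiplication by \<open>xmon s\<close>.\<close>

definition dv :: "('n \<Rightarrow>\<^sub>0 nat) \<Rightarrow> ('n, 'k::comm_ring_1) mpoly \<Rightarrow> ('n, 'k) mpoly"
  where "dv s p = Poly_Mapping.map_key (\<lambda>m. m + s) p"

lemma cf_dv [simp]: "cf (dv s p) m = cf p (m + s)"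
  by (simp add: dv_def map_key.rep_eq)

lemma dv_add: "dv s (p + q) = dv s p + dv s q" by (rule poly_mapping_eqI) (simp add: lookup_add)
lemma dv_diff: "dv s (p - q) = dv s p - dv s q" by (rule poly_mapping_eqI) (simp add: lookup_minus)
lemma dv_const_mult: "dv s (const c * q) = const c * dv s q" by (rule poly_mapping_eqI) simp
lemma dv_0 [simp]: "dv s 0 = 0" by (rule poly_mapping_eqI) simp
lemma dv_sum: "dv s (sum f A) = (\<Sum>a\<in>A. dv s (f a))"
  by (induction A rule: infinite_finite_induct) (auto simp: dv_add)

lemma dv_xmon_mult [simp]: "dv s (xmon s * p) = p"
  by (rule poly_mapping_eqI) simp

text \<open>With \<open>B\<close> the complement of the exponents of a monomial ideal, this is the
  normal form modulo that ideal.\<close>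

definition restr :: "('n \<Rightarrow>\<^sub>0 nat) set \<Rightarrow> ('n, 'k::comm_ring_1) mpoly \<Rightarrow> ('n, 'k) mpoly"
  where "restr B p = Poly_Mapping.mapp (\<lambda>m c. if m \<in> B then c else 0) p"

lemma cf_restr [simp]: "cf (restr B p) m = (if m \<in> B then cf p m else 0)"
  by (auto simp: restr_def lookup_mapp when_def in_keys_iff)

lemma keys_restr: "ks (restr B p) = ks p \<inter> B"
  by (auto simp: in_keys_iff split: if_splits)

lemma restr_split: "p = restr B p + restr (- B) p"
  by (rule poly_mapping_eqI) (simp add: lookup_add)

lemma restr_add: "restr B (p + q) = restr B p + restr B q" by (rule poly_mapping_eqI) (simp add: lookup_add)
lemma restr_diff: "restr B (p - q) = restr B p - restr B q" by (rule poly_mapping_eqI) (simp add: lookup_minus)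
lemma restr_id: "ks p \<subseteq> B \<Longrightarrow> restr B p = p" by (rule poly_mapping_eqI) (auto simp: in_keys_iff)
lemma restr_0: "ks p \<inter> B = {} \<Longrightarrow> restr B p = 0" by (rule poly_mapping_eqI) (auto simp: in_keys_iff)

lemma xmon_dv: "(\<And>m. m \<in> ks p \<Longrightarrow> s \<preceq> m) \<Longrightarrow> xmon s * dv s p = p"
proof (rule poly_mapping_eqI)
  fix m assume a: "\<And>m. m \<in> ks p \<Longrightarrow> s \<preceq> m"
  show "cf (xmon s * dv s p) m = cf p m"
  proof (cases "s \<preceq> m")
    case True
    then obtain t where "m = t + s" by (auto simp: divs_iff)
    then show ?thesis by simp
  next
    case False then show ?thesis using a by (metis cf_xmon_mult_0 in_keys_iff)
  qed
qed

subsection \<open>Monomial ideals\<close>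

definition upset :: "('n \<Rightarrow>\<^sub>0 nat) set \<Rightarrow> bool" where "upset B \<longleftrightarrow> (\<forall>m\<in>B. \<forall>m'. m \<preceq> m' \<longrightarrow> m' \<in> B)"

definition mideal :: "('n \<Rightarrow>\<^sub>0 nat) set \<Rightarrow> ('n, 'k::comm_ring_1) mpoly set" where "mideal B = {p. ks p \<subseteq> B}"

lemma keys_diff_subset: "ks (p - q) \<subseteq> ks p \<union> ks (q :: 'a \<Rightarrow>\<^sub>0 'b::ab_group_add)"
proof
  fix m assume "m \<in> ks (p - q)"
  then have "cf p m - cf q m \<noteq> 0" by (simp add: in_keys_iff lookup_minus)
  then show "m \<in> ks p \<union> ks q" by (auto simp: in_keys_iff)
qed

lemma mideal_add: "p \<in> mideal B \<Longrightarrow> q \<in> mideal B \<Longrightarrow> p + q \<in> mideal B"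
  using keys_add[of p q] by (auto simp: mideal_def)
lemma mideal_diff: "p \<in> mideal B \<Longrightarrow> q \<in> mideal B \<Longrightarrow> p - q \<in> mideal B"
  using keys_diff_subset[of p q] unfolding mideal_def by blast
lemma mideal_0 [simp]: "0 \<in> mideal B" by (simp add: mideal_def)

lemma mideal_mult:
  assumes "upset B" "p \<in> mideal B" shows "q * p \<in> mideal B"
proof -
  have "ks (q * p) \<subseteq> B"
    using keys_mult[of q p] assms unfolding mideal_def upset_def by (fastforce simp: divs_iff)
  then show ?thesis by (simp add: mideal_def)
qed

lemma mideal_mult2: "upset B \<Longrightarrow> p \<in> mideal B \<Longrightarrow> p * q \<in> mideal B"
  using mideal_mult[of B p q] by (simp add: mult.commute)

lemma mideal_uminus: "p \<in> mideal B \<Longrightarrow> - p \<in> mideal B"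
  using mideal_diff[of 0 B p] by simp

lemma mideal_mono: "B \<subseteq> C \<Longrightarrow> mideal B \<subseteq> mideal C" by (auto simp: mideal_def)

lemma mideal_restr_compl: "p - restr (- B) p \<in> mideal B"
proof -
  have "p - restr (-B) p = restr B p" using restr_split[of p B] by (metis add_diff_cancel_right')
  then show ?thesis by (auto simp: mideal_def keys_restr)
qed

lemma mideal_xmon_mult:
  assumes "\<And>m. m + s \<in> B \<Longrightarrow> m \<in> C" "xmon s * p \<in> mideal B" shows "p \<in> mideal C"
proof -
  have "m \<in> C" if "m \<in> ks p" for m
  proof -
    have "m + s \<in> ks (xmon s * p)" using that by (simp add: in_keys_iff)
    then show ?thesis using assms by (auto simp: mideal_def)
  qed
  then show ?thesis by (auto simp: mideal_def)
qed

lemma mideal_dv: "(\<And>m. m + s \<in> B \<Longrightarrow> m \<in> C) \<Longrightarrow> p \<in> mideal B \<Longrightarrow> dv s p \<in> mideal C"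
  by (auto simp: mideal_def in_keys_iff)

subsection \<open>Weighted degree\<close>

text \<open>The degree in the variables of \<open>D\<close> only. Besides the usual grading, the
  proof uses sets of one or two variables.\<close>

definition wd :: "'n::finite set \<Rightarrow> ('n \<Rightarrow>\<^sub>0 nat) \<Rightarrow> nat" where "wd D m = (\<Sum>i\<in>D. cf m i)"

abbreviation "tdeg \<equiv> wd UNIV"

lemma wd_add [simp]: "wd D (m + m') = wd D m + wd D m'"
  by (simp add: wd_def lookup_add sum.distrib)

lemma wd_0 [simp]: "wd D 0 = 0" by (simp add: wd_def)

lemma wd_ee [simp]: "wd D (ee i) = (if i \<in> D then 1 else 0)"
proof -
  have "wd D (ee i) = (\<Sum>j\<in>D. if i = j then 1 else 0)" by (auto simp: wd_def lookup_single when_def intro!: sum.cong)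
  then show ?thesis by (simp add: sum.delta)
qed

lemma exponent_degree_wd: "exponent_degree m = tdeg m" by (simp add: exponent_degree_def wd_def)

text \<open>Degrees are integers so that \<open>k - d\<close> always makes sense; in negative
  degrees only 0 is homogeneous.\<close>

definition hom :: "'n::finite set \<Rightarrow> int \<Rightarrow> ('n, 'k::comm_ring_1) mpoly \<Rightarrow> bool"
  where "hom D k p \<longleftrightarrow> (\<forall>m\<in>ks p. int (wd D m) = k)"

abbreviation "homog \<equiv> hom UNIV"

definition hp :: "'n::finite set \<Rightarrow> int \<Rightarrow> ('n, 'k::comm_ring_1) mpoly \<Rightarrow> ('n, 'k) mpoly"
  where "hp D k p = restr {m. int (wd D m) = k} p"

lemma hom_0 [simp]: "hom D k 0" by (simp add: hom_def)
lemma hom_hp [simp]: "hom D k (hp D k p)" by (simp add: hom_def hp_def keys_restr)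
lemma hp_hom: "hom D k p \<Longrightarrow> hp D k p = p" unfolding hp_def hom_def by (rule restr_id) auto
lemma hom_add: "hom D k p \<Longrightarrow> hom D k q \<Longrightarrow> hom D k (p + q)" using keys_add[of p q] unfolding hom_def by blast
lemma hom_diff: "hom D k p \<Longrightarrow> hom D k q \<Longrightarrow> hom D k (p - q)"
  unfolding hom_def using keys_diff_subset[of p q] by blast
lemma hom_mult: "hom D k p \<Longrightarrow> hom D l q \<Longrightarrow> hom D (k + l) (p * q)"
  using keys_mult[of p q] unfolding hom_def by fastforce
lemma hom_xmon: "hom D (int (wd D s)) (xmon s)" by (simp add: hom_def)
lemma hom_const [simp]: "hom D 0 (const c)" by (simp add: hom_def const_def)
lemma hom_const_mult: "hom D k p \<Longrightarrow> hom D k (const c * p)" using hom_mult[OF hom_const] by fastforce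
lemma hom_sum: "(\<And>a. a \<in> A \<Longrightarrow> hom D k (f a)) \<Longrightarrow> hom D k (sum f A)"
  by (induction A rule: infinite_finite_induct) (auto intro: hom_add)
lemma hom_neg: "hom D k p \<Longrightarrow> k < 0 \<Longrightarrow> p = 0"
  by (metis hom_def keys_eq_empty ex_in_conv of_nat_0_le_iff not_le)
lemma hp_add: "hp D k (p + q) = hp D k p + hp D k q" by (simp add: hp_def restr_add)
lemma hp_diff: "hp D k (p - q) = hp D k p - hp D k q" by (simp add: hp_def restr_diff)
lemma hp_in_mideal: "p \<in> mideal B \<Longrightarrow> hp D k p \<in> mideal B" by (auto simp: mideal_def hp_def keys_restr)

lemma hp_mult:
  assumes "hom D d q" shows "hp D k (q * w) = q * hp D (k - d) w"
proof -
  define B where "B = {m. int (wd D m) = k - d}"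
  have w: "w = hp D (k - d) w + restr (- B) w" unfolding hp_def B_def by (rule restr_split)
  have "hp D k (q * restr (- B) w) = 0"
    unfolding hp_def
  proof (rule restr_0, rule ccontr)
    assume "ks (q * restr (- B) w) \<inter> {m. int (wd D m) = k} \<noteq> {}"
    then obtain m where m: "m \<in> ks (q * restr (- B) w)" "int (wd D m) = k" by blast
    then obtain a b where "m = a + b" "a \<in> ks q" "b \<in> ks (restr (- B) w)"
      using keys_mult[of q "restr (- B) w"] by blast
    then show False using assms m(2) by (auto simp: keys_restr B_def hom_def)
  qed
  moreover have "hp D k (q * hp D (k - d) w) = q * hp D (k - d) w"
    using hom_mult[OF assms hom_hp[of D "k - d" w]] by (intro hp_hom) simp
  moreover have "q * w = q * hp D (k - d) w + q * restr (- B) w"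
    by (metis w distrib_left)
  ultimately show ?thesis by (simp add: hp_add)
qed

lemma hom_dv: assumes "hom D k p" shows "hom D (k - int (wd D s)) (dv s p)"
  unfolding hom_def
proof
  fix m assume "m \<in> ks (dv s p)"
  then have "m + s \<in> ks p" by (simp add: in_keys_iff)
  then have "int (wd D (m + s)) = k" using assms unfolding hom_def by blast
  then show "int (wd D m) = k - int (wd D s)" by simp
qed

lemma hom_restr: "hom D k p \<Longrightarrow> hom D k (restr B p)" by (auto simp: hom_def keys_restr)

text \<open>Comparing components of degree \<open>k\<close>: cofactors in congruences may be taken
  homogeneous, which fixes the degrees in the descent.\<close>

lemma hom_mideal_homogenise:
  assumes "hom D k p" "hom D d q" "p - q * w \<in> mideal B"
  shows "\<exists>w'. hom D (k - d) w' \<and> p - q * w' \<in> mideal B"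
proof -
  have "hp D k (p - q * w) \<in> mideal B" using assms(3) by (rule hp_in_mideal)
  then show ?thesis by (metis hp_diff hp_hom[OF assms(1)] hp_mult[OF assms(2)] hom_hp)
qed

subsection \<open>Linear forms and quadratic monomial ideals\<close>

lemma linear_form_mult: "linear_form a * p = (\<Sum>i\<in>UNIV. const (a i) * (xmon (ee i) * p))"
  by (simp add: linear_form_def indet_eq sum_distrib_right mult.assoc)

lemma cf_linear_form_mult:
  "cf (linear_form a * p) m = (\<Sum>i\<in>UNIV. if 0 < cf m i then a i * cf p (m - ee i) else 0)"
  by (auto simp: linear_form_mult lookup_sum cf_xmon_mult ee_divs_iff intro!: sum.cong)

lemma hom_linear_form: "homog 1 (linear_form a)"
  unfolding linear_form_def indet_eq
  by (intro hom_sum hom_const_mult) (metis hom_xmon UNIV_I of_nat_1 wd_ee)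

text \<open>The exponents of the monomials in the ideal generated by \<open>x\<^sup>g\<close>, \<open>g \<in> G\<close>, and \<open>x\<^sub>i\<close>, \<open>i \<in> T\<close>.\<close>
definition Bs :: "('n \<Rightarrow>\<^sub>0 nat) set \<Rightarrow> 'n set \<Rightarrow> ('n \<Rightarrow>\<^sub>0 nat) set"
  where "Bs G T = {m. (\<exists>g\<in>G. g \<preceq> m) \<or> (\<exists>i\<in>T. 0 < cf m i)}"

abbreviation qideal :: "('n \<Rightarrow>\<^sub>0 nat) set \<Rightarrow> 'n set \<Rightarrow> ('n, 'k::comm_ring_1) mpoly set"
  where "qideal G T \<equiv> mideal (Bs G T)"

definition quad :: "('n::finite \<Rightarrow>\<^sub>0 nat) set \<Rightarrow> bool" where "quad G \<longleftrightarrow> (\<forall>g\<in>G. tdeg g = 2)"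

text \<open>Neighbours of \<open>i\<close> in the graph whose edges are the generators;
  \<open>i\<close> is its own neighbour if its square is a generator.\<close>

definition Nb :: "('n \<Rightarrow>\<^sub>0 nat) set \<Rightarrow> 'n \<Rightarrow> 'n set" where "Nb G i = {j. ee i + ee j \<in> G}"

lemma Bs_upset [simp]: "upset (Bs G T)"
  unfolding upset_def
proof (intro ballI allI impI)
  fix m m' assume "m \<in> Bs G T" "m \<preceq> m'"
  then consider g where "g \<in> G" "g \<preceq> m'" | i where "i \<in> T" "0 < cf m i"
    unfolding Bs_def using divs_trans by blast
  then show "m' \<in> Bs G T"
  proof cases
    case 2
    then have "0 < cf m' i" using \<open>m \<preceq> m'\<close> unfolding divs_def by (metis less_le_trans)
    then show ?thesis using 2 by (auto simp: Bs_def)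
  qed (auto simp: Bs_def)
qed

lemma Bs_mono: "G \<subseteq> G' \<Longrightarrow> T \<subseteq> T' \<Longrightarrow> Bs G T \<subseteq> Bs G' T'" by (auto simp: Bs_def)

lemma qideal_mono: "G \<subseteq> G' \<Longrightarrow> T \<subseteq> T' \<Longrightarrow> p \<in> qideal G T \<Longrightarrow> p \<in> qideal G' T'"
  using mideal_mono[OF Bs_mono] by blast

lemmas qideal_mult = mideal_mult[OF Bs_upset]
lemmas qideal_mult2 = mideal_mult2[OF Bs_upset]

lemma wd_1_ee: assumes "tdeg g = 1" shows "\<exists>j. g = ee j"
proof -
  have "(\<Sum>i\<in>UNIV. cf g i) = 1" using assms by (simp add: wd_def)
  then obtain j where j: "0 < cf g j" by (metis gr0I sum.neutral zero_neq_one)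
  have "cf g j + (\<Sum>i\<in>UNIV - {j}. cf g i) = 1" using assms by (simp add: wd_def sum.remove[of UNIV j])
  then have 1: "cf g j = 1" "(\<Sum>i\<in>UNIV - {j}. cf g i) = 0" using j by linarith+
  have "\<forall>i\<in>UNIV - {j}. cf g i = 0" using 1(2) by (simp add: sum_eq_0_iff)
  then have "cf g i = 0" if "i \<noteq> j" for i using that by blast
  then have "g = ee j" using 1(1) by (intro poly_mapping_eqI) (auto simp: lookup_single when_def)
  then show ?thesis by blast
qed

lemma wd_2_ee: assumes "tdeg g = 2" shows "\<exists>i j. g = ee i + ee j"
proof -
  have "g \<noteq> 0" using assms by auto
  then obtain i where "0 < cf g i" by (metis gr0I lookup_zero poly_mapping_eqI)
  then obtain t where t: "g = t + ee i" using ee_divs_iff divs_iff by metis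
  then have "tdeg t = 1" using assms by simp
  then show ?thesis using wd_1_ee t add.commute by metis
qed

lemma ee2_divs: "ee i + ee j \<preceq> m \<longleftrightarrow> (if i = j then 2 \<le> cf m i else 0 < cf m i \<and> 0 < cf m j)"
  by (auto simp: divs_def lookup_add lookup_single when_def split: if_splits)

lemma ee2_eq_iff: "ee i + ee j = ee k + ee l \<longleftrightarrow> (i = k \<and> j = l) \<or> (i = l \<and> j = k)"
proof
  assume a: "ee i + ee j = ee k + ee l"
  have 1: "ee k + ee l \<preceq> ee i + ee j" "ee i + ee j \<preceq> ee k + ee l" using a by simp_all
  show "(i = k \<and> j = l) \<or> (i = l \<and> j = k)"
    using 1 unfolding ee2_divs by (auto simp: lookup_add lookup_single when_def split: if_splits)
qed (auto simp: add.commute)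

text \<open>A quadratic generator that divides \<open>m + ee i\<close> but not \<open>m\<close> uses
  up the new factor, and what remains of it is a single variable. So a colon by a variable only adds
  variables.\<close>

lemma Bs_colon:
  assumes "quad G" "i \<notin> T" "m + ee i \<in> Bs G T"
  shows "m \<in> Bs G (T \<union> Nb G i)"
proof -
  consider g where "g \<in> G" "g \<preceq> m + ee i" | j where "j \<in> T" "0 < cf (m + ee i) j"
    using assms(3) by (auto simp: Bs_def)
  then show ?thesis
  proof cases
    case 1
    obtain k l where g: "g = ee k + ee l" using assms(1) 1 wd_2_ee by (metis quad_def)
    show ?thesis
    proof (cases "g \<preceq> m")
      case True then show ?thesis using 1 by (auto simp: Bs_def)
    next
      case False
      have "\<exists>j. g = ee i + ee j \<and> 0 < cf m j"
        using 1(2) False unfolding g ee2_divs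
        by (auto simp: lookup_add lookup_single when_def ee2_eq_iff split: if_splits)
      then show ?thesis using 1 by (auto simp: Bs_def Nb_def)
    qed
  next
    case 2
    then have "0 < cf m j" using assms(2) by (auto simp: lookup_add lookup_single when_def split: if_splits)
    then show ?thesis using 2 by (auto simp: Bs_def)
  qed
qed

lemma Bs_colon_conv:
  assumes "m \<in> Bs G (T \<union> Nb G i)" shows "m + ee i \<in> Bs G T"
proof -
  consider g where "g \<in> G" "g \<preceq> m" | j where "j \<in> T" "0 < cf m j" | j where "ee i + ee j \<in> G" "0 < cf m j"
    using assms by (auto simp: Bs_def Nb_def)
  then show ?thesis
  proof cases
    case 1 then have "g \<preceq> m + ee i" using divs_trans divs_add2 by blast
    then show ?thesis using 1 by (auto simp: Bs_def)
  next
    case 2 then show ?thesis by (auto simp: Bs_def lookup_add)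
  next
    case 3
    then have "ee i + ee j \<preceq> m + ee i" unfolding ee2_divs by (auto simp: lookup_add lookup_single when_def)
    then show ?thesis using 3 by (auto simp: Bs_def)
  qed
qed

lemma qideal_colon:
  assumes "quad G" "i \<notin> T" "xmon (ee i) * p \<in> qideal G T" shows "p \<in> qideal G (T \<union> Nb G i)"
  using mideal_xmon_mult[OF Bs_colon[OF assms(1,2)] assms(3)] .

lemma qideal_colon_conv:
  assumes "p \<in> qideal G (T \<union> Nb G i)" shows "xmon (ee i) * p \<in> qideal G T"
  unfolding mideal_def
proof (clarify)
  fix m assume "m \<in> ks (xmon (ee i) * p)"
  then have "cf (xmon (ee i) * p) m \<noteq> 0" by (simp add: in_keys_iff)
  then obtain t where t: "m = t + ee i" by (metis cf_xmon_mult_0 divs_iff)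
  with \<open>m \<in> _\<close> have "t \<in> ks p" using cf_xmon_mult_add[of "ee i" p t] by (simp add: in_keys_iff del: cf_xmon_mult_add)
  then show "m \<in> Bs G T" using assms Bs_colon_conv[of t G T i] t by (auto simp: mideal_def)
qed

text \<open>Maximising one exponent among the terms of \<open>p\<close> isolates a single term of the product.\<close>
lemma cf_linear_form_top:
  assumes "m \<in> ks p" "\<And>m'. m' \<in> ks p \<Longrightarrow> cf m' i \<le> cf m i"
  shows "cf (linear_form a * p) (m + ee i) = a i * cf p m"
proof -
  have z: "cf p (m + ee i - ee j) = 0" if "j \<noteq> i" for j
  proof (rule ccontr)
    assume "cf p (m + ee i - ee j) \<noteq> 0"
    then have "m + ee i - ee j \<in> ks p" by (simp add: in_keys_iff)
    then have "cf (m + ee i - ee j) i \<le> cf m i" by (rule assms(2))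
    then show False using that by (simp add: lookup_add lookup_single when_def)
  qed
  have "cf (linear_form a * p) (m + ee i) = (\<Sum>j\<in>UNIV. if j = i then a i * cf p m else 0)"
    unfolding cf_linear_form_mult
    by (intro sum.cong) (use z in \<open>auto simp: lookup_add lookup_single\<close>)
  then show ?thesis by simp
qed

lemma linear_form_top:
  assumes "a i \<noteq> (0::'k::field)" "p \<noteq> 0" "linear_form a * p \<in> mideal B"
  shows "\<exists>m\<in>ks p. (\<forall>m'\<in>ks p. cf m' i \<le> cf m i) \<and> m + ee i \<in> B"
proof -
  have ne: "(\<lambda>m. cf m i) ` ks p \<noteq> {}" "finite ((\<lambda>m. cf m i) ` ks p)" using assms(2) by auto
  then obtain m where m: "m \<in> ks p" "cf m i = Max ((\<lambda>m. cf m i) ` ks p)"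
    using Max_in[OF ne(2,1)] by (auto simp: image_iff)
  then have mx: "cf m' i \<le> cf m i" if "m' \<in> ks p" for m' using ne that by simp
  have "cf (linear_form a * p) (m + ee i) = a i * cf p m" by (rule cf_linear_form_top[OF m(1) mx])
  then have "m + ee i \<in> ks (linear_form a * p)" using assms(1) m(1) by (simp add: in_keys_iff)
  then show ?thesis using m(1) mx assms(3) by (auto simp: mideal_def)
qed

text \<open>A generator has exponent at most 2 in \<open>i\<close>, and 2 only if it is the square.
  Raising an exponent that is already 2, or already 1 when the square is no generator, lets no
  further generator divide.\<close>

lemma qideal_loop:
  assumes "quad G" "m + ee i \<in> Bs G T" "m \<notin> Bs G T" "2 \<le> cf m i \<or> (1 \<le> cf m i \<and> ee i + ee i \<notin> G)"
  shows False
proof -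
  consider g where "g \<in> G" "g \<preceq> m + ee i" | j where "j \<in> T" "0 < cf (m + ee i) j"
    using assms(2) by (auto simp: Bs_def)
  then show ?thesis
  proof cases
    case 1
    obtain k l where g: "g = ee k + ee l" using assms(1) 1 wd_2_ee by (metis quad_def)
    have "g \<preceq> m" using 1 assms(4) unfolding g ee2_divs by (auto simp: lookup_add lookup_single when_def split: if_splits)
    then show ?thesis using 1 assms(3) by (auto simp: Bs_def)
  next
    case 2
    then have "0 < cf m j" using assms(4) by (auto simp: lookup_add lookup_single when_def split: if_splits)
    then show ?thesis using 2 assms(3) by (auto simp: Bs_def)
  qed
qed

lemma wd_large: assumes "card (UNIV :: 'n::finite set) < tdeg (m :: 'n \<Rightarrow>\<^sub>0 nat)" shows "\<exists>i. 2 \<le> cf m i"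
proof (rule ccontr)
  assume "\<not> ?thesis"
  then have "cf m i \<le> 1" for i by (metis not_less_eq_eq numeral_2_eq_2 One_nat_def)
  then have "tdeg m \<le> (\<Sum>i\<in>(UNIV::'n set). 1)" unfolding wd_def by (intro sum_mono) auto
  then show False using assms by simp
qed

text \<open>Above degree n some term outside the ideal has an exponent at least 2, in a variable
  \<open>i\<close> say. A term of the normal form with maximal exponent in \<open>i\<close> then
  survives multiplication by the linear form.\<close>

lemma qideal_large:
  fixes p :: "('n::finite, 'k::field) mpoly"
  assumes "\<And>i. a i \<noteq> 0" "quad G" "homog k p" "int (card (UNIV :: 'n set)) < k" "linear_form a * p \<in> qideal G T"
  shows "p \<in> qideal G T"
proof -
  define p0 where "p0 = restr (- Bs G T) p"
  have pp: "p - p0 \<in> qideal G T" unfolding p0_def by (rule mideal_restr_compl)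
  have "linear_form a * p0 = linear_form a * p - linear_form a * (p - p0)" by (simp add: algebra_simps)
  then have l: "linear_form a * p0 \<in> qideal G T" using assms(5) qideal_mult[OF pp] mideal_diff by metis
  have "p0 = 0"
  proof (rule ccontr)
    assume "p0 \<noteq> 0"
    then obtain m0 where m0: "m0 \<in> ks p0" by (metis all_not_in_conv keys_eq_empty)
    have "homog k p0" unfolding p0_def by (rule hom_restr[OF assms(3)])
    then have "int (tdeg m0) = k" using m0 by (auto simp: hom_def)
    then obtain i where i: "2 \<le> cf m0 i" using wd_large[of m0] assms(4) by auto
    obtain m where m: "m \<in> ks p0" "\<And>m'. m' \<in> ks p0 \<Longrightarrow> cf m' i \<le> cf m i" "m + ee i \<in> Bs G T"
      using linear_form_top[OF assms(1) \<open>p0 \<noteq> 0\<close> l] by blast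
    have "m \<notin> Bs G T" using m(1) by (auto simp: p0_def keys_restr)
    moreover have "2 \<le> cf m i" using m(2)[OF m0] i by simp
    ultimately show False using qideal_loop[OF assms(2) m(3)] by blast
  qed
  then show ?thesis using pp by simp
qed

subsection \<open>The descent\<close>

text \<open>Only the nontrivial inclusion of exactness in degree \<open>j\<close>; the other one is
  carried by hypotheses of the form \<open>A * B \<in> qideal G {}\<close>.\<close>

definition exact_at ::
  "('n::finite \<Rightarrow>\<^sub>0 nat) set \<Rightarrow> ('n, 'k::comm_ring_1) mpoly \<Rightarrow> ('n, 'k) mpoly \<Rightarrow> 'n set \<Rightarrow> int \<Rightarrow> bool"
  where "exact_at G A B T j \<longleftrightarrow>
    (\<forall>p. homog j p \<longrightarrow> A * p \<in> qideal G T \<longrightarrow> (\<exists>w. p - B * w \<in> qideal G T))"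

text \<open>Exactness is needed for all sets \<open>T\<close> at once: the colon ideal of \<open>(G, x\<^sub>i | i \<in> T)\<close> by a variable
  outside \<open>T\<close> is an ideal of the same shape.\<close>
lemma exact_lift:
  fixes A B p :: "('n::finite, 'k::comm_ring_1) mpoly"
  assumes quad: "quad G" and A: "homog \<alpha> A" and AB: "A * B \<in> qideal G {}"
    and H: "\<And>T. exact_at G B A T (j + \<alpha> - 1)"
  shows "homog j p \<Longrightarrow> A * p \<in> qideal G T \<Longrightarrow>
    \<exists>u. homog j u \<and> A * u \<in> qideal G {} \<and> p - u \<in> qideal G T"
  using finite[of T]
proof (induction T arbitrary: p rule: finite_induct)
  case empty
  then show ?case by (intro exI[of _ p]) auto
next
  case (insert i T)
  let ?x = "xmon (ee i) :: ('n, 'k) mpoly"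
  define r where "r = restr (- Bs G T) (A * p)"
  define v where "v = dv (ee i) r"
  have "ee i \<preceq> m" if "m \<in> ks r" for m
  proof -
    have "m \<in> Bs G (insert i T)" "m \<notin> Bs G T"
      using that insert.prems(2) by (auto simp: r_def keys_restr mideal_def)
    then show ?thesis unfolding ee_divs_iff Bs_def by auto
  qed
  then have rv: "?x * v = r" unfolding v_def by (rule xmon_dv)
  have "homog (j + \<alpha>) r"
    unfolding r_def using hom_mult[OF insert.prems(1) A] by (intro hom_restr) (simp add: mult.commute)
  then have v: "homog (j + \<alpha> - 1) v" unfolding v_def using hom_dv[of UNIV "j + \<alpha>" r "ee i"] by simp
  have Ap: "A * p - ?x * v \<in> qideal G T" unfolding rv r_def by (rule mideal_restr_compl)
  have "?x * (B * v) = A * B * p - B * (A * p - ?x * v)" by (simp add: algebra_simps)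
  moreover have "A * B * p \<in> qideal G T" using qideal_mult2[OF qideal_mono[OF _ _ AB]] by blast
  ultimately have "?x * (B * v) \<in> qideal G T" using qideal_mult[OF Ap] mideal_diff by metis
  then have "B * v \<in> qideal G (T \<union> Nb G i)" using qideal_colon[OF quad insert.hyps(2)] by blast
  then obtain w where "v - A * w \<in> qideal G (T \<union> Nb G i)" using H v unfolding exact_at_def by blast
  then obtain w where w: "homog (j - 1) w" "v - A * w \<in> qideal G (T \<union> Nb G i)"
    using hom_mideal_homogenise[OF v A] by (metis add.commute add_diff_cancel_right' diff_add_eq diff_diff_eq2)
  define p' where "p' = p - ?x * w"
  have "homog j p'" unfolding p'_def
    using hom_mult[OF hom_xmon[of UNIV "ee i"] w(1)] by (intro hom_diff insert.prems(1)) simp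
  moreover have "A * p' = (A * p - ?x * v) + ?x * (v - A * w)" by (simp add: p'_def algebra_simps)
  then have "A * p' \<in> qideal G T" using Ap qideal_colon_conv[OF w(2)] mideal_add by metis
  ultimately obtain u where u: "homog j u" "A * u \<in> qideal G {}" "p' - u \<in> qideal G T"
    using insert.IH by blast
  have "?x * w \<in> qideal G (insert i T)"
  proof -
    have "?x \<in> qideal G (insert i T)" by (simp add: mideal_def Bs_def lookup_single)
    then show ?thesis by (rule qideal_mult2)
  qed
  moreover have "p' - u \<in> qideal G (insert i T)" by (rule qideal_mono[OF _ _ u(3)]) auto
  ultimately have "(p' - u) + ?x * w \<in> qideal G (insert i T)" by (rule mideal_add[rotated])
  then show ?case using u by (intro exI[of _ u]) (simp add: p'_def algebra_simps)
qed

text \<open>An element annihilated modulo \<open>T\<close> lifts to one annihilated modulo the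
  generators alone, where exactness is assumed.\<close>

lemma exact_all:
  fixes A B :: "('n::finite, 'k::comm_ring_1) mpoly"
  assumes "quad G" "homog \<alpha> A" "A * B \<in> qideal G {}"
    and "\<And>T. exact_at G B A T (j + \<alpha> - 1)" "exact_at G A B {} j"
  shows "exact_at G A B T j"
  unfolding exact_at_def
proof (intro allI impI)
  fix p assume "homog j p" "A * p \<in> qideal G T"
  then obtain u where u: "homog j u" "A * u \<in> qideal G {}" "p - u \<in> qideal G T"
    using exact_lift[OF assms(1-4)] by blast
  then obtain w where "u - B * w \<in> qideal G {}" using assms(5) unfolding exact_at_def by blast
  then have "u - B * w \<in> qideal G T" using qideal_mono by blast
  then have "(p - u) + (u - B * w) \<in> qideal G T" using u(3) mideal_add by blast
  then show "\<exists>w. p - B * w \<in> qideal G T" by auto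
qed

text \<open>One round, \<open>ev\<close> then \<open>od\<close>, passes from degree j + d - 1 to j,
  a strict decrease as d is at least 2. Both steps are hypotheses because the monomial and the
  binomial case prove them differently.\<close>

lemma descent_False:
  fixes Q :: "('n::finite, 'k::comm_ring_1) mpoly"
  assumes quad: "quad G" and d: "d \<ge> 2" and Q: "homog d Q"
    and large: "\<And>j T. M \<le> j \<Longrightarrow> exact_at G (linear_form a) Q T j"
    and ev: "\<And>j. (\<And>T. exact_at G (linear_form a) Q T (j + d - 1)) \<Longrightarrow> \<forall>T. exact_at G Q (linear_form a) T j"
    and od: "\<And>j. (\<And>T. exact_at G Q (linear_form a) T j) \<Longrightarrow> \<forall>T. exact_at G (linear_form a) Q T j"
  shows False
proof -
  have "\<forall>T. exact_at G (linear_form a) Q T j" if "M - int k \<le> j" for k j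
    using that
  proof (induction k arbitrary: j)
    case 0
    then show ?case using large by auto
  next
    case (Suc k)
    have "M - int k \<le> j + d - 1" using Suc.prems d by simp
    then have "\<forall>T. exact_at G Q (linear_form a) T j" using ev Suc.IH by blast
    then show ?case using od by blast
  qed
  \<comment> \<open>The number of rounds is chosen to reach degree \<open>d - 1\<close>, from which
    \<open>ev\<close> yields degree 0.\<close>
  from this[of "nat (M - d + 1)" "0 + d - 1"] have "\<forall>T. exact_at G (linear_form a) Q T (0 + d - 1)"
    by auto
  then have e: "exact_at G Q (linear_form a) UNIV 0" using ev by blast
  have "g \<notin> G" if "g \<preceq> 0" for g
  proof -
    have "g = 0" using that by (intro poly_mapping_eqI) (simp add: divs_def)
    then show ?thesis using quad by (auto simp: quad_def)
  qed
  then have z: "0 \<notin> Bs G UNIV" by (auto simp: Bs_def)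
  have "m \<in> Bs G UNIV" if "m \<in> ks Q" for m
  proof -
    have "m \<noteq> 0" using Q that d unfolding hom_def by fastforce
    then have "\<exists>i. 0 < cf m i" by (metis gr0I lookup_zero poly_mapping_eqI)
    then show ?thesis by (auto simp: Bs_def)
  qed
  then have "Q * 1 \<in> qideal G UNIV" by (auto simp: mideal_def)
  moreover have "homog 0 (1 :: ('n, 'k) mpoly)" by (simp add: hom_def)
  ultimately obtain w where "1 - linear_form a * w \<in> qideal G UNIV" using e unfolding exact_at_def by blast
  moreover have "cf (1 - linear_form a * w) 0 = 1" by (simp add: lookup_minus cf_linear_form_mult)
  ultimately show False using z by (metis (no_types, lifting) in_keys_iff mideal_def mem_Collect_eq subsetD zero_neq_one)
qed

subsection \<open>Dimension counts\<close>

lemma const_add: "const (c + d) = const c + const d" by (simp add: const_def single_add)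
lemma const_mult: "const (c * d) = const c * const d" by (simp add: const_def mult_single)
lemma const_1 [simp]: "const 1 = 1" by (simp add: const_def)
lemma const_0 [simp]: "const 0 = 0" by (simp add: const_def)
lemma const_uminus: "const (- c) = - const c" by (simp add: const_def single_uminus)

global_interpretation pv: vector_space "\<lambda>(c :: 'k::field) (p :: ('n, 'k) mpoly). const c * p"
  by unfold_locales (simp_all add: const_add const_mult algebra_simps)

text \<open>\<open>pv.dim\<close> takes the default value 0 on infinite-dimensional spaces, so
  comparisons of dimensions need this guard.\<close>

definition fdim :: "('n, 'k::field) mpoly set \<Rightarrow> bool" where
  "fdim A \<longleftrightarrow> pv.subspace A \<and> (\<exists>S. finite S \<and> A \<subseteq> pv.span S)"

lemma fdim_subspace: "fdim A \<Longrightarrow> pv.subspace B \<Longrightarrow> B \<subseteq> A \<Longrightarrow> fdim B"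
  unfolding fdim_def by blast

lemma fdim_finite_indep: "fdim A \<Longrightarrow> S \<subseteq> A \<Longrightarrow> pv.independent S \<Longrightarrow> finite S"
  unfolding fdim_def by (metis pv.independent_span_bound subset_trans)

lemma fdim_basis:
  assumes "fdim A" "S \<subseteq> A" "pv.independent S"
  obtains C where "S \<subseteq> C" "C \<subseteq> A" "pv.independent C" "pv.span C = A" "finite C" "card C = pv.dim A"
proof -
  obtain C where C: "S \<subseteq> C" "C \<subseteq> A" "pv.independent C" "A \<subseteq> pv.span C"
    using pv.maximal_independent_subset_extend[OF assms(2,3)] by blast
  have "pv.span C \<subseteq> A" using C(2) assms(1) by (simp add: fdim_def pv.span_minimal)
  then show ?thesis using that C fdim_finite_indep[OF assms(1) C(2,3)] pv.basis_card_eq_dim[of C A] by blast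
qed

lemma fdim_basis0:
  assumes "fdim A"
  obtains C where "C \<subseteq> A" "pv.independent C" "pv.span C = A" "finite C" "card C = pv.dim A"
  using fdim_basis[OF assms, of "{}"] pv.independent_empty by blast

lemma fdim_dim_mono: assumes "fdim A" "pv.subspace B" "B \<subseteq> A" shows "pv.dim B \<le> pv.dim A"
proof -
  obtain b where b: "b \<subseteq> B" "pv.independent b" "pv.span b = B" "finite b" "card b = pv.dim B"
    by (rule fdim_basis0[OF fdim_subspace[OF assms]])
  then have bA: "b \<subseteq> A" using assms(3) by blast
  obtain a where "b \<subseteq> a" "a \<subseteq> A" "pv.independent a" "pv.span a = A" "finite a" "card a = pv.dim A"
    by (rule fdim_basis[OF assms(1) bA b(2)])
  then show ?thesis using card_mono[of a b] b by simp
qed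

lemma fdim_dim_eq:
  assumes "fdim A" "pv.subspace B" "B \<subseteq> A" "pv.dim A \<le> pv.dim B" shows "A = B"
proof -
  obtain b where b: "b \<subseteq> B" "pv.independent b" "pv.span b = B" "finite b" "card b = pv.dim B"
    by (rule fdim_basis0[OF fdim_subspace[OF assms(1-3)]])
  then have bA: "b \<subseteq> A" using assms(3) by blast
  obtain a where a: "b \<subseteq> a" "a \<subseteq> A" "pv.independent a" "pv.span a = A" "finite a" "card a = pv.dim A"
    by (rule fdim_basis[OF assms(1) bA b(2)])
  have "b = a" by (rule card_seteq[OF a(5,1)]) (use a b assms(4) in simp)
  then show ?thesis using b a by simp
qed

text \<open>Multiplication by \<open>q\<close> induces an isomorphism from A/B to A'/B'; the
  equality of dimensions is written with sums because they are natural numbers. No quotient is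
  formed: a basis of a complement of \<open>B\<close> is mapped to one of a complement of
  \<open>B'\<close>.\<close>

lemma dim_quot:
  fixes q :: "('n, 'k::field) mpoly"
  assumes A: "fdim A" and B: "pv.subspace B" "B \<subseteq> A"
    and A': "fdim A'" and B': "pv.subspace B'" "B' \<subseteq> A'"
    and ker: "\<And>x. x \<in> A \<Longrightarrow> q * x \<in> B' \<longleftrightarrow> x \<in> B"
    and img: "\<And>x. x \<in> A \<Longrightarrow> q * x \<in> A'"
    and sur: "\<And>y. y \<in> A' \<Longrightarrow> \<exists>x\<in>A. y - q * x \<in> B'"
  shows "pv.dim A + pv.dim B' = pv.dim A' + pv.dim B"
proof -
  have sA: "pv.subspace A" "pv.subspace A'" using A A' by (auto simp: fdim_def)
  obtain b where b: "b \<subseteq> B" "pv.independent b" "pv.span b = B" "finite b" "card b = pv.dim B"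
    by (rule fdim_basis0[OF fdim_subspace[OF A B]])
  have bA: "b \<subseteq> A" using b(1) B(2) by blast
  obtain a where a: "b \<subseteq> a" "a \<subseteq> A" "pv.independent a" "pv.span a = A" "finite a" "card a = pv.dim A"
    by (rule fdim_basis[OF A bA b(2)])
  obtain b' where b': "b' \<subseteq> B'" "pv.independent b'" "pv.span b' = B'" "finite b'" "card b' = pv.dim B'"
    by (rule fdim_basis0[OF fdim_subspace[OF A' B']])
  define C where "C = a - b"
  have fC: "finite C" using a by (simp add: C_def)
  have sumC: "(\<Sum>c\<in>C. const (u c) * c) \<in> A" for u
    by (rule pv.subspace_sum[OF sA(1)]) (use a sA(1) in \<open>auto simp: C_def intro: pv.subspace_scale\<close>)
  \<comment> \<open>Independence of the images modulo \<open>B'\<close>: a relation among them is a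
    relation between \<open>C\<close> and \<open>b\<close>, hence one within the basis
    \<open>a\<close>.\<close>
  have zero: "u c = 0" if "q * (\<Sum>c\<in>C. const (u c) * c) \<in> B'" "c \<in> C" for u c
  proof -
    have "(\<Sum>c\<in>C. const (u c) * c) \<in> pv.span b" using ker[OF sumC[of u]] that b(3) by simp
    then obtain w where w: "(\<Sum>c\<in>C. const (u c) * c) = (\<Sum>v\<in>b. const (w v) * v)"
      using pv.span_finite[OF b(4)] by auto
    define x where "x v = (if v \<in> C then u v else - w v)" for v
    have "(\<Sum>v\<in>a. const (x v) * v) = (\<Sum>v\<in>C. const (x v) * v) + (\<Sum>v\<in>b. const (x v) * v)"
    proof -
      have "a = C \<union> b" "C \<inter> b = {}" using a(1) by (auto simp: C_def)
      then show ?thesis using sum.union_disjoint[OF fC b(4), of "\<lambda>v. const (x v) * v"] by simp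
    qed
    also have "(\<Sum>v\<in>C. const (x v) * v) = (\<Sum>c\<in>C. const (u c) * c)" by (simp add: x_def)
    also have "(\<Sum>v\<in>b. const (x v) * v) = - (\<Sum>v\<in>b. const (w v) * v)"
      unfolding sum_negf[symmetric] by (intro sum.cong) (auto simp: x_def C_def const_uminus)
    finally have "(\<Sum>v\<in>a. const (x v) * v) = 0" using w by simp
    then have "x c = 0" using a(3,5) that(2) unfolding pv.dependent_finite[OF a(5)] C_def by blast
    then show ?thesis using that(2) by (simp add: x_def)
  qed
  have inj: "inj_on ((*) q) C"
  proof (rule inj_onI, rule ccontr)
    fix c c' assume cc: "c \<in> C" "c' \<in> C" "q * c = q * c'" "c \<noteq> c'"
    define u where "u v = (if v = c then 1 else if v = c' then - 1 else (0 :: 'k))" for v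
    have "(\<Sum>v\<in>C. const (u v) * v) = (\<Sum>v\<in>{c, c'}. const (u v) * v)"
      using cc fC by (intro sum.mono_neutral_right) (auto simp: u_def)
    also have "\<dots> = c - c'" using cc by (simp add: u_def const_uminus)
    finally have eq: "(\<Sum>v\<in>C. const (u v) * v) = c - c'" .
    have "q * (\<Sum>v\<in>C. const (u v) * v) = 0" unfolding eq by (simp add: right_diff_distrib cc(3))
    then have "q * (\<Sum>v\<in>C. const (u v) * v) \<in> B'" using pv.subspace_0[OF B'(1)] by simp
    then have "u c = 0" using zero[of u c] cc(1) by blast
    then show False by (simp add: u_def)
  qed
  have dis: "(*) q ` C \<inter> b' = {}"
  proof (rule ccontr)
    assume "(*) q ` C \<inter> b' \<noteq> {}"
    then obtain c where c: "c \<in> C" "q * c \<in> B'" using b'(1) by blast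
    define u where "u v = (if v = c then 1 else (0 :: 'k))" for v
    have "(\<Sum>v\<in>C. const (u v) * v) = (\<Sum>v\<in>{c}. const (u v) * v)"
      using c fC by (intro sum.mono_neutral_right) (auto simp: u_def)
    then have "(\<Sum>v\<in>C. const (u v) * v) = c" by (simp add: u_def)
    then have "u c = 0" using zero[of u c] c by simp
    then show False by (simp add: u_def)
  qed
  let ?D = "(*) q ` C \<union> b'"
  have fD: "finite ?D" using fC b' by simp
  have sumD: "(\<Sum>v\<in>?D. const (u v) * v) = q * (\<Sum>c\<in>C. const (u (q * c)) * c) + (\<Sum>v\<in>b'. const (u v) * v)" for u
  proof -
    have "(\<Sum>v\<in>?D. const (u v) * v) = (\<Sum>v\<in>(*) q ` C. const (u v) * v) + (\<Sum>v\<in>b'. const (u v) * v)"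
      using fC b'(4) dis by (intro sum.union_disjoint) auto
    also have "(\<Sum>v\<in>(*) q ` C. const (u v) * v) = (\<Sum>c\<in>C. const (u (q * c)) * (q * c))"
      by (simp add: sum.reindex[OF inj])
    finally show ?thesis by (simp add: sum_distrib_left mult.left_commute)
  qed
  have "pv.independent ?D"
    unfolding pv.dependent_finite[OF fD]
  proof (rule notI, elim exE conjE bexE)
    fix u v assume u: "(\<Sum>v\<in>?D. const (u v) * v) = 0" "v \<in> ?D" "u v \<noteq> 0"
    have t: "(\<Sum>v\<in>b'. const (u v) * v) \<in> B'"
      by (rule pv.subspace_sum[OF B'(1)]) (use b'(1) B'(1) in \<open>auto intro: pv.subspace_scale\<close>)
    have "q * (\<Sum>c\<in>C. const (u (q * c)) * c) = - (\<Sum>v\<in>b'. const (u v) * v)"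
      using u(1) unfolding sumD by (simp add: eq_neg_iff_add_eq_0)
    then have "q * (\<Sum>c\<in>C. const (u (q * c)) * c) \<in> B'" using t B'(1) by (simp add: pv.subspace_neg)
    then have c0: "u (q * c) = 0" if "c \<in> C" for c using zero[of "\<lambda>c. u (q * c)" c] that by blast
    then have "(\<Sum>v\<in>b'. const (u v) * v) = 0" using u(1) unfolding sumD by simp
    then have "u v = 0" if "v \<in> b'" using b'(2) that unfolding pv.dependent_finite[OF b'(4)] by blast
    then show False using u c0 by auto
  qed
  moreover have "?D \<subseteq> A'" using img a(2) b'(1) B'(2) by (auto simp: C_def)
  moreover have "A' \<subseteq> pv.span ?D"
  proof
    fix y assume "y \<in> A'"
    then obtain x where x: "x \<in> A" "y - q * x \<in> B'" using sur by blast
    have "a = b \<union> C" using a(1) by (auto simp: C_def)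
    then obtain x1 x2 where x12: "x = x1 + x2" "x1 \<in> pv.span b" "x2 \<in> pv.span C"
      using x(1) a(4) pv.span_Un[of b C] by blast
    have "x1 \<in> B" "x1 \<in> A" using x12 b(3) B(2) by auto
    then have "q * x1 \<in> B'" using ker by blast
    then have 1: "(y - q * x) + q * x1 \<in> pv.span b'" using x(2) B'(1) b'(3) by (simp add: pv.subspace_add)
    obtain u where u: "x2 = (\<Sum>c\<in>C. const (u c) * c)" using x12(3) pv.span_finite[OF fC] by auto
    have "q * x2 = (\<Sum>c\<in>C. const (u c) * (q * c))" by (simp add: u sum_distrib_left mult.left_commute)
    also have "\<dots> \<in> pv.span ((*) q ` C)"
      by (intro pv.span_sum pv.span_scale pv.span_base) auto
    finally have "q * x2 \<in> pv.span ?D" using pv.span_mono[of "(*) q ` C" ?D] by blast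
    moreover have "(y - q * x) + q * x1 \<in> pv.span ?D" using 1 pv.span_mono[of b' ?D] by blast
    ultimately have "((y - q * x) + q * x1) + q * x2 \<in> pv.span ?D" by (rule pv.span_add[rotated])
    then show "y \<in> pv.span ?D" by (simp add: x12(1) algebra_simps)
  qed
  ultimately have "card ?D = pv.dim A'" using pv.basis_card_eq_dim by blast
  moreover have "card ?D = card C + card b'"
    using fC b'(4) dis by (simp add: card_Un_disjoint card_image[OF inj])
  moreover have "card a = card C + card b" using a(1,5) b(4) by (simp add: C_def card_Diff_subset card_mono)
  ultimately show ?thesis using a b b' by simp
qed

section \<open>Graded pieces, homogeneous ideals and Hilbert functions\<close>

definition Pk :: "int \<Rightarrow> ('n::finite, 'k::field) mpoly set" where "Pk k = {p. homog k p}"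

lemma Pk_subspace: "pv.subspace (Pk k)"
  by (simp add: pv.subspace_def Pk_def hom_add hom_const_mult)

lemma finite_wd: "finite {m :: 'n::finite \<Rightarrow>\<^sub>0 nat. int (tdeg m) = k}"
proof -
  have "finite {f :: 'n \<Rightarrow> nat. \<forall>i. (i \<in> UNIV \<longrightarrow> f i \<in> {..nat k}) \<and> (i \<notin> UNIV \<longrightarrow> f i = 0)}"
    by (rule finite_set_of_finite_funs) auto
  moreover have "cf ` {m :: 'n \<Rightarrow>\<^sub>0 nat. int (tdeg m) = k} \<subseteq> {f. \<forall>i. (i \<in> UNIV \<longrightarrow> f i \<in> {..nat k}) \<and> (i \<notin> UNIV \<longrightarrow> f i = 0)}"
  proof clarsimp
    fix m :: "'n \<Rightarrow>\<^sub>0 nat" and i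
    show "cf m i \<le> tdeg m" unfolding wd_def by (rule member_le_sum) auto
  qed
  ultimately have "finite (cf ` {m :: 'n \<Rightarrow>\<^sub>0 nat. int (tdeg m) = k})" by (rule finite_subset[rotated])
  moreover have "inj_on cf {m :: 'n \<Rightarrow>\<^sub>0 nat. int (tdeg m) = k}"
    by (rule inj_onI, rule poly_mapping_eqI) simp
  ultimately show ?thesis by (rule finite_imageD)
qed

lemma Pk_fdim: "fdim (Pk k :: ('n::finite, 'k::field) mpoly set)"
  unfolding fdim_def
proof (intro conjI exI)
  let ?S = "xmon ` {m :: 'n \<Rightarrow>\<^sub>0 nat. int (tdeg m) = k} :: ('n, 'k) mpoly set"
  show "finite ?S" using finite_wd by blast
  show "Pk k \<subseteq> pv.span ?S"
  proof
    fix p :: "('n, 'k) mpoly" assume "p \<in> Pk k"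
    then have "(\<Sum>m\<in>ks p. const (cf p m) * xmon m) \<in> pv.span ?S"
      by (intro pv.span_sum pv.span_scale pv.span_base) (auto simp: Pk_def hom_def)
    then show "p \<in> pv.span ?S" by (simp only: poly_expand[symmetric])
  qed
qed (rule Pk_subspace)

lemma Pk_neg: "k < 0 \<Longrightarrow> Pk k = {0}" using hom_neg by (auto simp: Pk_def)

definition hideal :: "('n::finite, 'k::field) mpoly set \<Rightarrow> bool" where
  "hideal I \<longleftrightarrow> 0 \<in> I \<and> (\<forall>p\<in>I. \<forall>q\<in>I. p + q \<in> I) \<and> (\<forall>p\<in>I. \<forall>q. q * p \<in> I) \<and> (\<forall>p\<in>I. \<forall>k. hp UNIV k p \<in> I)"

lemma hidealD: assumes "hideal I"
  shows "0 \<in> I" "p \<in> I \<Longrightarrow> q \<in> I \<Longrightarrow> p + q \<in> I" "p \<in> I \<Longrightarrow> q * p \<in> I" "p \<in> I \<Longrightarrow> p * q \<in> I"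
    "p \<in> I \<Longrightarrow> hp UNIV k p \<in> I" "p \<in> I \<Longrightarrow> q \<in> I \<Longrightarrow> p - q \<in> I" "p \<in> I \<Longrightarrow> - p \<in> I"
proof -
  show m: "p \<in> I \<Longrightarrow> q * p \<in> I" for p q using assms by (simp add: hideal_def)
  show a: "p \<in> I \<Longrightarrow> q \<in> I \<Longrightarrow> p + q \<in> I" for p q using assms by (simp add: hideal_def)
  show u: "p \<in> I \<Longrightarrow> - p \<in> I" for p using m[of p "- 1"] by simp
  show "p \<in> I \<Longrightarrow> q \<in> I \<Longrightarrow> p - q \<in> I" using a[OF _ u] by simp
  show "0 \<in> I" "p \<in> I \<Longrightarrow> hp UNIV k p \<in> I" using assms by (auto simp: hideal_def)
  show "p \<in> I \<Longrightarrow> p * q \<in> I" using m[of p q] by (simp add: mult.commute)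
qed

lemma hideal_subspace: "hideal I \<Longrightarrow> pv.subspace I"
  by (simp add: pv.subspace_def hidealD)

lemma hideal_homogenise:
  assumes "hideal I" "homog k p" "homog d q" "p - q * w \<in> I"
  shows "\<exists>w'. homog (k - d) w' \<and> p - q * w' \<in> I"
proof -
  have "hp UNIV k (p - q * w) \<in> I" using hidealD(5)[OF assms(1,4)] .
  then show ?thesis by (metis hp_diff hp_hom[OF assms(2)] hp_mult[OF assms(3)] hom_hp)
qed

lemma qideal_hideal: "hideal (qideal G T)"
  by (auto simp: hideal_def mideal_add qideal_mult hp_in_mideal)

text \<open>The degree \<open>k\<close> part of I + (q).\<close>

definition modk :: "('n::finite, 'k::field) mpoly set \<Rightarrow> ('n, 'k) mpoly \<Rightarrow> int \<Rightarrow> ('n, 'k) mpoly set" where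
  "modk I q k = {p \<in> Pk k. \<exists>w. p - q * w \<in> I}"

lemma modk_subspace: assumes "hideal I" shows "pv.subspace (modk I q k)"
  unfolding pv.subspace_def
proof (intro conjI ballI allI)
  show "0 \<in> modk I q k" using hidealD(1)[OF assms] by (auto simp: modk_def Pk_def intro: exI[of _ 0])
  fix x y :: "('a, 'b) mpoly" and c
  assume x: "x \<in> modk I q k"
  then obtain w where w: "x - q * w \<in> I" by (auto simp: modk_def)
  have "const c * (x - q * w) \<in> I" by (rule hidealD(3)[OF assms w])
  then have "const c * x - q * (const c * w) \<in> I" by (simp add: algebra_simps)
  then show "const c * x \<in> modk I q k" using x by (auto simp: modk_def Pk_def intro: hom_const_mult)
  assume y: "y \<in> modk I q k"
  then obtain v where v: "y - q * v \<in> I" by (auto simp: modk_def)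
  have "(x - q * w) + (y - q * v) \<in> I" by (rule hidealD(2)[OF assms w v])
  then have "(x + y) - q * (w + v) \<in> I" by (simp add: algebra_simps)
  then show "x + y \<in> modk I q k" using x y by (auto simp: modk_def Pk_def intro: hom_add)
qed

lemma modk_Pk: "modk I q k \<subseteq> Pk k" by (auto simp: modk_def)

lemma Pk_Int_subspace: "hideal I \<Longrightarrow> pv.subspace (Pk k \<inter> I)"
  by (intro pv.subspace_inter Pk_subspace hideal_subspace)

text \<open>Multiplication by \<open>q\<close> identifies P/(I : q) in degree k - d with (I + (q))/I
  in degree k; \<open>K\<close> is the degree k - d part of (I : q).\<close>

lemma dim_mult:
  fixes q :: "('n::finite, 'k::field) mpoly"
  assumes I: "hideal I" and q: "homog d q"
    and ker: "\<And>p. homog (k - d) p \<Longrightarrow> q * p \<in> I \<longleftrightarrow> p \<in> K" and K: "pv.subspace K" "K \<subseteq> (Pk (k - d) :: ('n, 'k) mpoly set)"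
  shows "pv.dim (Pk (k - d) :: ('n, 'k) mpoly set) + pv.dim (Pk k \<inter> I) = pv.dim (modk I q k) + pv.dim K"
proof (rule dim_quot)
  have sub: "q * x \<in> Pk k" if "x \<in> Pk (k - d)" for x using hom_mult[OF q, of "k - d" x] that by (simp add: Pk_def)
  show "fdim (modk I q k)" by (rule fdim_subspace[OF Pk_fdim modk_subspace[OF I] modk_Pk])
  show "Pk k \<inter> I \<subseteq> modk I q k" by (auto simp: modk_def intro: exI[of _ 0])
  show "q * x \<in> Pk k \<inter> I \<longleftrightarrow> x \<in> K" if "x \<in> Pk (k - d)" for x using sub[OF that] ker that by (auto simp: Pk_def)
  show "q * x \<in> modk I q k" if "x \<in> Pk (k - d)" for x
    using sub[OF that] hidealD(1)[OF I] by (auto simp: modk_def intro: exI[of _ x])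
  fix y assume y: "y \<in> modk I q k"
  then obtain w0 where w0: "homog k y" "y - q * w0 \<in> I" by (auto simp: modk_def Pk_def)
  obtain w where w: "homog (k - d) w" "y - q * w \<in> I"
    using hideal_homogenise[OF I w0(1) q w0(2)] by blast
  have "y - q * w \<in> Pk k" using y sub w(1) by (auto simp: modk_def Pk_def intro: hom_diff)
  then show "\<exists>x\<in>Pk (k - d). y - q * x \<in> Pk k \<inter> I" using w by (auto simp: Pk_def)
qed (use I K in \<open>auto intro: Pk_fdim Pk_Int_subspace\<close>)

text \<open>With \<open>r\<close>, \<open>b\<close>, \<open>c\<close> the dimensions in degree \<open>k\<close> of \<open>P/I\<close>, \<open>P/(I + l)\<close> and \<open>P/(I + Q)\<close>,
  exactness gives \<open>r k = b k + c (k - 1) = c k + b (k - d)\<close>, hence \<open>c k = b k + \<dots> + b (k - d + 1)\<close>.\<close>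
lemma exact_pair_artinian:
  fixes l Q :: "('n::finite, 'k::field) mpoly"
  assumes I: "hideal I" and l: "homog 1 l" and Q: "homog (int d) Q" and lQ: "l * Q \<in> I"
    and ex1: "\<And>p. l * p \<in> I \<Longrightarrow> \<exists>w. p - Q * w \<in> I"
    and ex2: "\<And>p. Q * p \<in> I \<Longrightarrow> \<exists>w. p - l * w \<in> I"
    and large: "\<And>k p. N \<le> k \<Longrightarrow> homog k p \<Longrightarrow> Q * p \<in> I"
  shows "\<exists>M. \<forall>k\<ge>M. \<forall>p. homog k p \<longrightarrow> p \<in> I"
proof -
  define r where "r k = int (pv.dim (Pk k :: ('n, 'k) mpoly set)) - int (pv.dim (Pk k \<inter> I))" for k
  define b where "b k = int (pv.dim (Pk k :: ('n, 'k) mpoly set)) - int (pv.dim (modk I l k))" for k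
  define c where "c k = int (pv.dim (Pk k :: ('n, 'k) mpoly set)) - int (pv.dim (modk I Q k))" for k
  have k1: "l * p \<in> I \<longleftrightarrow> p \<in> modk I Q k" if "homog k p" for p k
  proof
    assume "p \<in> modk I Q k"
    then obtain w where w: "p - Q * w \<in> I" by (auto simp: modk_def)
    have "l * (p - Q * w) + (l * Q) * w \<in> I"
      by (rule hidealD(2)[OF I hidealD(3)[OF I w] hidealD(4)[OF I lQ]])
    then show "l * p \<in> I" by (simp add: algebra_simps)
  qed (use ex1 that in \<open>auto simp: modk_def Pk_def\<close>)
  have k2: "Q * p \<in> I \<longleftrightarrow> p \<in> modk I l k" if "homog k p" for p k
  proof
    assume "p \<in> modk I l k"
    then obtain w where w: "p - l * w \<in> I" by (auto simp: modk_def)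
    have "Q * (p - l * w) + (l * Q) * w \<in> I"
      by (rule hidealD(2)[OF I hidealD(3)[OF I w] hidealD(4)[OF I lQ]])
    then show "Q * p \<in> I" by (simp add: algebra_simps)
  qed (use ex2 that in \<open>auto simp: modk_def Pk_def\<close>)
  have 1: "r k = b k + c (k - 1)" for k
    using dim_mult[OF I l, of k "modk I Q (k - 1)"] k1 modk_subspace[OF I] modk_Pk
    unfolding r_def b_def c_def by fastforce
  have 2: "r k = c k + b (k - int d)" for k
    using dim_mult[OF I Q, of k "modk I l (k - int d)"] k2 modk_subspace[OF I] modk_Pk
    unfolding r_def b_def c_def by fastforce
  have neg: "b k = 0" "c k = 0" if "k < 0" for k
  proof -
    have "modk I q k = {0}" for q
      using Pk_neg[OF that] pv.subspace_0[OF modk_subspace[OF I, of q k]] modk_Pk[of I q k] by auto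
    then show "b k = 0" "c k = 0" by (simp_all add: b_def c_def Pk_neg[OF that])
  qed
  \<comment> \<open>The index \<open>int n - 1\<close> lets the induction start in degree -1, where
    both sides are 0.\<close>
  have c: "c (int n - 1) = (\<Sum>t<d. b (int n - 1 - int t))" for n
  proof (induction n)
    case 0
    then show ?case using neg by simp
  next
    case (Suc n)
    have "(\<Sum>t<Suc d. b (int n - int t)) = b (int n) + (\<Sum>t<d. b (int n - int (Suc t)))"
      by (subst sum.lessThan_Suc_shift) simp
    then have "(\<Sum>t<d. b (int n - int t)) + b (int n - int d) = b (int n) + c (int n - 1)"
      using Suc.IH by (simp add: algebra_simps)
    then show ?case using 1[of "int n"] 2[of "int n"] by (simp add: algebra_simps)
  qed
  have b0: "b k = 0" if "N \<le> k" for k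
  proof -
    have "modk I l k = Pk k" using k2 large that by (auto simp: modk_def Pk_def)
    then show ?thesis by (simp add: b_def)
  qed
  \<comment> \<open>The bound makes \<open>k\<close> nonnegative and puts the whole window
    \<open>k - 1 - t\<close>, \<open>t < d\<close>, into degrees at least \<open>N\<close>, where b
    vanishes.\<close>
  have "homog k p \<longrightarrow> p \<in> I" if k: "\<bar>N\<bar> + int d + 1 \<le> k" for k p
  proof -
    have "k = int (nat k)" using k by linarith
    then have "c (k - 1) = (\<Sum>t<d. b (k - 1 - int t))" using c[of "nat k"] by simp
    also have "\<dots> = 0" by (intro sum.neutral ballI b0) (use k in auto)
    finally have "r k = 0" using 1[of k] b0[of k] k by simp
    then have "Pk k = Pk k \<inter> I"
      by (intro fdim_dim_eq[OF Pk_fdim Pk_Int_subspace[OF I]]) (auto simp: r_def)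
    then show ?thesis by (auto simp: Pk_def)
  qed
  then show ?thesis by blast
qed

subsection \<open>The binomial case: descent\<close>

text \<open>Write q = q0 + x q1 and w = w0 + x w1 with q0, w0 free of x. Then q0 w0 contributes
  nothing to the contraction. Modulo x the formula is the product rule.\<close>

lemma dv_ee_times:
  "dv (ee z) (q * w) = dv (ee z) q * w + (q - xmon (ee z) * dv (ee z) q) * dv (ee z) (w :: ('n, 'k::comm_ring_1) mpoly)"
proof -
  let ?x = "xmon (ee z) :: ('n, 'k) mpoly"
  define q0 where "q0 = q - ?x * dv (ee z) q"
  define w0 where "w0 = w - ?x * dv (ee z) w"
  have free: "cf m z = 0" if "m \<in> ks (p - ?x * dv (ee z) p)" for m and p :: "('n, 'k) mpoly"
  proof (rule ccontr)
    assume "cf m z \<noteq> 0"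
    then obtain t where "m = t + ee z" using ee_divs_iff divs_iff by (metis gr0I)
    then show False using that by (simp add: in_keys_iff lookup_minus)
  qed
  have "dv (ee z) (q0 * w0) = 0"
  proof (rule poly_mapping_eqI, rule ccontr)
    fix m assume "cf (dv (ee z) (q0 * w0)) m \<noteq> cf 0 m"
    then have "m + ee z \<in> ks (q0 * w0)" by (simp add: in_keys_iff)
    then obtain u v where "m + ee z = u + v" "u \<in> ks q0" "v \<in> ks w0" using keys_mult by blast
    then have "cf (m + ee z) z = 0" using free unfolding q0_def w0_def by (simp add: lookup_add)
    then show False by (simp add: lookup_add)
  qed
  moreover have "q * w = ?x * (dv (ee z) q * w) + (q0 * w0 + ?x * (q0 * dv (ee z) w))"
    by (simp add: q0_def w0_def algebra_simps)
  ultimately show ?thesis unfolding q0_def[symmetric] by (simp add: dv_add)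
qed

lemma dv_ee_xmon: "dv (ee z) (xmon (ee i) :: ('n, 'k::comm_ring_1) mpoly) = (if i = z then 1 else 0)"
proof (rule poly_mapping_eqI)
  fix m :: "'n \<Rightarrow>\<^sub>0 nat"
  have "cf (xmon (ee i) :: ('n, 'k) mpoly) (m + ee z) = (if m + ee z = ee i then 1 else 0)"
    by (auto simp: xmon_def lookup_single when_def)
  moreover have "m + ee z = ee i \<longleftrightarrow> i = z \<and> m = 0"
  proof
    assume a: "m + ee z = ee i"
    have "0 < cf (ee i) z" unfolding a[symmetric] by (simp add: lookup_add)
    then have "i = z" by (simp add: lookup_single when_def split: if_splits)
    then show "i = z \<and> m = 0" using a by simp
  qed auto
  ultimately show "cf (dv (ee z) (xmon (ee i) :: ('n, 'k) mpoly)) m = cf (if i = z then 1 else 0) m"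
    by (auto simp: lookup_one when_def)
qed

lemma dv_ee_linear_form: "dv (ee z) (linear_form a) = const (a z)"
proof -
  have "dv (ee z) (linear_form a) = (\<Sum>i\<in>UNIV. if i = z then const (a z) else 0)"
    unfolding linear_form_def indet_eq dv_sum
    by (intro sum.cong) (auto simp: dv_const_mult dv_ee_xmon)
  then show ?thesis by simp
qed

lemma colon_subspace':
  assumes "pv.subspace K" "pv.subspace V" shows "pv.subspace {v \<in> V. (q :: ('n, 'k::field) mpoly) * v \<in> K}"
proof -
  have "q * (const c * v) \<in> K" if "q * v \<in> K" for c v
    using pv.subspace_scale[OF assms(1) that, of c] by (simp only: mult.left_commute)
  then show ?thesis using assms by (auto simp: pv.subspace_def distrib_left)
qed

lemma colon_subspace:
  assumes "hideal K" "pv.subspace V" shows "pv.subspace {v \<in> V. (q :: ('n::finite, 'k::field) mpoly) * v \<in> K}"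
  by (rule colon_subspace'[OF hideal_subspace[OF assms(1)] assms(2)])

lemma plus_subspace:
  assumes "pv.subspace V" "pv.subspace W" "pv.subspace K"
  shows "pv.subspace {y \<in> V. \<exists>w\<in>W. y - (q :: ('n, 'k::field) mpoly) * w \<in> K}"
  unfolding pv.subspace_def
proof (intro conjI ballI allI)
  show "0 \<in> {y \<in> V. \<exists>w\<in>W. y - q * w \<in> K}"
    using assms by (auto simp: pv.subspace_def intro!: bexI[of _ 0])
  fix y y' and c :: 'k
  assume "y \<in> {y \<in> V. \<exists>w\<in>W. y - q * w \<in> K}"
  then obtain w where w: "y \<in> V" "w \<in> W" "y - q * w \<in> K" by blast
  have "const c * (y - q * w) \<in> K" by (rule pv.subspace_scale[OF assms(3) w(3)])
  then have "const c * y - q * (const c * w) \<in> K" by (simp add: algebra_simps)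
  then show "const c * y \<in> {y \<in> V. \<exists>w\<in>W. y - q * w \<in> K}"
    using pv.subspace_scale[OF assms(1) w(1)] pv.subspace_scale[OF assms(2) w(2)] by blast
  assume "y' \<in> {y \<in> V. \<exists>w\<in>W. y - q * w \<in> K}"
  then obtain w' where w': "y' \<in> V" "w' \<in> W" "y' - q * w' \<in> K" by blast
  have "(y - q * w) + (y' - q * w') \<in> K" by (rule pv.subspace_add[OF assms(3) w(3) w'(3)])
  then have "(y + y') - q * (w + w') \<in> K" by (simp add: algebra_simps)
  then show "y + y' \<in> {y \<in> V. \<exists>w\<in>W. y - q * w \<in> K}"
    using pv.subspace_add[OF assms(1) w(1) w'(1)] pv.subspace_add[OF assms(2) w(2) w'(2)] by blast
qed

text \<open>The data of the twisted descent: over \<open>I\<close>, the element \<open>f\<close>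
  generates the monomial ideal of \<open>G\<close>, and (I : f) is the monomial ideal of
  \<open>G\<close> and the variables in \<open>A\<close>. The products of \<open>z\<close> and
  \<open>z'\<close> vanish modulo \<open>G\<close>, and these variables lie in \<open>A\<close>
  together with all their neighbours.\<close>

locale binomial_descent =
  fixes G :: "('n::finite \<Rightarrow>\<^sub>0 nat) set" and a :: "'n \<Rightarrow> 'k::field" and Q f :: "('n, 'k) mpoly"
    and I :: "('n, 'k) mpoly set" and d :: int and A :: "'n set" and z z' :: 'n and M :: int
  assumes quad: "quad G" and a: "\<And>i. a i \<noteq> 0" and d: "2 \<le> d" and Q: "homog d Q"
    and I: "hideal I" "I \<subseteq> qideal G {}"
    and f: "homog 2 f" "f \<in> qideal G {}"
    and split: "\<And>p. p \<in> qideal G {} \<Longrightarrow> \<exists>v. p - f * v \<in> I"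
    and colon: "\<And>g. f * g \<in> I \<longleftrightarrow> g \<in> qideal G A"
    and lQ: "linear_form a * Q \<in> I"
    and ex1: "\<And>p. linear_form a * p \<in> I \<Longrightarrow> \<exists>w. p - Q * w \<in> I"
    and ex2: "\<And>p. Q * p \<in> I \<Longrightarrow> \<exists>w. p - linear_form a * w \<in> I"
    and z: "z \<noteq> z'" "z \<in> A" "z' \<in> A" "ee z + ee z \<in> G" "ee z + ee z' \<in> G" "ee z' + ee z' \<in> G"
      "Nb G z \<subseteq> A" "Nb G z' \<subseteq> A"
    and large: "\<And>k p. M \<le> k \<Longrightarrow> homog k p \<Longrightarrow> p \<in> I"
begin

abbreviation "l \<equiv> linear_form a"
abbreviation "S0 \<equiv> qideal G {} :: ('n, 'k) mpoly set"
abbreviation "L \<equiv> qideal G A :: ('n, 'k) mpoly set"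
text \<open>The colon of \<open>N\<close> by either of the two dropped variables is
  \<open>L\<close>: multiplication by \<open>x z\<close> maps \<open>L\<close> into
  \<open>N\<close>, and the contraction \<open>D z\<close> maps \<open>N\<close> back into
  \<open>L\<close>.\<close>

abbreviation "N \<equiv> qideal G (A - {z, z'}) :: ('n, 'k) mpoly set"
abbreviation "x i \<equiv> xmon (ee i) :: ('n, 'k) mpoly"
abbreviation "D i \<equiv> dv (ee i) :: ('n, 'k) mpoly \<Rightarrow> ('n, 'k) mpoly"

lemma sub: "p \<in> I \<Longrightarrow> p \<in> S0" "p \<in> S0 \<Longrightarrow> p \<in> N" "p \<in> S0 \<Longrightarrow> p \<in> L" "p \<in> N \<Longrightarrow> p \<in> L"
  using I(2) qideal_mono[of G G "{}" "A - {z, z'}" p] qideal_mono[of G G "{}" A p] qideal_mono[of G G "A - {z, z'}" A p] by auto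

lemmas iI = hidealD[OF I(1)]
lemmas iS = hidealD[OF qideal_hideal[of G "{}"]]
lemmas iN = hidealD[OF qideal_hideal[of G "A - {z, z'}"]]
lemmas iL = hidealD[OF qideal_hideal[of G A]]

lemma swap: "binomial_descent G a Q f I d A z' z M"
  using binomial_descent_axioms z unfolding binomial_descent_def by (simp add: add.commute)

lemma D_N: "p \<in> N \<Longrightarrow> D z p \<in> L"
proof (rule mideal_dv)
  fix m assume "m + ee z \<in> Bs G (A - {z, z'})"
  then have "m \<in> Bs G ((A - {z, z'}) \<union> Nb G z)" by (intro Bs_colon[OF quad]) auto
  then show "m \<in> Bs G A" using Bs_mono[of G G "(A - {z, z'}) \<union> Nb G z" A] z by blast
qed

lemma x_L: "p \<in> L \<Longrightarrow> x z * p \<in> N"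
proof (rule qideal_colon_conv)
  assume "p \<in> L"
  then show "p \<in> qideal G ((A - {z, z'}) \<union> Nb G z)"
    by (rule qideal_mono[rotated 2]) (use z in \<open>auto simp: Nb_def\<close>)
qed

lemma x_in_L: "i \<in> A \<Longrightarrow> x i * p \<in> L"
proof (rule qideal_mult2)
  assume "i \<in> A"
  then have "ee i \<in> Bs G A" unfolding Bs_def by (intro CollectI disjI2 bexI[of _ i]) simp_all
  then show "x i \<in> L" by (simp add: mideal_def)
qed

text \<open>The error term of the product rule is a multiple of \<open>x z\<close>, hence zero
  modulo \<open>L\<close>, where \<open>D z\<close> behaves like a derivation.\<close>

lemma D_times: "D z (q * w) - (D z q * w + q * D z w) \<in> L"
proof -
  have "D z (q * w) - (D z q * w + q * D z w) = - (x z * (D z q * D z w))"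
    by (simp add: dv_ee_times algebra_simps)
  then show ?thesis using iL(7)[OF x_in_L[OF z(2)]] by (rule ssubst)
qed

lemma D_other: "D z' (x z * s) \<in> L"
proof -
  have "D z' (x z * s) = x z * D z' s" using z(1) by (subst dv_ee_times) (simp add: dv_ee_xmon)
  then show ?thesis using x_in_L[OF z(2)] by simp
qed

lemma D_l: "D z (l * w) - (const (a z) * w + l * D z w) \<in> L"
  using D_times[of l w] by (simp add: dv_ee_linear_form)

text \<open>The product rule applied to the relation l Q = 0.\<close>

lemma l_q: "l * D z Q + const (a z) * Q \<in> L"
proof -
  have "D z (l * Q) \<in> L" using D_N sub lQ by blast
  then have "D z (l * Q) - (D z (l * Q) - (const (a z) * Q + l * D z Q)) \<in> L" using D_l iL(6) by blast
  then show ?thesis by (simp add: algebra_simps)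
qed

end

context binomial_descent begin

interpretation sw: binomial_descent G a Q f I d A z' z M by (rule swap)

text \<open>Contracting by \<open>z\<close> expresses \<open>s\<close> through \<open>w\<close>,
  modulo l and \<open>L\<close>. Contracting by \<open>z'\<close> kills \<open>x z * s\<close> and
  shows that \<open>w\<close> itself is a multiple of l modulo \<open>L\<close>; this is what the
  second variable is for.\<close>

lemma cancel: assumes "x z * s - l * w \<in> N" shows "\<exists>g. s - l * g \<in> L"
proof -
  let ?c = "const (a z / a z')"
  have 1: "s - D z (l * w) \<in> L" using D_N[OF assms] by (simp add: dv_diff)
  have "x z * s - l * w \<in> sw.N" using assms by (simp add: insert_commute)
  then have "D z' (x z * s - l * w) \<in> L" by (rule sw.D_N)
  then have "D z' (x z * s) - D z' (l * w) \<in> L" by (simp only: dv_diff)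
  then have "D z' (x z * s) - (D z' (x z * s) - D z' (l * w)) - (D z' (l * w) - (const (a z') * w + l * D z' w)) \<in> L"
    using D_other sw.D_l iL(6) by blast
  then have "const (a z') * w + l * D z' w \<in> L" by simp
  then have "?c * (const (a z') * w + l * D z' w) \<in> L" by (rule iL(3))
  moreover have "?c * (const (a z') * w) = const (a z) * w"
    unfolding mult.assoc[symmetric] const_mult[symmetric] using a[of z'] by simp
  ultimately have 2: "const (a z) * w + ?c * (l * D z' w) \<in> L" by (simp only: distrib_left)
  have "(s - D z (l * w)) + (D z (l * w) - (const (a z) * w + l * D z w)) + (const (a z) * w + ?c * (l * D z' w)) \<in> L"
    by (rule iL(2)[OF iL(2)[OF 1 D_l] 2])
  then have "s - l * (D z w - ?c * D z' w) \<in> L" by (simp add: algebra_simps)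
  then show ?thesis by blast
qed

text \<open>The defect of exactness over \<open>S0\<close> is a cofactor \<open>v\<close> of
  \<open>f\<close> in degree j - 1. Multiplication by \<open>x z\<close> brings it to degree j,
  where exactness modulo \<open>N\<close> is available, and \<open>cancel\<close> removes the factor
  again.\<close>

lemma od_step:
  assumes "\<And>T. exact_at G Q l T j" shows "exact_at G l Q T j"
proof (rule exact_all[OF quad hom_linear_form])
  show "l * Q \<in> S0" using sub lQ by blast
  show "exact_at G Q l T (j + 1 - 1)" for T using assms by simp
  show "exact_at G l Q {} j" unfolding exact_at_def
  proof (intro allI impI)
    fix p assume p: "homog j p" "l * p \<in> S0"
    obtain v0 where v0: "l * p - f * v0 \<in> I" using split p(2) by blast
    have "homog (1 + j) (l * p)" by (rule hom_mult[OF hom_linear_form p(1)])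
    then obtain v where v: "homog (1 + j - 2) v" "l * p - f * v \<in> I"
      using hideal_homogenise[OF I(1) _ f(1) v0] by blast
    have "(l * Q) * p - Q * (l * p - f * v) \<in> I" by (rule iI(6)[OF iI(4)[OF lQ] iI(3)[OF v(2)]])
    then have "f * (Q * v) \<in> I" by (simp add: algebra_simps)
    then have "Q * v \<in> L" using colon by blast
    then have "x z * (Q * v) \<in> N" by (rule x_L)
    then have "Q * (x z * v) \<in> N" by (simp add: algebra_simps)
    moreover have "homog j (x z * v)" using hom_mult[OF hom_xmon[of UNIV "ee z"] v(1)] by simp
    ultimately obtain w where "x z * v - l * w \<in> N" using assms unfolding exact_at_def by blast
    then obtain g where "v - l * g \<in> L" using cancel by blast
    then have "f * (v - l * g) \<in> I" using colon by blast
    then have "(l * p - f * v) + f * (v - l * g) \<in> I" by (rule iI(2)[OF v(2)])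
    then have "l * (p - f * g) \<in> I" by (simp add: algebra_simps)
    then obtain h where "p - f * g - Q * h \<in> I" using ex1 by blast
    then have "(p - f * g - Q * h) + f * g \<in> S0" using sub(1) f(2) iS(2,4) by blast
    then show "\<exists>w. p - Q * w \<in> S0" by (auto simp: algebra_simps)
  qed
qed

text \<open>Two classes annihilated by l are packed into \<open>x z * v + x z' * v'\<close> and read
  off again by the two contractions, so a single cofactor \<open>w\<close> serves both. This is the
  source of the factor 2 in the dimension count.\<close>

lemma both:
  assumes ex: "\<And>T. exact_at G l Q T (j + d - 1)"
    and v: "homog (j + d - 2) v" "l * v \<in> L" and v': "homog (j + d - 2) v'" "l * v' \<in> L"
  shows "\<exists>w. homog (j - 1) w \<and> Q * w \<in> L \<and> (\<exists>h. v - D z Q * w - Q * h \<in> L) \<and> (\<exists>h. v' - D z' Q * w - Q * h \<in> L)"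
proof -
  define p where "p = x z * v + x z' * v'"
  have hp: "homog (j + d - 1) p"
    unfolding p_def using hom_mult[OF hom_xmon[of UNIV "ee z"] v(1)] hom_mult[OF hom_xmon[of UNIV "ee z'"] v'(1)]
    by (intro hom_add) (simp_all add: algebra_simps)
  have "x z' * (l * v') \<in> N" using sw.x_L[OF v'(2)] by (simp add: insert_commute)
  then have "x z * (l * v) + x z' * (l * v') \<in> N" using x_L[OF v(2)] iN(2) by blast
  then have "l * p \<in> N" by (simp add: p_def algebra_simps)
  then obtain w0 where w0: "p - Q * w0 \<in> N" using ex hp unfolding exact_at_def by blast
  obtain w where w: "homog (j + d - 1 - d) w" "p - Q * w \<in> N"
    using hom_mideal_homogenise[OF hp Q w0] by blast
  have pL: "p \<in> L" unfolding p_def using x_in_L z iL(2) by blast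
  then have "p - (p - Q * w) \<in> L" using w(2) sub iL(6) by blast
  then have QL: "Q * w \<in> L" by simp
  have gen: "\<exists>h. v - D z Q * w - Q * h \<in> L"
    if "p = x z * v + r" "D z r \<in> L" "p - Q * w \<in> N" "\<And>p. p \<in> N \<Longrightarrow> D z p \<in> L"
      "\<And>q w. D z (q * w) - (D z q * w + q * D z w) \<in> L" for z v r
  proof -
    have "D z (p - Q * w) \<in> L" using that by blast
    then have "v + D z r - D z (Q * w) \<in> L" by (simp add: that(1) dv_diff dv_add)
    then have "(v + D z r - D z (Q * w)) - D z r + (D z (Q * w) - (D z Q * w + Q * D z w)) \<in> L"
      by (rule iL(2)[OF iL(6)[OF _ that(2)] that(5)])
    then have "v - D z Q * w - Q * D z w \<in> L" by (simp add: algebra_simps)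
    then show ?thesis by blast
  qed
  have "\<exists>h. v - D z Q * w - Q * h \<in> L"
    by (rule gen[OF p_def sw.D_other w(2) D_N D_times])
  moreover have "\<exists>h. v' - D z' Q * w - Q * h \<in> L"
  proof (rule gen[OF _ D_other w(2) _ sw.D_times])
    show "p = x z' * v' + x z * v" by (simp add: p_def)
    show "D z' p \<in> L" if "p \<in> N" for p using sw.D_N that by (simp add: insert_commute)
  qed
  ultimately show ?thesis using w(1) QL by (intro exI[of _ w]) simp
qed

text \<open>Together with \<open>l_qw\<close> this makes multiplication by \<open>D z Q\<close> well
  defined on the quotients counted in \<open>ev_step\<close>.\<close>

lemma qX0: assumes "w - l * g \<in> L" shows "\<exists>h. D z Q * w - Q * h \<in> L"
proof -
  have "D z Q * (w - l * g) + (l * D z Q + const (a z) * Q) * g \<in> L"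
    by (rule iL(2)[OF iL(3)[OF assms] iL(4)[OF l_q]])
  then have "D z Q * w - Q * (- const (a z) * g) \<in> L" by (simp add: algebra_simps)
  then show ?thesis by blast
qed

lemma l_qw: assumes "Q * w \<in> L" shows "l * (D z Q * w) \<in> L"
proof -
  have "(l * D z Q + const (a z) * Q) * w - const (a z) * (Q * w) \<in> L"
    by (rule iL(6)[OF iL(4)[OF l_q] iL(3)[OF assms]])
  then show ?thesis by (simp add: algebra_simps)
qed

end

context binomial_descent begin

interpretation sw: binomial_descent G a Q f I d A z' z M by (rule swap)

text \<open>Multiplication by \<open>Q\<close> and by \<open>f\<close> identifies \<open>U1 / U0\<close> with \<open>X1 / X0\<close>, multiplication by \<open>x z\<close>
  followed by lifting embeds \<open>Y1 / Y0\<close> into \<open>U1 / U0\<close>, and \<open>w \<mapsto> (D z Q * w, D z' Q * w)\<close> maps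
  \<open>Y1 / Y0\<close> onto \<open>(X1 / X0)\<^sup>2\<close>. So \<open>2 dim (X1 / X0) \<le> dim (X1 / X0)\<close>, and \<open>U1 = U0\<close>.\<close>
lemma ev_step:
  assumes ex: "\<And>T. exact_at G l Q T (j + d - 1)" shows "exact_at G Q l T j"
proof (rule exact_all[OF quad Q])
  have lQS: "l * Q \<in> S0" and lQL: "l * Q \<in> L" using sub lQ by blast+
  show "Q * l \<in> S0" using lQS by (simp add: mult.commute)
  show "exact_at G l Q T (j + d - 1)" for T by (rule ex)
  define i where "i = j + d - 2"
  define X1 where "X1 = {v \<in> Pk i. l * v \<in> L}"
  define X0 where "X0 = modk L Q i"
  define Y1 where "Y1 = {w \<in> Pk (j - 1). Q * w \<in> L}"
  define Y0 where "Y0 = modk L l (j - 1)"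
  define U1 where "U1 = {u \<in> Pk j. Q * u \<in> S0}"
  define U0 where "U0 = modk S0 l j"
  define Nn where "Nn = modk N l j"
  \<comment> \<open>\<open>A'\<close> and \<open>B'\<close> are a meeting place: \<open>Q\<close>
    maps U1/U0, and \<open>f\<close> maps X1/X0, isomorphically onto A'/B'.\<close>
  define A' where "A' = {y \<in> Pk (j + d). \<exists>v\<in>X1. y - f * v \<in> I}"
  define B' where "B' = {y \<in> Pk (j + d). \<exists>v\<in>X0. y - f * v \<in> I}"
  define A3 where "A3 = {y \<in> Pk j. \<exists>w\<in>Y1. y - x z * w \<in> Nn}"
  define U2 where "U2 = U1 \<inter> A3"
  define Y01 where "Y01 = {w \<in> Y1. D z Q * w \<in> X0}"
  define Y00 where "Y00 = {w \<in> Y01. D z' Q * w \<in> X0}"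
  have sX0: "pv.subspace X0" "pv.subspace Y0" "pv.subspace U0" "pv.subspace Nn"
    unfolding X0_def Y0_def U0_def Nn_def by (intro modk_subspace qideal_hideal)+
  have sX1: "pv.subspace X1" "pv.subspace Y1" "pv.subspace U1"
    unfolding X1_def Y1_def U1_def
    using colon_subspace[OF qideal_hideal Pk_subspace] by blast+
  have sAB: "pv.subspace A'" "pv.subspace B'" "pv.subspace A3"
    unfolding A'_def B'_def A3_def
    using plus_subspace[OF Pk_subspace _ hideal_subspace[OF I(1)]] plus_subspace[OF Pk_subspace _ sX0(4)] sX0 sX1 by blast+
  have sU2: "pv.subspace U2" unfolding U2_def by (rule pv.subspace_inter[OF sX1(3) sAB(3)])
  have sY: "pv.subspace Y01" "pv.subspace Y00"
    unfolding Y00_def Y01_def using colon_subspace'[OF sX0(1)] sX1(2) by blast+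
  have f0: "fdim X1" "fdim A'" "fdim U1" "fdim Y1" "fdim A3"
    using sX1 sAB fdim_subspace[OF Pk_fdim] unfolding X1_def A'_def U1_def Y1_def A3_def by blast+
  have f1: "fdim U2" "fdim Y01" "fdim X0"
    using fdim_subspace[OF f0(3) sU2] fdim_subspace[OF f0(4) sY(1)] fdim_subspace[OF Pk_fdim sX0(1)] modk_Pk
    unfolding U2_def Y01_def X0_def by blast+
  have lm: "q * p \<in> K" if "hideal K" "q * r \<in> K" "p - r * w \<in> K" for q p r w K
  proof -
    have "q * (p - r * w) + (q * r) * w \<in> K" by (rule hidealD(2)[OF that(1) hidealD(3)[OF that(1,3)] hidealD(4)[OF that(1,2)]])
    then show ?thesis by (simp add: algebra_simps)
  qed
  have QlL: "Q * l \<in> L" and QlS: "Q * l \<in> S0" and QlI: "Q * l \<in> I" using lQL lQS lQ by (simp_all add: mult.commute)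
  have X01: "X0 \<subseteq> X1" unfolding X0_def X1_def modk_def using lm[OF qideal_hideal lQL] by blast
  have Y0Y1: "Y0 \<subseteq> Y1" unfolding Y0_def Y1_def modk_def using lm[OF qideal_hideal QlL] by blast
  have U01: "U0 \<subseteq> U1" unfolding U0_def U1_def modk_def using lm[OF qideal_hideal QlS] by blast
  have BA: "B' \<subseteq> A'" unfolding A'_def B'_def using X01 by blast
  have NP: "Nn \<subseteq> Pk j" unfolding Nn_def by (rule modk_Pk)
  have NA: "Nn \<subseteq> A3" using NP pv.subspace_0[OF sX1(2)] unfolding A3_def by (auto intro!: bexI[of _ 0])
  have c1: "pv.dim U1 + pv.dim B' = pv.dim A' + pv.dim U0"
  proof (rule dim_quot[OF f0(3) sX0(3) U01 f0(2) sAB(2) BA])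
    fix u assume u: "u \<in> U1"
    have hu: "homog j u" "Q * u \<in> S0" using u by (auto simp: U1_def Pk_def)
    have hQu: "homog (j + d) (Q * u)" using hom_mult[OF Q hu(1)] by (simp add: add.commute)
    obtain v0 where v0: "Q * u - f * v0 \<in> I" using split[OF hu(2)] by blast
    obtain v where v: "homog i v" "Q * u - f * v \<in> I"
      using hideal_homogenise[OF I(1) hQu f(1) v0] unfolding i_def by blast
    have "(l * Q) * u - l * (Q * u - f * v) \<in> I" by (rule iI(6)[OF iI(4)[OF lQ] iI(3)[OF v(2)]])
    then have "f * (l * v) \<in> I" by (simp add: algebra_simps)
    then have vX: "v \<in> X1" using v(1) colon by (simp add: X1_def Pk_def)
    show "Q * u \<in> A'" using vX v(2) hQu unfolding A'_def Pk_def by blast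
    show "Q * u \<in> B' \<longleftrightarrow> u \<in> U0"
    proof
      assume "Q * u \<in> B'"
      then obtain v where v: "v \<in> X0" "Q * u - f * v \<in> I" by (auto simp: B'_def)
      then obtain w where w: "v - Q * w \<in> L" by (auto simp: X0_def modk_def)
      have "f * (v - Q * w) \<in> I" using w colon by blast
      then have "(Q * u - f * v) + f * (v - Q * w) \<in> I" by (rule iI(2)[OF v(2)])
      then have "Q * (u - f * w) \<in> I" by (simp add: algebra_simps)
      then obtain g where "u - f * w - l * g \<in> I" using ex2 by blast
      then have "(u - f * w - l * g) + f * w \<in> S0" using sub(1) f(2) iS(2,4) by blast
      then have "u - l * g \<in> S0" by (simp add: algebra_simps)
      then show "u \<in> U0" using hu(1) by (auto simp: U0_def modk_def Pk_def)
    next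
      assume "u \<in> U0"
      then obtain g where g: "u - l * g \<in> S0" by (auto simp: U0_def modk_def)
      then obtain v0 where v0: "(u - l * g) - f * v0 \<in> I" using split by blast
      have "Q * ((u - l * g) - f * v0) + (Q * l) * g \<in> I" by (rule iI(2)[OF iI(3)[OF v0] iI(4)[OF QlI]])
      then have "Q * u - f * (Q * v0) \<in> I" by (simp add: algebra_simps)
      then have "(Q * u - f * (Q * v0)) - (Q * u - f * v) \<in> I" by (rule iI(6)[OF _ v(2)])
      then have "f * (v - Q * v0) \<in> I" by (simp add: algebra_simps)
      then have "v - Q * v0 \<in> L" using colon by blast
      then have "v \<in> X0" using v(1) by (auto simp: X0_def modk_def Pk_def)
      then show "Q * u \<in> B'" using v(2) hQu unfolding B'_def Pk_def by blast
    qed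
  next
    fix y assume "y \<in> A'"
    then obtain v where y: "homog (j + d) y" and v: "v \<in> X1" "y - f * v \<in> I" by (auto simp: A'_def Pk_def)
    have "f * (l * v) \<in> I" using v(1) colon by (simp add: X1_def)
    then have "l * (y - f * v) + f * (l * v) \<in> I" by (rule iI(2)[OF iI(3)[OF v(2)]])
    then have "l * y \<in> I" by (simp add: algebra_simps)
    then obtain w where w: "y - Q * w \<in> I" using ex1 by blast
    obtain u where u: "homog (j + d - d) u" "y - Q * u \<in> I"
      using hideal_homogenise[OF I(1) y Q w] by blast
    have "y - f * v \<in> S0" "f * v \<in> S0" "y - Q * u \<in> S0" using v(2) u(2) sub(1) iS(4)[OF f(2)] by blast+
    then have "((y - f * v) + f * v) - (y - Q * u) \<in> S0" by (rule iS(6)[OF iS(2)])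
    then have "Q * u \<in> S0" by simp
    then have uU: "u \<in> U1" using u(1) by (simp add: U1_def Pk_def)
    have hQu: "homog (j + d) (Q * u)" using hom_mult[OF Q u(1)] by (simp add: add.commute)
    have "y - Q * u \<in> B'"
      unfolding B'_def Pk_def using hom_diff[OF y hQu] u(2) pv.subspace_0[OF sX0(1)]
      by (intro CollectI conjI bexI[of _ 0]) simp_all
    then show "\<exists>u\<in>U1. y - Q * u \<in> B'" using uU by blast
  qed
  have hf: "homog (j + d) (f * v)" if "v \<in> X1" for v
    using hom_mult[OF f(1), of i v] that by (simp add: X1_def Pk_def i_def)
  have c2: "pv.dim X1 + pv.dim B' = pv.dim A' + pv.dim X0"
  proof (rule dim_quot[OF f0(1) sX0(1) X01 f0(2) sAB(2) BA])
    fix v assume v: "v \<in> X1"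
    show "f * v \<in> A'" using hf[OF v] v iI(1) unfolding A'_def Pk_def by (intro CollectI conjI bexI[of _ v]) simp_all
    show "f * v \<in> B' \<longleftrightarrow> v \<in> X0"
    proof
      assume "v \<in> X0"
      then show "f * v \<in> B'" using hf[OF v] iI(1) unfolding B'_def Pk_def by (intro CollectI conjI bexI[of _ v]) simp_all
    next
      assume "f * v \<in> B'"
      then obtain v2 where v2: "v2 \<in> X0" "f * v - f * v2 \<in> I" by (auto simp: B'_def)
      then obtain w where w: "v2 - Q * w \<in> L" by (auto simp: X0_def modk_def)
      have "f * (v - v2) \<in> I" using v2(2) by (simp add: right_diff_distrib)
      then have "v - v2 \<in> L" using colon by blast
      then have "(v - v2) + (v2 - Q * w) \<in> L" using w by (rule iL(2))
      then have "v - Q * w \<in> L" by simp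
      then show "v \<in> X0" using v by (auto simp: X0_def X1_def modk_def)
    qed
  next
    fix y assume "y \<in> A'"
    then obtain v where y: "homog (j + d) y" and v: "v \<in> X1" "y - f * v \<in> I" by (auto simp: A'_def Pk_def)
    have "y - f * v \<in> B'"
      unfolding B'_def Pk_def using hom_diff[OF y hf[OF v(1)]] v(2) pv.subspace_0[OF sX0(1)]
      by (intro CollectI conjI bexI[of _ 0]) simp_all
    then show "\<exists>v\<in>X1. y - f * v \<in> B'" using v(1) by blast
  qed
  have hx: "homog j (x z * w)" if "w \<in> Y1" for w
    using hom_mult[OF hom_xmon[of UNIV "ee z"], of "j - 1" w] that by (simp add: Y1_def Pk_def)
  have c3: "pv.dim Y1 + pv.dim Nn = pv.dim A3 + pv.dim Y0"
  proof (rule dim_quot[OF f0(4) sX0(2) Y0Y1 f0(5) sX0(4) NA])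
    fix w assume w: "w \<in> Y1"
    show "x z * w \<in> A3" using hx[OF w] w pv.subspace_0[OF sX0(4)] unfolding A3_def Pk_def
      by (intro CollectI conjI bexI[of _ w]) simp_all
    show "x z * w \<in> Nn \<longleftrightarrow> w \<in> Y0"
    proof
      assume "x z * w \<in> Nn"
      then obtain g where "x z * w - l * g \<in> N" by (auto simp: Nn_def modk_def)
      then obtain g where "w - l * g \<in> L" using cancel by blast
      then show "w \<in> Y0" using w by (auto simp: Y0_def Y1_def modk_def)
    next
      assume "w \<in> Y0"
      then obtain g where "w - l * g \<in> L" by (auto simp: Y0_def modk_def)
      then have "x z * (w - l * g) \<in> N" by (rule x_L)
      then have "x z * w - l * (x z * g) \<in> N" by (simp add: algebra_simps)
      then show "x z * w \<in> Nn" using hx[OF w] by (auto simp: Nn_def modk_def Pk_def)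
    qed
  next
    fix y assume "y \<in> A3"
    then show "\<exists>w\<in>Y1. y - x z * w \<in> Nn" by (auto simp: A3_def)
  qed
  have U0N: "U0 \<subseteq> Nn" unfolding U0_def Nn_def modk_def using sub(2) by blast
  have U0U2: "U0 \<subseteq> U2 \<inter> Nn" using U0N U01 NA unfolding U2_def by blast
  have sU2N: "pv.subspace (U2 \<inter> Nn)" by (rule pv.subspace_inter[OF sU2 sX0(4)])
  \<comment> \<open>The map is the inclusion, written as multiplication by 1. Elements of
    \<open>A3\<close> are annihilated by \<open>Q\<close> only modulo \<open>N\<close>, and
    surjectivity is their lift by \<open>exact_lift\<close>.\<close>
  have c4: "pv.dim U2 + pv.dim Nn = pv.dim A3 + pv.dim (U2 \<inter> Nn)"
  proof (rule dim_quot[of U2 "U2 \<inter> Nn" A3 Nn 1, OF f1(1) sU2N _ f0(5) sX0(4) NA])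
    show "U2 \<inter> Nn \<subseteq> U2" by blast
    show "1 * u \<in> Nn \<longleftrightarrow> u \<in> U2 \<inter> Nn" if "u \<in> U2" for u using that by simp
    show "1 * u \<in> A3" if "u \<in> U2" for u using that by (simp add: U2_def)
    fix y assume y: "y \<in> A3"
    then obtain w g where w: "w \<in> Y1" "y - x z * w - l * g \<in> N" by (auto simp: A3_def Nn_def modk_def)
    have hy: "homog j y" using y by (simp add: A3_def Pk_def)
    have QlN: "Q * l \<in> N" using QlS sub(2) by blast
    have "x z * (Q * w) \<in> N" using w(1) x_L by (simp add: Y1_def)
    then have "Q * (x z * w) \<in> N" by (simp only: mult.left_commute)
    then have "Q * (y - x z * w - l * g) + (Q * l) * g + Q * (x z * w) \<in> N"
      by (intro iN(2) iN(3)[OF w(2)] iN(4)[OF QlN])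
    then have "Q * y \<in> N" by (simp add: algebra_simps)
    then obtain u where u: "homog j u" "Q * u \<in> S0" "y - u \<in> N"
      using exact_lift[OF quad Q QlS ex hy] by blast
    have "y - u \<in> Nn" using hom_diff[OF hy u(1)] u(3) by (auto simp: Nn_def modk_def Pk_def intro!: exI[of _ 0])
    moreover have "u \<in> A3"
    proof -
      have "y - (y - u) \<in> A3" using y \<open>y - u \<in> Nn\<close> NA sAB(3) pv.subspace_diff by blast
      then show ?thesis by simp
    qed
    ultimately show "\<exists>u\<in>U2. y - 1 * u \<in> Nn" using u by (intro bexI[of _ u]) (auto simp: U2_def U1_def Pk_def)
  qed
  have hq: "homog i (D t Q * w)" if "w \<in> Y1" for w t
  proof -
    have "homog (d - 1) (D t Q)" using hom_dv[OF Q, of "ee t"] by simp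
    then show ?thesis using hom_mult[of UNIV "d - 1" "D t Q" "j - 1" w] that by (simp add: Y1_def Pk_def i_def algebra_simps)
  qed
  have qX1: "D z Q * w \<in> X1" "D z' Q * w \<in> X1" if "w \<in> Y1" for w
    using hq[OF that] l_qw sw.l_qw that unfolding X1_def Pk_def Y1_def by blast+
  have zX: "homog i 0" "l * 0 \<in> L" by simp_all
  have onto: "\<exists>w\<in>Y1. v - D z Q * w \<in> X0 \<and> v' - D z' Q * w \<in> X0" if "v \<in> X1" "v' \<in> X1" for v v'
  proof -
    have h: "homog (j + d - 2) v" "l * v \<in> L" "homog (j + d - 2) v'" "l * v' \<in> L"
      using that by (auto simp: X1_def Pk_def i_def)
    obtain w where w: "homog (j - 1) w" "Q * w \<in> L" "\<exists>h. v - D z Q * w - Q * h \<in> L" "\<exists>h. v' - D z' Q * w - Q * h \<in> L"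
      using both[OF ex h] by blast
    have wY: "w \<in> Y1" using w by (simp add: Y1_def Pk_def)
    have "v - D z Q * w \<in> X0" "v' - D z' Q * w \<in> X0"
      using w(3,4) hom_diff[OF h(1)] hom_diff[OF h(3)] hq[OF wY] unfolding X0_def modk_def Pk_def i_def by blast+
    then show ?thesis using wY by blast
  qed
  have n0: "p \<in> X0" if "0 - p \<in> X0" for p using pv.subspace_neg[OF sX0(1) that] by simp
  have c5: "pv.dim Y1 + pv.dim X0 = pv.dim X1 + pv.dim Y01"
  proof (rule dim_quot[of Y1 Y01 X1 X0 "D z Q", OF f0(4) sY(1) _ f0(1) sX0(1) X01])
    show "Y01 \<subseteq> Y1" by (auto simp: Y01_def)
    show "D z Q * w \<in> X0 \<longleftrightarrow> w \<in> Y01" if "w \<in> Y1" for w using that by (simp add: Y01_def)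
    show "D z Q * w \<in> X1" if "w \<in> Y1" for w using qX1(1) that .
    show "\<exists>w\<in>Y1. v - D z Q * w \<in> X0" if "v \<in> X1" for v using onto[OF that that] by blast
  qed
  have c6: "pv.dim Y01 + pv.dim X0 = pv.dim X1 + pv.dim Y00"
  proof (rule dim_quot[of Y01 Y00 X1 X0 "D z' Q", OF f1(2) sY(2) _ f0(1) sX0(1) X01])
    show "Y00 \<subseteq> Y01" by (auto simp: Y00_def)
    show "D z' Q * w \<in> X0 \<longleftrightarrow> w \<in> Y00" if "w \<in> Y01" for w using that by (simp add: Y00_def)
    show "D z' Q * w \<in> X1" if "w \<in> Y01" for w using qX1(2) that by (simp add: Y01_def)
    fix v assume v: "v \<in> X1"
    have "0 \<in> X1" by (rule pv.subspace_0[OF sX1(1)])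
    then obtain w where "w \<in> Y1" "0 - D z Q * w \<in> X0" "v - D z' Q * w \<in> X0" using onto v by blast
    then show "\<exists>w\<in>Y01. v - D z' Q * w \<in> X0" using n0 unfolding Y01_def by blast
  qed
  \<comment> \<open>\<open>Y0\<close> lies in the common kernel of both maps, so Y1/Y0 has at least
    twice the dimension of X1/X0.\<close>
  have Y000: "Y0 \<subseteq> Y00"
  proof
    fix w assume w: "w \<in> Y0"
    then obtain g where g: "w - l * g \<in> L" by (auto simp: Y0_def modk_def)
    have "w \<in> Y1" using w Y0Y1 by blast
    then show "w \<in> Y00" using hq qX0[OF g] sw.qX0[OF g] unfolding Y00_def Y01_def X0_def modk_def Pk_def by blast
  qed
  have d1: "pv.dim Y0 \<le> pv.dim Y00" by (rule fdim_dim_mono[OF fdim_subspace[OF f1(2) sY(2)] sX0(2) Y000]) (auto simp: Y00_def)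
  have d2: "pv.dim U0 \<le> pv.dim (U2 \<inter> Nn)" by (rule fdim_dim_mono[OF fdim_subspace[OF f1(1) sU2N] sX0(3) U0U2]) auto
  have d3: "pv.dim U2 \<le> pv.dim U1" by (rule fdim_dim_mono[OF f0(3) sU2]) (auto simp: U2_def)
  have d4: "pv.dim X0 \<le> pv.dim X1" by (rule fdim_dim_mono[OF f0(1) sX0(1) X01])
  \<comment> \<open>In terms of quotients: 2 dim X1/X0 \<le> dim Y1/Y0 = dim A3/Nn = dim U2/(U2
    \<inter> Nn) \<le> dim U1/U0 = dim X1/X0.\<close>
  have "pv.dim U1 \<le> pv.dim U0" using c1 c2 c3 c4 c5 c6 d1 d2 d3 d4 by linarith
  then have "U1 = U0" by (rule fdim_dim_eq[OF f0(3) sX0(3) U01])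
  then show "exact_at G Q l {} j" unfolding exact_at_def U1_def U0_def modk_def Pk_def by blast
qed

lemma contradiction: False
proof (rule descent_False[OF quad d Q])
  show "exact_at G l Q T j" if "M \<le> j" for j T
    unfolding exact_at_def
  proof (intro allI impI exI[of _ 0])
    fix p :: "('n, 'k) mpoly" assume "homog j p"
    then have "p \<in> S0" using large[OF that] sub(1) by blast
    then show "p - Q * 0 \<in> qideal G T" using qideal_mono[of G G "{}" T p] by simp
  qed
  show "\<forall>T. exact_at G Q l T j" if "\<And>T. exact_at G l Q T (j + d - 1)" for j using ev_step[OF that] by blast
  show "\<forall>T. exact_at G l Q T j" if "\<And>T. exact_at G Q l T j" for j using od_step[OF that] by blast
qed

end

subsection \<open>Binomial quadratic ideals\<close>

lemma qideal_xmon: "m \<in> Bs G T \<Longrightarrow> xmon m \<in> qideal G T"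
  by (simp add: mideal_def)

lemma Bs_gen: "g \<in> G \<Longrightarrow> g \<in> Bs G T"
  unfolding Bs_def using divs_refl by blast

text \<open>Reduces the inclusion of a monomial ideal in a homogeneous ideal, such as (I : f1), to
  its generators.\<close>

lemma qideal_least:
  assumes K: "hideal K" and "\<And>g. g \<in> G \<Longrightarrow> xmon g \<in> K" "\<And>i. i \<in> T \<Longrightarrow> xmon (ee i) \<in> K"
    and p: "p \<in> qideal G T" shows "p \<in> K"
proof -
  have x: "xmon m \<in> K" if "m \<in> Bs G T" for m
  proof -
    from that consider g where "g \<in> G" "g \<preceq> m" | i where "i \<in> T" "ee i \<preceq> m"
      unfolding Bs_def ee_divs_iff by blast
    then obtain s where s: "s \<preceq> m" "xmon s \<in> K" using assms(2,3) by metis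
    then obtain t where "m = t + s" using divs_iff by blast
    then show ?thesis using hidealD(3)[OF K s(2)] by (simp add: xmon_add)
  qed
  have "pv.subspace K" by (rule hideal_subspace[OF K])
  then have "(\<Sum>m\<in>ks p. const (cf p m) * xmon m) \<in> K"
    by (rule pv.subspace_sum) (use x p in \<open>auto simp: mideal_def intro!: hidealD(3)[OF K]\<close>)
  then show ?thesis by (simp only: poly_expand[symmetric])
qed

lemma hideal_plus:
  fixes f :: "('n::finite, 'k::field) mpoly"
  assumes I: "hideal I" and f: "homog d f" shows "hideal {p. \<exists>v. p - f * v \<in> I}"
  unfolding hideal_def
proof (intro conjI ballI allI)
  let ?K = "{p. \<exists>v. p - f * v \<in> I}"
  show "0 \<in> ?K" using hidealD(1)[OF I] by (auto intro: exI[of _ 0])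
  fix p assume "p \<in> ?K"
  then obtain v where v: "p - f * v \<in> I" by blast
  show "q * p \<in> ?K" for q
  proof -
    have "q * p - f * (q * v) \<in> I"
      using hidealD(3)[OF I v, of q] by (simp only: right_diff_distrib mult.left_commute)
    then show ?thesis by blast
  qed
  show "hp UNIV k p \<in> ?K" for k
    using hidealD(5)[OF I v, of k] by (auto simp: hp_diff hp_mult[OF f])
  fix q assume "q \<in> ?K"
  then obtain u where u: "q - f * u \<in> I" by blast
  have "(p + q) - f * (v + u) = (p - f * v) + (q - f * u)" by (simp add: algebra_simps)
  then have "(p + q) - f * (v + u) \<in> I" using hidealD(2)[OF I v u] by (rule ssubst)
  then show "p + q \<in> ?K" by blast
qed

section \<open>Quadratic monomials and variables together with one binomial\<close>

definition bideal ::
  "('n::finite \<Rightarrow>\<^sub>0 nat) set \<Rightarrow> 'n set \<Rightarrow> ('n \<Rightarrow>\<^sub>0 nat) \<Rightarrow> ('n \<Rightarrow>\<^sub>0 nat) \<Rightarrow> ('n, 'k::field) mpoly set"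
  where "bideal G T r1 r2 = {p. \<exists>h. p - (xmon r1 + xmon r2) * h \<in> qideal G T}"

lemma bideal_commute: "bideal G T r1 r2 = bideal G T r2 r1"
  by (simp add: bideal_def add.commute)

lemma bideal_base: "p \<in> qideal G T \<Longrightarrow> p \<in> bideal G T r1 r2"
  by (auto simp: bideal_def intro: exI[of _ 0])

lemma bideal_gen: "(xmon r1 + xmon r2) * h \<in> bideal G T r1 r2"
  by (auto simp: bideal_def intro: exI[of _ h])

lemma hom_binomial: "wd D r1 = e \<Longrightarrow> wd D r2 = e \<Longrightarrow> hom D (int e) (xmon r1 + xmon r2)"
  using hom_xmon[of D r1] hom_xmon[of D r2] by (intro hom_add) simp_all

text \<open>Stated for partial degrees because the top-part argument grades by the two variables of
  the binomial only.\<close>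

lemma bideal_hp:
  assumes "wd D r1 = e" "wd D r2 = e" "p \<in> bideal G T r1 r2" shows "hp D k p \<in> bideal G T r1 r2"
proof -
  obtain h where "p - (xmon r1 + xmon r2) * h \<in> qideal G T" using assms(3) by (auto simp: bideal_def)
  then have "hp D k (p - (xmon r1 + xmon r2) * h) \<in> qideal G T" by (rule hp_in_mideal)
  then show ?thesis unfolding bideal_def hp_diff hp_mult[OF hom_binomial[OF assms(1,2)]] by blast
qed

lemma bideal_hideal:
  assumes "tdeg r1 = e" "tdeg r2 = e"
  shows "hideal (bideal G T r1 r2 :: ('n::finite, 'k::field) mpoly set)"
  unfolding hideal_def
proof (intro conjI ballI allI)
  let ?e = "xmon r1 + xmon r2 :: ('n, 'k) mpoly"
  show "0 \<in> bideal G T r1 r2" by (intro bideal_base) simp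
  fix p :: "('n, 'k) mpoly" assume p: "p \<in> bideal G T r1 r2"
  then show "hp UNIV k p \<in> bideal G T r1 r2" for k by (rule bideal_hp[OF assms])
  obtain h where h: "p - ?e * h \<in> qideal G T" using p by (auto simp: bideal_def)
  show "q * p \<in> bideal G T r1 r2" for q
  proof -
    have "q * (p - ?e * h) \<in> qideal G T" by (rule qideal_mult[OF h])
    then have "q * p - ?e * (q * h) \<in> qideal G T" by (simp only: right_diff_distrib mult.left_commute)
    then show ?thesis unfolding bideal_def by blast
  qed
  fix q :: "('n, 'k) mpoly" assume "q \<in> bideal G T r1 r2"
  then obtain g where g: "q - ?e * g \<in> qideal G T" by (auto simp: bideal_def)
  have "(p - ?e * h) + (q - ?e * g) \<in> qideal G T" by (rule mideal_add[OF h g])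
  moreover have "(p - ?e * h) + (q - ?e * g) = (p + q) - ?e * (h + g)" by (simp add: algebra_simps)
  ultimately show "p + q \<in> bideal G T r1 r2" unfolding bideal_def by auto
qed

lemma bideal_sub:
  fixes p :: "('n::finite, 'k::field) mpoly"
  assumes "p \<in> bideal G T m1 m2" shows "p \<in> qideal (insert m1 (insert m2 G)) T"
proof -
  let ?G = "insert m1 (insert m2 G)"
  obtain h where h: "p - (xmon m1 + xmon m2) * h \<in> qideal G T" using assms by (auto simp: bideal_def)
  have "(xmon m1 + xmon m2) * h \<in> qideal ?G T"
    by (intro qideal_mult2 mideal_add qideal_xmon Bs_gen) simp_all
  moreover have "p - (xmon m1 + xmon m2) * h \<in> qideal ?G T" by (rule qideal_mono[OF _ _ h]) auto
  ultimately have "p - (xmon m1 + xmon m2) * h + (xmon m1 + xmon m2) * h \<in> qideal ?G T"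
    by (rule mideal_add[rotated])
  then show ?thesis by simp
qed

text \<open>Modulo the ideal \<open>xmon m2\<close> is minus \<open>xmon m1\<close>, so adding the
  latter already gives the whole monomial ideal.\<close>

lemma bideal_split:
  fixes p :: "('n::finite, 'k::field) mpoly"
  assumes w: "tdeg m1 = e" "tdeg m2 = e" and p: "p \<in> qideal (insert m1 (insert m2 G)) T"
  shows "\<exists>v. p - xmon m1 * v \<in> bideal G T m1 m2"
proof -
  let ?I = "bideal G T m1 m2 :: ('n, 'k) mpoly set"
  let ?K = "{p. \<exists>v. p - xmon m1 * v \<in> ?I}"
  note I = bideal_hideal[OF w, of G T, where 'k = 'k]
  have IK: "q \<in> ?K" if "q \<in> ?I" for q using that by (auto intro!: exI[of _ 0])
  have "p \<in> ?K"
  proof (rule qideal_least[OF hideal_plus[OF I hom_xmon] _ _ p])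
    fix g assume "g \<in> insert m1 (insert m2 G)"
    then consider "g = m1" | "g = m2" | "g \<in> G" by blast
    then show "xmon g \<in> ?K"
    proof cases
      case 1
      then show ?thesis using hidealD(1)[OF I] by (auto intro!: exI[of _ 1])
    next
      case 2
      then show ?thesis using bideal_gen[of m1 m2 1 G T] by (auto intro!: exI[of _ "-1"] simp: add.commute)
    next
      case 3
      then show ?thesis by (intro IK bideal_base qideal_xmon Bs_gen)
    qed
  next
    fix i assume "i \<in> T"
    then show "xmon (ee i) \<in> ?K"
      by (intro IK bideal_base qideal_xmon) (auto simp: Bs_def intro!: bexI[of _ i])
  qed
  then show ?thesis by blast
qed

lemma bideal_monomial:
  assumes w: "tdeg m1 = e" "tdeg m2 = e" and m: "m1 \<in> G \<or> m2 \<in> G"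
  shows "bideal G {} m1 m2 = (qideal (insert m1 (insert m2 G)) {} :: ('n::finite, 'k::field) mpoly set)"
proof (intro equalityI subsetI bideal_sub)
  let ?I = "bideal G {} m1 m2 :: ('n, 'k) mpoly set"
  note I = bideal_hideal[OF w, of G "{}", where 'k = 'k]
  have e: "xmon m1 + xmon m2 \<in> ?I" using bideal_gen[of m1 m2 1] by simp
  have g: "xmon g \<in> ?I" if "g \<in> G" for g using that by (intro bideal_base qideal_xmon Bs_gen)
  have "xmon m1 \<in> ?I \<and> xmon m2 \<in> ?I"
    using m g hidealD(6)[OF I e, of "xmon m1"] hidealD(6)[OF I e, of "xmon m2"] by auto
  then show "p \<in> ?I" if "p \<in> qideal (insert m1 (insert m2 G)) {}" for p
    using g by (intro qideal_least[OF I _ _ that]) auto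
qed

text \<open>The colon by a variable of \<open>r\<close> only adds its neighbours, which are in
  \<open>T\<close> already; so \<open>r\<close> is divided out one variable at a time.\<close>

lemma qideal_nzd:
  assumes "quad G" "\<And>i. 0 < cf r i \<Longrightarrow> i \<notin> T \<and> Nb G i \<subseteq> T" "xmon r * p \<in> qideal G T"
  shows "p \<in> qideal G T"
  using assms(2,3)
proof (induction "tdeg r" arbitrary: r)
  case 0
  then have "r = 0" by (intro poly_mapping_eqI) (simp add: wd_def)
  then show ?case using 0 by simp
next
  case (Suc n)
  then have "r \<noteq> 0" by auto
  then obtain i where i: "0 < cf r i" by (metis gr0I lookup_zero poly_mapping_eqI)
  then obtain t where t: "r = t + ee i" using ee_divs_iff divs_iff by metis
  have "xmon (ee i) * (xmon t * p) \<in> qideal G T"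
    using Suc.prems(2) by (simp only: t add.commute[of t] xmon_add mult.assoc)
  then have "xmon t * p \<in> qideal G (T \<union> Nb G i)" using qideal_colon[OF assms(1)] Suc.prems(1)[OF i] by blast
  moreover have "T \<union> Nb G i = T" using Suc.prems(1)[OF i] by blast
  ultimately have "xmon t * p \<in> qideal G T" by simp
  moreover have "n = tdeg t" using Suc.hyps(2) t by simp
  moreover have "0 < cf t j \<Longrightarrow> 0 < cf r j" for j by (simp add: t lookup_add)
  ultimately show ?case using Suc.hyps(1) Suc.prems(1) by blast
qed

text \<open>Only terms of \<open>h\<close> free of the variable \<open>i\<close> are an obstruction to dividing
  \<open>x\<^sub>i g - (x\<^sup>r\<^sup>1 + x\<^sup>r\<^sup>2) h\<close> by \<open>x\<^sub>i\<close>, and these already lie in the monomial part.\<close>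
lemma bideal_nzd:
  fixes g :: "('n::finite, 'k::field) mpoly"
  assumes quad: "quad G" and r1: "\<And>i. 0 < cf r1 i \<Longrightarrow> i \<notin> T \<and> Nb G i \<subseteq> T"
    and r2: "\<And>i. 0 < cf r2 i \<Longrightarrow> i \<notin> T \<and> Nb G i \<subseteq> T"
    and i: "0 < cf r1 i" "cf r2 i = 0" and g: "xmon (ee i) * g \<in> bideal G T r1 r2"
  shows "g \<in> bideal G T r1 r2"
proof -
  let ?e = "xmon r1 + xmon r2 :: ('n, 'k) mpoly" and ?x = "xmon (ee i) :: ('n, 'k) mpoly"
  obtain h where h: "?x * g - ?e * h \<in> qideal G T" using g by (auto simp: bideal_def)
  define h0 where "h0 = hp {i} 0 h"
  define h1 where "h1 = dv (ee i) (h - h0)"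
  have "?x * h1 = h - h0"
    unfolding h1_def
  proof (rule xmon_dv)
    fix m assume "m \<in> ks (h - h0)"
    then have "cf h m \<noteq> cf h0 m" by (simp add: in_keys_iff lookup_minus)
    then have "wd {i} m \<noteq> 0" by (simp add: h0_def hp_def split: if_splits)
    then show "ee i \<preceq> m" by (simp add: ee_divs_iff wd_def)
  qed
  then have h1: "h = ?x * h1 + h0" by simp
  have v: "hp {i} 0 (xmon s * p) = 0" if "0 < cf s i" for s p
    using hp_mult[OF hom_xmon, of "{i}" 0 s p] that hom_neg[OF hom_hp[of "{i}" "0 - int (wd {i} s)" p]]
    by (simp add: wd_def)
  have "hp {i} 0 (xmon r2 * h) = xmon r2 * h0"
    using hp_mult[OF hom_xmon, of "{i}" 0 r2 h] i(2) by (simp add: wd_def h0_def)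
  moreover have "hp {i} 0 (?x * g - ?e * h) \<in> qideal G T" by (rule hp_in_mideal[OF h])
  ultimately have "0 - (0 + xmon r2 * h0) \<in> qideal G T"
    using v[of "ee i" g] v[OF i(1), of h] by (simp add: hp_diff hp_add distrib_right)
  then have "xmon r2 * h0 \<in> qideal G T" using mideal_uminus by fastforce
  then have "h0 \<in> qideal G T" by (rule qideal_nzd[OF quad, rotated]) (rule r2)
  then have "(?x * g - ?e * h) + ?e * h0 \<in> qideal G T" by (rule mideal_add[OF h qideal_mult])
  then have "?x * (g - ?e * h1) \<in> qideal G T" by (simp add: h1 algebra_simps)
  then have "g - ?e * h1 \<in> qideal G T"
    by (rule qideal_nzd[OF quad, rotated]) (use r1[OF i(1)] in \<open>auto simp: lookup_single when_def split: if_splits\<close>)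
  then show ?thesis by (auto simp: bideal_def)
qed

lemma bideal_nzd_power:
  fixes g :: "('n::finite, 'k::field) mpoly"
  assumes quad: "quad G" and r1: "\<And>i. 0 < cf r1 i \<Longrightarrow> i \<notin> T \<and> Nb G i \<subseteq> T"
    and r2: "\<And>i. 0 < cf r2 i \<Longrightarrow> i \<notin> T \<and> Nb G i \<subseteq> T"
    and i: "0 < cf r1 i" "cf r2 i = 0" and g: "xmon (Poly_Mapping.single i k) * g \<in> bideal G T r1 r2"
  shows "g \<in> bideal G T r1 r2"
  using g
proof (induction k)
  case (Suc k)
  have "Poly_Mapping.single i (Suc k) = ee i + Poly_Mapping.single i k" by (simp add: single_add[symmetric])
  then have "xmon (ee i) * (xmon (Poly_Mapping.single i k) * g) \<in> bideal G T r1 r2"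
    using Suc.prems by (simp only: xmon_add mult.assoc)
  then show ?case using Suc.IH bideal_nzd[OF quad r1 r2 i] by blast
qed simp

lemma bideal_proper:
  assumes "quad G" "r1 \<noteq> 0" "r2 \<noteq> 0" shows "(1 :: ('n::finite, 'k::field) mpoly) \<notin> bideal G T r1 r2"
proof
  assume "(1 :: ('n, 'k) mpoly) \<in> bideal G T r1 r2"
  then obtain h :: "('n, 'k) mpoly" where h: "1 - (xmon r1 + xmon r2) * h \<in> qideal G T" by (auto simp: bideal_def)
  have "\<not> r \<preceq> 0" if "r \<noteq> 0" for r :: "'n \<Rightarrow>\<^sub>0 nat"
    using that by (metis divs_def le_zero_eq lookup_zero poly_mapping_eqI)
  then have "cf (1 - (xmon r1 + xmon r2) * h) 0 = 1"
    using assms by (simp add: lookup_minus distrib_right lookup_add cf_xmon_mult_0)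
  then have "0 \<in> Bs G T" using h by (auto simp: mideal_def in_keys_iff)
  then obtain g where "g \<in> G" "g \<preceq> 0" by (auto simp: Bs_def)
  moreover from this have "g = 0" by (intro poly_mapping_eqI) (simp add: divs_def)
  ultimately show False using assms(1) by (auto simp: quad_def)
qed

text \<open>The two factors of \<open>q\<close> both come from \<open>m\<close>, both from
  \<open>t\<close>, or one from each.\<close>

lemma quad_divs_add:
  assumes "tdeg q = 2" "q \<preceq> t + m"
  shows "q \<preceq> m \<or> q \<preceq> t \<or> (\<exists>i. 0 < cf t i \<and> q \<preceq> m + ee i)"
proof -
  obtain k l where q: "q = ee k + ee l" using wd_2_ee[OF assms(1)] by blast
  show ?thesis
  proof (cases "k = l")
    case True
    have "2 \<le> cf t l + cf m l" using assms(2) unfolding q ee2_divs True by (simp add: lookup_add)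
    then have "2 \<le> cf m l \<or> 2 \<le> cf t l \<or> (0 < cf t l \<and> 2 \<le> cf (m + ee l) l)"
      by (simp add: lookup_add) linarith
    then show ?thesis unfolding q ee2_divs True by auto
  next
    case False
    have *: "0 < cf t k + cf m k" "0 < cf t l + cf m l"
      using assms(2) unfolding q ee2_divs using False by (simp_all add: lookup_add)
    have "0 < cf (m + ee i) j \<longleftrightarrow> 0 < cf m j \<or> i = j" for i j by (auto simp: lookup_add lookup_single when_def)
    then show ?thesis unfolding q ee2_divs using False * by (simp add: if_not_P) (metis add_gr_0)
  qed
qed

subsection \<open>The ideal generated by monomials and one binomial\<close>

text \<open>\<open>s\<close> is the greatest common divisor of the two monomials. That neither
  monomial is in the monomial part separates this case from the one in
  \<open>bideal_monomial\<close>.\<close>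

locale binomial_ideal =
  fixes G0 :: "('n::finite \<Rightarrow>\<^sub>0 nat) set" and s r1 r2 :: "'n \<Rightarrow>\<^sub>0 nat" and ty :: "'k::field itself"
  assumes quad0: "quad G0" and w: "tdeg (s + r1) = 2" "tdeg (s + r2) = 2" "r1 \<noteq> 0" "r2 \<noteq> 0"
    and coprime: "\<And>i. cf r1 i = 0 \<or> cf r2 i = 0"
    and m: "s + r1 \<notin> Bs G0 {}" "s + r2 \<notin> Bs G0 {}"
begin

abbreviation "m1 \<equiv> s + r1"
abbreviation "m2 \<equiv> s + r2"
abbreviation "f1 \<equiv> xmon m1 :: ('n, 'k) mpoly"
abbreviation "f2 \<equiv> xmon m2 :: ('n, 'k) mpoly"
abbreviation "G \<equiv> insert m1 (insert m2 G0)"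
abbreviation "I \<equiv> bideal G0 {} m1 m2 :: ('n, 'k) mpoly set"
text \<open>Variables that kill one of the two monomials modulo \<open>G0\<close>; since f1 = - f2
  modulo \<open>I\<close>, they kill both there.\<close>

definition "A = {i. m1 + ee i \<in> Bs G0 {} \<or> m2 + ee i \<in> Bs G0 {}}"
text \<open>The candidate for (I : f1). The binomial of the cofactors belongs to it because
  \<open>xmon r1 * f2 = xmon r2 * f1\<close>.\<close>

abbreviation "K \<equiv> bideal G0 A r1 r2 :: ('n, 'k) mpoly set"

lemma swap: "binomial_ideal G0 s r2 r1"
  by unfold_locales (use quad0 w m coprime in \<open>auto simp: disj_commute\<close>)

lemma quad: "quad G" using quad0 w by (auto simp: quad_def)

lemma I: "hideal I" by (rule bideal_hideal[OF w(1,2)])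
lemma wr: "tdeg r1 = tdeg r2" using w by simp
lemma K: "hideal K" using bideal_hideal[OF wr refl] .

lemmas iI = hidealD[OF I]
lemmas iK = hidealD[OF K]

lemma f12: "f1 + f2 \<in> I" using bideal_gen[of m1 m2 1] by simp

lemma f1_f2: "f1 * g \<in> I \<longleftrightarrow> f2 * g \<in> I"
proof -
  have e: "f1 * g + f2 * g \<in> I" using iI(4)[OF f12] by (simp add: distrib_right)
  show ?thesis using iI(6)[OF e, of "f1 * g"] iI(6)[OF e, of "f2 * g"] by auto
qed

lemma I_sub: "p \<in> I \<Longrightarrow> p \<in> qideal G {}"
  by (rule bideal_sub)

lemma split: "p \<in> qideal G {} \<Longrightarrow> \<exists>v. p - f1 * v \<in> I"
  by (rule bideal_split[OF w(1,2)])

lemma cross: "xmon r1 * f2 = xmon r2 * f1"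
  by (simp add: xmon_add mult_ac)

lemma Bs_A:
  assumes "m \<in> {m1, m2}" "t + m \<in> Bs G0 {}" shows "t \<in> Bs G0 A"
proof -
  obtain q where q: "q \<in> G0" "q \<preceq> t + m" using assms(2) by (auto simp: Bs_def)
  have "tdeg q = 2" using quad0 q(1) by (auto simp: quad_def)
  moreover have "\<not> q \<preceq> m" using m q(1) assms(1) by (auto simp: Bs_def)
  ultimately consider "q \<preceq> t" | i where "0 < cf t i" "q \<preceq> m + ee i" using quad_divs_add q(2) by blast
  then show ?thesis
  proof cases
    case 2
    then have "m + ee i \<in> Bs G0 {}" using q(1) by (auto simp: Bs_def)
    then have "i \<in> A" using assms(1) by (auto simp: A_def)
    then show ?thesis using 2 by (auto simp: Bs_def)
  qed (use q in \<open>auto simp: Bs_def\<close>)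
qed

text \<open>Induction on the number of terms of \<open>h\<close>. A term t with t m2 in the monomial
  part is absorbed into \<open>g\<close>. Otherwise t m2 must be cancelled by a multiple of
  \<open>m1\<close>; by coprimality \<open>r1\<close> divides t, and the term turns into a multiple
  of f1.\<close>

lemma colonD: "f1 * g - (f1 + f2) * h \<in> qideal G0 {} \<Longrightarrow> g \<in> K"
proof (induction "card (ks h)" arbitrary: g h)
  case 0
  then have "h = 0" by simp
  then have "xmon m1 * g \<in> qideal G0 {}" using 0 by simp
  then have "g \<in> qideal G0 A" by (rule mideal_xmon_mult[rotated]) (rule Bs_A, simp_all)
  then show ?case by (rule bideal_base)
next
  case (Suc n)
  then have "ks h \<noteq> {}" by force
  then obtain t where t: "t \<in> ks h" by blast
  define y where "y = const (cf h t) * (xmon t :: ('n, 'k) mpoly)"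
  define h' where "h' = h - y"
  have cy: "cf y u = (if u = t then cf h t else 0)" for u
    by (auto simp: y_def xmon_def lookup_single when_def)
  have "ks h' = ks h - {t}" by (auto simp: h'_def in_keys_iff lookup_minus cy split: if_splits)
  then have c: "n = card (ks h')" using Suc.hyps(2) t by simp
  have h: "h = y + h'" by (simp add: h'_def)
  show ?case
  proof (cases "t + m2 \<in> Bs G0 {}")
    case True
    have "xmon t \<in> qideal G0 A" using Bs_A[OF _ True] by (intro qideal_xmon) simp
    then have yK: "y \<in> K" unfolding y_def by (intro bideal_base qideal_mult)
    have "f2 * xmon t = xmon (t + m2)" by (simp add: xmon_add mult_ac)
    then have "f2 * xmon t \<in> qideal G0 {}" using qideal_xmon[OF True] by simp
    then have "const (cf h t) * (f2 * xmon t) \<in> qideal G0 {}" by (rule qideal_mult)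
    then have "f2 * y \<in> qideal G0 {}" unfolding y_def by (simp only: mult.left_commute)
    then have "(f1 * g - (f1 + f2) * h) + f2 * y \<in> qideal G0 {}" by (rule mideal_add[OF Suc.prems])
    then have "f1 * (g - y) - (f1 + f2) * h' \<in> qideal G0 {}" unfolding h by (simp add: algebra_simps)
    then have "g - y \<in> K" using Suc.hyps(1)[OF c] by blast
    then have "(g - y) + y \<in> K" using yK by (rule iK(2))
    then show ?thesis by simp
  next
    case False
    have "r1 \<preceq> t"
    proof (rule ccontr)
      assume n: "\<not> r1 \<preceq> t"
      have nm: "\<not> m1 \<preceq> t + m2"
      proof
        assume "m1 \<preceq> t + m2"
        then have "cf r1 i \<le> cf t i" for i
          using coprime[of i] unfolding divs_def by (auto simp: lookup_add dest: spec[of _ i])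
        then show False using n by (simp add: divs_def)
      qed
      have "cf (f1 * g - (f1 + f2) * h) (t + m2) = cf (f1 * (g - h)) (t + m2) - cf (f2 * h) (t + m2)"
        by (simp add: algebra_simps lookup_minus lookup_add)
      also have "\<dots> = - cf h t" by (simp add: cf_xmon_mult_0[OF nm])
      finally have "t + m2 \<in> ks (f1 * g - (f1 + f2) * h)" using t by (simp add: in_keys_iff)
      then show False using Suc.prems False by (auto simp: mideal_def)
    qed
    then obtain t' where t': "t = t' + r1" by (auto simp: divs_iff)
    define z where "z = const (cf h t) * (xmon t' :: ('n, 'k) mpoly)"
    have y: "y = z * xmon r1" by (simp add: y_def z_def t' xmon_add mult_ac)
    have "f2 * y = z * (xmon r1 * f2)" unfolding y by (simp only: mult_ac)
    also have "\<dots> = z * (xmon r2 * f1)" by (simp only: cross)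
    finally have "(f1 + f2) * y = f1 * ((xmon r1 + xmon r2) * z)"
      unfolding distrib_right by (simp only: y) (simp only: distrib_left distrib_right mult_ac)
    then have "f1 * (g - (xmon r1 + xmon r2) * z) - (f1 + f2) * h' = f1 * g - (f1 + f2) * h"
      unfolding h right_diff_distrib distrib_left by simp
    then have "g - (xmon r1 + xmon r2) * z \<in> K" using Suc.hyps(1)[OF c] Suc.prems by simp
    then have "(g - (xmon r1 + xmon r2) * z) + (xmon r1 + xmon r2) * z \<in> K" using bideal_gen by (rule iK(2))
    then show ?thesis by simp
  qed
qed

lemma f1_A: "i \<in> A \<Longrightarrow> f1 * xmon (ee i) \<in> I"
proof -
  assume "i \<in> A"
  then consider "m1 + ee i \<in> Bs G0 {}" | "m2 + ee i \<in> Bs G0 {}" by (auto simp: A_def)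
  then have "f1 * xmon (ee i) \<in> I \<or> f2 * xmon (ee i) \<in> I"
    unfolding xmon_add[symmetric] using bideal_base qideal_xmon by metis
  then show ?thesis using f1_f2 by blast
qed

lemma f1_e: "f1 * (xmon r1 + xmon r2) \<in> I"
proof -
  have "f1 * (xmon r1 + xmon r2) = xmon r1 * (f1 + f2)"
    using cross by (simp add: distrib_left mult.commute)
  then show ?thesis using iI(3)[OF f12] by simp
qed

lemma colon_hideal: "hideal {g. f1 * g \<in> I}"
  unfolding hideal_def
proof (intro conjI ballI allI)
  show "0 \<in> {g. f1 * g \<in> I}" using iI(1) by simp
  fix p assume p: "p \<in> {g. f1 * g \<in> I}"
  show "q * p \<in> {g. f1 * g \<in> I}" for q using iI(3)[of "f1 * p" q] p by (simp add: mult.left_commute)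
  show "hp UNIV k p \<in> {g. f1 * g \<in> I}" for k
    using iI(5)[of "f1 * p" "k + int (tdeg m1)"] p hp_mult[OF hom_xmon, of UNIV "k + int (tdeg m1)" m1 p] by simp
  show "p + q \<in> {g. f1 * g \<in> I}" if "q \<in> {g. f1 * g \<in> I}" for q
    using iI(2) p that by (simp add: distrib_left)
qed

lemma colon: "f1 * g \<in> I \<longleftrightarrow> g \<in> K"
proof
  assume "f1 * g \<in> I"
  then obtain h where "f1 * g - (f1 + f2) * h \<in> qideal G0 {}" by (auto simp: bideal_def)
  then show "g \<in> K" by (rule colonD)
next
  assume "g \<in> K"
  then obtain h where h: "g - (xmon r1 + xmon r2) * h \<in> qideal G0 A" by (auto simp: bideal_def)
  have "g - (xmon r1 + xmon r2) * h \<in> {g. f1 * g \<in> I}"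
  proof (rule qideal_least[OF colon_hideal _ _ h])
    show "xmon g \<in> {g. f1 * g \<in> I}" if "g \<in> G0" for g
    proof -
      have "(xmon g :: ('n, 'k) mpoly) \<in> I" using that by (intro bideal_base qideal_xmon Bs_gen)
      then show ?thesis using iI(3) by blast
    qed
    show "xmon (ee i) \<in> {g. f1 * g \<in> I}" if "i \<in> A" for i using f1_A[OF that] by simp
  qed
  moreover have "(xmon r1 + xmon r2) * h \<in> {g. f1 * g \<in> I}"
    using iI(4)[OF f1_e, of h] by (simp add: mult.assoc)
  ultimately have "(g - (xmon r1 + xmon r2) * h) + (xmon r1 + xmon r2) * h \<in> {g. f1 * g \<in> I}"
    by (rule hidealD(2)[OF colon_hideal])
  then show "f1 * g \<in> I" by simp
qed

end

subsection \<open>Exact pairs with a linear form\<close>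

lemma wd_single [simp]: "tdeg (Poly_Mapping.single (i :: 'n::finite) k) = k"
proof -
  have "tdeg (Poly_Mapping.single i k) = (\<Sum>j\<in>UNIV. if i = j then k else 0)"
    by (simp add: wd_def lookup_single when_def)
  then show ?thesis by (simp add: sum.delta)
qed

lemma wd_eq_0: "tdeg m = 0 \<longleftrightarrow> m = 0"
  by (auto simp: wd_def intro: poly_mapping_eqI)

lemma wd_divs: "g \<preceq> m \<Longrightarrow> tdeg g \<le> tdeg m"
  unfolding wd_def divs_def by (intro sum_mono) simp

lemma wd_divs_eq: assumes "g \<preceq> m" "tdeg g = tdeg m" shows "g = m"
proof -
  obtain t where t: "m = t + g" using assms(1) divs_iff by blast
  then have "tdeg t = 0" using assms(2) by simp
  then have "t = 0" by (simp add: wd_eq_0)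
  then show ?thesis using t by simp
qed

lemma Bs_wd2: assumes "quad G" "tdeg m = 2" shows "m \<in> Bs G {} \<longleftrightarrow> m \<in> G"
  using wd_divs_eq[of _ m] assms Bs_gen[of m G "{}"] unfolding Bs_def quad_def by fastforce

lemma Bs_low: assumes "quad G" "tdeg m < 2" shows "m \<notin> Bs G {}"
  using wd_divs[of _ m] assms unfolding Bs_def quad_def by fastforce

lemma cf_linear_form_quad:
  "cf (linear_form a * p) (ee i + ee j) =
    (if i = j then a i * cf p (ee i) else a i * cf p (ee j) + a j * cf p (ee i))"
proof -
  have "cf (linear_form a * p) (ee i + ee j) =
      (\<Sum>k\<in>UNIV. (if k = i then a i * cf p (ee j) else 0) + (if k = j \<and> i \<noteq> j then a j * cf p (ee i) else 0))"
    unfolding cf_linear_form_mult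
    by (intro sum.cong) (auto simp: lookup_add lookup_single when_def add.commute)
  then show ?thesis by (simp add: sum.distrib)
qed

lemma cf_xmon_ee: "cf (xmon (ee u) :: ('n, 'k::comm_ring_1) mpoly) (ee v) = (if u = v then 1 else 0)"
  using arg_cong[OF dv_ee_xmon[where 'k = 'k, of v u], of "\<lambda>p. cf p 0"]
    cf_dv[of "ee v" "xmon (ee u) :: ('n, 'k) mpoly" 0]
  by (auto simp: lookup_one)

lemma hom_0_const: assumes "homog 0 p" shows "p = const (cf p 0)"
proof (rule poly_mapping_eqI)
  fix m
  have "m = 0" if "m \<in> ks p" using assms that by (auto simp: hom_def wd_eq_0)
  then show "cf p m = cf (const (cf p 0)) m"
    by (cases "m = 0") (auto simp: const_def lookup_single when_def in_keys_iff)
qed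

text \<open>The common setting of both cases: \<open>I\<close> is the monomial ideal of
  \<open>G\<close> or a binomial ideal inside it.\<close>

locale exact_pair =
  fixes G :: "('n::finite \<Rightarrow>\<^sub>0 nat) set" and a :: "'n \<Rightarrow> 'k::field" and Q :: "('n, 'k) mpoly"
    and I :: "('n, 'k) mpoly set" and d :: nat
  assumes quad: "quad G" and a: "\<And>i. a i \<noteq> 0" and Q: "homog (int d) Q"
    and I: "hideal I" and I_sub: "\<And>p. p \<in> I \<Longrightarrow> p \<in> qideal G {}"
    and lQ: "linear_form a * Q \<in> I"
    and ex1: "\<And>p. linear_form a * p \<in> I \<Longrightarrow> \<exists>w. p - Q * w \<in> I"
    and ex2: "\<And>p. Q * p \<in> I \<Longrightarrow> \<exists>w. p - linear_form a * w \<in> I"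
begin

abbreviation "l \<equiv> linear_form a"

lemmas iI = hidealD[OF I]

lemma low: assumes "p \<in> I" "tdeg m < 2" shows "cf p m = 0"
  using I_sub[OF assms(1)] Bs_low[OF quad assms(2)] by (auto simp: mideal_def in_keys_iff)

lemma Q_notin: "Q \<notin> I"
proof
  assume "Q \<in> I"
  then have "Q * 1 \<in> I" by simp
  then obtain w where "1 - l * w \<in> I" using ex2 by blast
  then have "cf (1 - l * w) 0 = 0" by (rule low) simp
  then show False by (simp add: lookup_minus cf_linear_form_mult)
qed

lemma d_pos: "0 < d"
proof (rule ccontr)
  assume "\<not> 0 < d"
  then have m0: "m = 0" if "m \<in> ks Q" for m
    using Q that by (auto simp: hom_def wd_eq_0)
  obtain i :: 'n where True by blast
  have "cf (l * Q) (ee i) = 0" by (rule low[OF lQ]) simp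
  moreover have "cf (l * Q) (ee i) = (\<Sum>j\<in>UNIV. if j = i then a i * cf Q 0 else 0)"
    unfolding cf_linear_form_mult
    by (intro sum.cong) (auto simp: lookup_single when_def)
  ultimately have "cf Q 0 = 0" using a by simp
  then have "ks Q = {}" using m0 by (metis all_not_in_conv in_keys_iff)
  then have "Q = 0" by simp
  then show False using Q_notin iI(1) by simp
qed

text \<open>l is a nonzerodivisor in high degrees modulo \<open>G\<close>, by
  \<open>qideal_large\<close>, and on the multiples of \<open>f\<close>, by \<open>nzd\<close>;
  together this forces Q to kill high degrees. The monomial case is f = 0.\<close>

lemma artinian:
  assumes f: "homog 2 f" and split: "\<And>p. p \<in> qideal G {} \<Longrightarrow> \<exists>v. p - f * v \<in> I"
    and nzd: "\<And>k v. N \<le> k \<Longrightarrow> homog k v \<Longrightarrow> f * (l * v) \<in> I \<Longrightarrow> f * v \<in> I"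
  shows "\<exists>M. \<forall>k\<ge>M. \<forall>p. homog k p \<longrightarrow> p \<in> I"
proof (rule exact_pair_artinian[OF I hom_linear_form Q lQ ex1 ex2])
  \<comment> \<open>The bound makes the degree d + k of \<open>Q * p\<close> exceed n and the degree
    d + k - 2 of its cofactor at least \<open>N\<close>.\<close>
  fix k and p :: "('n, 'k) mpoly" assume k: "max N 0 + int (card (UNIV :: 'n set)) + 3 \<le> k" and p: "homog k p"
  have Qp: "homog (int d + k) (Q * p)" by (rule hom_mult[OF Q p])
  have lQp: "l * (Q * p) \<in> I" using iI(4)[OF lQ, of p] by (simp add: mult.assoc)
  have "Q * p \<in> qideal G {}"
    by (rule qideal_large[OF a quad Qp _ I_sub[OF lQp]]) (use k in simp)
  then obtain v0 where v0: "Q * p - f * v0 \<in> I" using split by blast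
  obtain v where v: "homog (int d + k - 2) v" "Q * p - f * v \<in> I"
    using hideal_homogenise[OF I Qp f v0] by blast
  have "l * (Q * p) - l * (Q * p - f * v) \<in> I" by (rule iI(6)[OF lQp iI(3)[OF v(2)]])
  then have "f * (l * v) \<in> I" by (simp add: algebra_simps)
  then have "f * v \<in> I" by (rule nzd[OF _ v(1), rotated]) (use k in simp)
  then have "(Q * p - f * v) + f * v \<in> I" by (rule iI(2)[OF v(2)])
  then show "Q * p \<in> I" by simp
qed

text \<open>A high power of the variable lies in the monomial ideal, and its square is the only
  quadratic monomial dividing that power.\<close>

lemma squares:
  assumes "\<exists>M. \<forall>k\<ge>M. \<forall>p. homog k p \<longrightarrow> p \<in> I" shows "ee i + ee i \<in> G"
proof -
  obtain M where M: "\<And>k p. M \<le> k \<Longrightarrow> homog k p \<Longrightarrow> p \<in> I" using assms by blast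
  define k where "k = nat M"
  let ?m = "Poly_Mapping.single i k"
  have "(xmon ?m :: ('n, 'k) mpoly) \<in> I"
    by (rule M[of "int (tdeg ?m)", OF _ hom_xmon]) (simp add: k_def)
  then have "(xmon ?m :: ('n, 'k) mpoly) \<in> qideal G {}" by (rule I_sub)
  then have "?m \<in> Bs G {}" by (simp add: mideal_def)
  then obtain g where g: "g \<in> G" "g \<preceq> ?m" by (auto simp: Bs_def)
  then obtain u v where uv: "g = ee u + ee v" using quad wd_2_ee by (metis quad_def)
  have "0 < cf g u" "0 < cf g v" by (simp_all add: uv lookup_add)
  then have "0 < cf ?m u" "0 < cf ?m v" using g(2) unfolding divs_def by (metis less_le_trans)+
  then have "u = i" "v = i" by (simp_all add: lookup_single when_def split: if_splits)
  then show ?thesis using g(1) uv by simp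
qed

end

text \<open>Written \<open>Q = \<Sum> c\<^sub>i a\<^sub>i x\<^sub>i\<close>, a linear \<open>Q\<close> satisfies \<open>c\<^sub>i + c\<^sub>j = 0\<close> for every \<open>x\<^sub>i x\<^sub>j\<close>
  outside the monomial ideal.\<close>
locale exact_pair_linear = exact_pair G a Q I 1
  for G :: "('n::finite \<Rightarrow>\<^sub>0 nat) set" and a :: "'n \<Rightarrow> 'k::field_char_0" and Q I +
  fixes f :: "('n, 'k) mpoly"
  assumes f: "homog 2 f" and split: "\<And>p. p \<in> qideal G {} \<Longrightarrow> \<exists>v. p - f * v \<in> I"
    and sq: "\<And>i. ee i + ee i \<in> G"
begin

definition "c i = cf Q (ee i) / a i"

lemma Q_cf: "cf Q (ee i) = c i * a i" using a by (simp add: c_def)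

lemma cf_lQ: "cf (l * Q) (ee i + ee j) = (if i = j then c i else c i + c j) * (a i * a j)"
  unfolding cf_linear_form_quad Q_cf by (simp add: algebra_simps)

lemma c_add: assumes "ee i + ee j \<notin> G" shows "c i + c j = 0"
proof -
  have ij: "i \<noteq> j" using sq assms by auto
  have "ee i + ee j \<notin> Bs G {}" using assms Bs_wd2[OF quad, of "ee i + ee j"] by simp
  then have "cf (l * Q) (ee i + ee j) = 0" using I_sub[OF lQ] by (auto simp: mideal_def in_keys_iff)
  then show ?thesis using a ij by (simp add: cf_lQ)
qed

text \<open>The cofactor of l is a constant, and \<open>I\<close> contains no linear forms.\<close>

lemma degree_1:
  assumes "homog 1 p" "Q * p \<in> I"
  shows "\<exists>w. \<forall>i. cf p (ee i) = a i * w"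
proof -
  obtain w0 where "p - l * w0 \<in> I" using ex2 assms(2) by blast
  then obtain w where w: "homog (1 - 1) w" "p - l * w \<in> I"
    using hideal_homogenise[OF I assms(1) hom_linear_form] by blast
  have "cf p (ee i) = a i * cf w 0" for i
  proof -
    have "cf (l * w) (ee i) = (\<Sum>j\<in>UNIV. if j = i then a i * cf w 0 else 0)"
      unfolding cf_linear_form_mult by (intro sum.cong) (auto simp: lookup_single when_def)
    moreover have "cf (p - l * w) (ee i) = 0" by (rule low[OF w(2)]) simp
    ultimately show ?thesis by (simp add: lookup_minus)
  qed
  then show ?thesis by blast
qed

text \<open>A term x_i x_j of the product has c_j nonzero, so c_i + c_j is nonzero and the term is a
  generator by \<open>c_add\<close>. Modulo \<open>I\<close> only a multiple of \<open>f\<close> is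
  left.\<close>

lemma x_Q: assumes "c i = 0" shows "\<exists>t. xmon (ee i) * Q - const t * f \<in> I"
proof -
  have "xmon (ee i) * Q \<in> qideal G {}"
    unfolding mideal_def
  proof clarify
    fix m assume m: "m \<in> ks (xmon (ee i) * Q)"
    then obtain t where t: "m = t + ee i" by (metis cf_xmon_mult_0 divs_iff in_keys_iff)
    then have "t \<in> ks Q" using m by (simp add: in_keys_iff)
    then have "tdeg t = 1" using Q by (auto simp: hom_def)
    then obtain j where j: "t = ee j" using wd_1_ee by blast
    then have "c j \<noteq> 0" using \<open>t \<in> ks Q\<close> Q_cf[of j] by (auto simp: in_keys_iff)
    then have "ee i + ee j \<in> G" using c_add[of i j] assms by auto
    then show "m \<in> Bs G {}" unfolding t j by (intro Bs_gen) (simp add: add.commute)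
  qed
  then obtain v0 where v0: "xmon (ee i) * Q - f * v0 \<in> I" using split by blast
  have "homog (1 + 1) (xmon (ee i) * Q)"
    using hom_mult[OF hom_xmon[of UNIV "ee i"] Q] by simp
  then obtain v where v: "homog (1 + 1 - 2) v" "xmon (ee i) * Q - f * v \<in> I"
    using hideal_homogenise[OF I _ f v0] by blast
  have "v = const (cf v 0)" by (rule hom_0_const) (use v(1) in simp)
  then have "xmon (ee i) * Q - const (cf v 0) * f \<in> I" using v(2) by (simp add: mult.commute)
  then show ?thesis by blast
qed

text \<open>x_i Q and x_j Q are both multiples of \<open>f\<close> modulo \<open>I\<close>, so a
  nonzero combination of x_i and x_j kills Q. It would be a multiple of l, but l involves the third
  variable.\<close>

lemma no_three_zeros:
  assumes "i \<noteq> j" "i \<noteq> k" "j \<noteq> k" "c i = 0" "c j = 0" shows False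
proof -
  let ?x = "\<lambda>i. xmon (ee i) :: ('n, 'k) mpoly"
  obtain s t where s: "?x i * Q - const s * f \<in> I" and t: "?x j * Q - const t * f \<in> I"
    using x_Q assms by meson
  define p where "p = (if s = 0 then ?x i else const t * ?x i - const s * ?x j)"
  have h: "homog 1 (?x i)" for i using hom_xmon[of UNIV "ee i"] by simp
  have "homog 1 p" unfolding p_def using h by (auto intro: hom_diff hom_const_mult)
  moreover have "Q * p \<in> I"
  proof (cases "s = 0")
    case True then show ?thesis using s by (simp add: p_def mult.commute)
  next
    case False
    have "const t * (?x i * Q - const s * f) - const s * (?x j * Q - const t * f) \<in> I"
      by (rule iI(6)[OF iI(3)[OF s] iI(3)[OF t]])
    then show ?thesis using False by (simp add: p_def algebra_simps)
  qed
  ultimately obtain w where w: "\<And>i. cf p (ee i) = a i * w" using degree_1 by blast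
  note e = cf_xmon_ee[where 'k = 'k]
  have "cf p (ee k) = 0" using assms by (simp add: p_def lookup_minus e)
  then have "w = 0" using w a by simp
  then have "cf p (ee i) = 0" "cf p (ee j) = 0" using w by simp_all
  then show False using assms by (simp add: p_def lookup_minus e split: if_splits)
qed

text \<open>For a cubic monomial outside the ideal, the three pair sums of the c's vanish; in
  characteristic zero the c's themselves then vanish.\<close>

lemma cubic: assumes "homog 3 p" shows "p \<in> qideal G {}"
  unfolding mideal_def
proof clarify
  fix m assume "m \<in> ks p"
  then have m3: "tdeg m = 3" using assms by (auto simp: hom_def)
  then have "m \<noteq> 0" by auto
  then obtain i where "0 < cf m i" by (metis gr0I lookup_zero poly_mapping_eqI)
  then obtain t where t: "m = t + ee i" using ee_divs_iff divs_iff by metis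
  then have "tdeg t = 2" using m3 by simp
  then obtain j k where jk: "t = ee j + ee k" using wd_2_ee by blast
  have d: "ee i + ee j \<preceq> m" "ee i + ee k \<preceq> m" "ee j + ee k \<preceq> m"
    unfolding t jk divs_def by (simp_all add: lookup_add)
  show "m \<in> Bs G {}"
  proof (rule ccontr)
    assume "m \<notin> Bs G {}"
    then have n: "ee i + ee j \<notin> G" "ee i + ee k \<notin> G" "ee j + ee k \<notin> G" using d by (auto simp: Bs_def)
    then have ne: "i \<noteq> j" "i \<noteq> k" "j \<noteq> k" using sq by auto
    have e: "c i + c j = 0" "c i + c k = 0" "c j + c k = 0" using n c_add by blast+
    have "2 * c i = (c i + c j) + (c i + c k) - (c j + c k)" by (simp add: algebra_simps)
    then have "c i = 0" using e by simp
    then show False using no_three_zeros[OF ne] e by simp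
  qed
qed

lemma square_generated:
  assumes "\<And>p. homog 3 p \<Longrightarrow> p \<in> I" "homog 2 q" shows "\<exists>w. q - l * w \<in> I"
  using hom_mult[OF Q assms(2)] by (intro ex2 assms(1)) simp

end

text \<open>The instance f = 0. Exactness over \<open>G\<close> itself is now given, so
  \<open>exact_all\<close> provides both steps of the descent.\<close>

theorem exact_pair_monomial:
  fixes a :: "'n::finite \<Rightarrow> 'k::field_char_0"
  assumes "exact_pair G a Q (qideal G {}) d"
  shows "d = 1 \<and> (\<forall>q. homog 2 q \<longrightarrow> (\<exists>w. q - linear_form a * w \<in> qideal G {}))"
proof -
  let ?l = "linear_form a"
  interpret ep: exact_pair G a Q "qideal G {}" d by fact
  have ar: "\<exists>M. \<forall>k\<ge>M. \<forall>p. homog k p \<longrightarrow> p \<in> (qideal G {} :: ('n, 'k) mpoly set)"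
    by (rule ep.artinian[of 0]) auto
  show ?thesis
  proof (cases "d = 1")
    case True
    interpret li: exact_pair_linear G a Q "qideal G {}" 0
      using assms ep.squares[OF ar] unfolding True by (intro exact_pair_linear.intro exact_pair_linear_axioms.intro) auto
    show ?thesis using True li.square_generated li.cubic by blast
  next
    case False
    then have d: "2 \<le> int d" using ep.d_pos by simp
    obtain M where M: "\<And>k p. M \<le> k \<Longrightarrow> homog k p \<Longrightarrow> p \<in> (qideal G {} :: ('n, 'k) mpoly set)"
      using ar by blast
    have Ql: "Q * ?l \<in> qideal G {}" using ep.lQ by (simp add: mult.commute)
    have False
    proof (rule descent_False[OF ep.quad d ep.Q])
      show "exact_at G ?l Q T j" if "M \<le> j" for j T
        unfolding exact_at_def
      proof (intro allI impI exI[of _ 0])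
        fix p :: "('n, 'k) mpoly" assume "homog j p"
        then show "p - Q * 0 \<in> qideal G T" using qideal_mono[of G G "{}" T p] M[OF that] by simp
      qed
      show "\<forall>T. exact_at G Q ?l T j" if "\<And>T. exact_at G ?l Q T (j + int d - 1)" for j
        using exact_all[OF ep.quad ep.Q Ql that] ep.ex2 by (auto simp: exact_at_def)
      show "\<forall>T. exact_at G ?l Q T j" if "\<And>T. exact_at G Q ?l T j" for j
        using exact_all[OF ep.quad hom_linear_form ep.lQ, of j] that ep.ex1 by (auto simp: exact_at_def)
    qed
    then show ?thesis ..
  qed
qed

subsection \<open>Exact pairs modulo a binomial ideal\<close>

text \<open>With p, q constants and x, y variables, this eliminates y from p x + q y modulo x^2 +
  y^2.\<close>

lemma two_squares:
  fixes p q x y v :: "'a::comm_ring_1"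
  shows "(p * x - q * y) * ((p * x + q * y) * v) + q * q * ((x * x + y * y) * v) = x * (x * ((p * p + q * q) * v))"
  by (simp add: algebra_simps)

lemma const_diff: "const (c - d) = const c - const d" by (simp add: const_def single_diff)

definition mval :: "('n::finite \<Rightarrow> 'k::field) \<Rightarrow> ('n \<Rightarrow>\<^sub>0 nat) \<Rightarrow> 'k"
  where "mval a m = (\<Prod>i\<in>UNIV. a i ^ cf m i)"

lemma mval_add [simp]: "mval a (m + m') = mval a m * mval a m'"
  by (simp add: mval_def lookup_add power_add prod.distrib)

lemma mval_ee [simp]: "mval a (ee i) = a i"
proof -
  have "mval a (ee i) = (\<Prod>j\<in>UNIV. if j = i then a i else 1)"
    unfolding mval_def by (intro prod.cong) (auto simp: lookup_single when_def)
  then show ?thesis by (simp add: prod.delta)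
qed

text \<open>Passing to the part of highest degree in the variables \<open>D\<close>.\<close>
lemma top_part_nzd:
  fixes K :: "('n::finite, 'k::field) mpoly set"
  assumes K: "hideal K" and hpK: "\<And>p k. p \<in> K \<Longrightarrow> hp D k p \<in> K"
    and top: "\<And>v. linear_form (\<lambda>i. if i \<in> D then a i else 0) * v \<in> K \<Longrightarrow> v \<in> K"
  shows "linear_form a * v \<in> K \<Longrightarrow> v \<in> K"
proof -
  define l1 where "l1 = (linear_form (\<lambda>i. if i \<in> D then a i else 0) :: ('n, 'k) mpoly)"
  define l0 where "l0 = (linear_form (\<lambda>i. if i \<in> D then 0 else a i) :: ('n, 'k) mpoly)"
  have l: "linear_form a = l1 + l0"
    unfolding l1_def l0_def linear_form_def sum.distrib[symmetric] by (intro sum.cong) auto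
  have hx: "hom D (if i \<in> D then 1 else 0) (indet i :: ('n, 'k) mpoly)" for i
    using hom_xmon[of D "ee i"] by (simp add: indet_eq split: if_splits)
  have l1: "hom D 1 l1" unfolding l1_def linear_form_def
  proof (rule hom_sum)
    show "hom D 1 (const (if i \<in> D then a i else 0) * indet i)" for i
      using hom_const_mult[OF hx[of i]] by (cases "i \<in> D") auto
  qed
  have l0: "hom D 0 l0" unfolding l0_def linear_form_def
  proof (rule hom_sum)
    show "hom D 0 (const (if i \<in> D then 0 else a i) * indet i)" for i
      using hom_const_mult[OF hx[of i]] by (cases "i \<in> D") auto
  qed
  have "v \<in> K" if "\<And>m. m \<in> ks v \<Longrightarrow> wd D m < t" "linear_form a * v \<in> K" for t
    using that
  proof (induction t arbitrary: v)
    case 0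
    then have "ks v = {}" by blast
    then show ?case using hidealD(1)[OF K] by simp
  next
    case (Suc t)
    define u where "u = hp D (int t) v"
    have "hp D (int t + 1) v = 0"
      unfolding hp_def using Suc.prems(1) by (intro restr_0) fastforce
    then have "hp D (int t + 1) (linear_form a * v) = l1 * u"
      by (simp add: l distrib_right hp_add hp_mult[OF l1] hp_mult[OF l0] u_def)
    then have "u \<in> K" using hpK[OF Suc.prems(2), of "int t + 1"] top by (simp add: l1_def)
    have "linear_form a * v - linear_form a * u \<in> K"
      by (rule hidealD(6)[OF K Suc.prems(2) hidealD(3)[OF K \<open>u \<in> K\<close>]])
    then have "linear_form a * (v - u) \<in> K" by (simp only: right_diff_distrib)
    moreover have "wd D m < t" if "m \<in> ks (v - u)" for m
    proof -
      have "cf v m \<noteq> cf u m" using that by (simp add: in_keys_iff lookup_minus)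
      then have "wd D m \<noteq> t" "m \<in> ks v" by (auto simp: u_def hp_def in_keys_iff split: if_splits)
      then show ?thesis using Suc.prems(1)[of m] by simp
    qed
    ultimately have "v - u \<in> K" by (rule Suc.IH[rotated])
    then have "(v - u) + u \<in> K" using \<open>u \<in> K\<close> by (rule hidealD(2)[OF K])
    then show ?case by simp
  qed
  note t = this
  have "wd D m < Suc (Max (wd D ` ks v))" if "m \<in> ks v" for m
    using that by (simp add: le_imp_less_Suc)
  then show "linear_form a * v \<in> K \<Longrightarrow> v \<in> K" using t by blast
qed

lemma linear_form_two:
  assumes "i \<noteq> j"
  shows "linear_form (\<lambda>k. if k \<in> {i, j} then a k else 0) = const (a i) * xmon (ee i) + const (a j) * xmon (ee j)"
proof -
  have "linear_form (\<lambda>k. if k \<in> {i, j} then a k else 0) = (\<Sum>k\<in>{i, j}. const (a k) * indet k)"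
    unfolding linear_form_def by (rule sum.mono_neutral_cong_right) auto
  then show ?thesis using assms by (simp add: indet_eq)
qed

locale binomial_pair = binomial_ideal G0 s r1 r2 ty
  for G0 :: "('n::finite \<Rightarrow>\<^sub>0 nat) set" and s r1 r2 and ty :: "'k::field_char_0 itself" +
  fixes a :: "'n \<Rightarrow> 'k" and Q :: "('n, 'k) mpoly" and d :: nat
  assumes pair: "exact_pair G a Q I d"
    and gen: "\<And>t. t \<in> {1, -1, 2, -2, 1/2, -1/2} \<Longrightarrow> mval a (s + r1) \<noteq> t * mval a (s + r2)"
begin

sublocale ep: exact_pair G a Q I d by (rule pair)

lemma a: "a i \<noteq> 0" using ep.a .

abbreviation "l \<equiv> linear_form a"

lemma f1_hom: "homog 2 f1" using hom_xmon[of UNIV m1] unfolding w(1) by simp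

text \<open>The excluded ratios are closed under inversion, so the two monomials may be exchanged; 2
  and -2 come from 1/2 and -1/2 in this way.\<close>

lemma swap_pair: "binomial_pair G0 s r2 r1 a Q d"
proof -
  interpret sw: binomial_ideal G0 s r2 r1 "TYPE('k)" by (rule swap)
  have "exact_pair sw.G a Q sw.I d" using pair by (simp only: insert_commute bideal_commute)
  moreover have "mval a m2 \<noteq> t * mval a m1" if "t \<in> {1, -1, 2, -2, 1/2, -1/2}" for t
  proof
    assume e: "mval a m2 = t * mval a m1"
    have "\<exists>u\<in>{1, -1, 2, -2, 1/2, -1/2}. u * t = 1" using that by (elim insertE emptyE; hypsubst; simp)
    then obtain u where u: "u \<in> {1, -1, 2, -2, 1/2, -1/2}" "u * t = 1" by blast
    have "u * mval a m2 = mval a m1" unfolding e mult.assoc[symmetric] u(2) by simp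
    then show False using gen[OF u(1)] by simp
  qed
  ultimately show ?thesis by unfold_locales (auto simp: exact_pair_def)
qed

end

lemma (in binomial_ideal) A_swap: "binomial_ideal.A G0 s r2 r1 = A"
proof -
  interpret sw: binomial_ideal G0 s r2 r1 "TYPE('k)" by (rule swap)
  show ?thesis unfolding sw.A_def A_def by blast
qed

text \<open>If neither \<open>x\<^sup>r\<^sup>1\<close> nor \<open>x\<^sup>r\<^sup>2\<close> lies in the monomial part of \<open>K = (I : f\<^sub>1)\<close>, then the variables of
  \<open>r1\<close> and \<open>r2\<close> as well as \<open>l\<close> are nonzerodivisors modulo \<open>K\<close>; a power of such a variable cannot
  be in \<open>I\<close>.\<close>
locale binomial_pair_domain = binomial_pair +
  assumes nA: "r1 \<notin> Bs G0 A" "r2 \<notin> Bs G0 A"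
begin

lemma swap_domain: "binomial_pair_domain G0 s r2 r1 a Q d"
  using swap_pair nA A_swap unfolding binomial_pair_domain_def binomial_pair_domain_axioms_def by simp

text \<open>A neighbour \<open>j\<close> of a variable dividing \<open>xmon r1\<close> kills
  \<open>f1\<close>, because \<open>m1 + ee j\<close> is divisible by the generator joining
  them.\<close>

lemma var1: assumes "0 < cf r1 i" shows "i \<notin> A \<and> Nb G0 i \<subseteq> A"
proof
  show "i \<notin> A" using nA assms by (auto simp: Bs_def)
  show "Nb G0 i \<subseteq> A"
  proof
    fix j assume "j \<in> Nb G0 i"
    then have g: "ee i + ee j \<in> G0" by (simp add: Nb_def)
    obtain t where t: "r1 = t + ee i" using assms ee_divs_iff divs_iff by metis
    have "ee i + ee j \<preceq> m1 + ee j" unfolding t divs_def by (simp add: lookup_add)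
    then have "m1 + ee j \<in> Bs G0 {}" using g by (auto simp: Bs_def)
    then show "j \<in> A" by (simp add: A_def)
  qed
qed

end

context binomial_pair_domain begin

interpretation sw: binomial_pair_domain G0 s r2 r1 "TYPE('b)" a Q d by (rule swap_domain)

lemma var2: assumes "0 < cf r2 i" shows "i \<notin> A \<and> Nb G0 i \<subseteq> A"
  using sw.var1[OF assms] A_swap by simp

lemma nzd1: assumes "0 < cf r1 i" "xmon (ee i) * g \<in> K" shows "g \<in> K"
  by (rule bideal_nzd[OF quad0 var1 var2 assms(1) _ assms(2)]) (use coprime[of i] assms(1) in auto)

lemma K_swap: "sw.K = K" by (simp add: A_swap bideal_commute)

end

context binomial_pair_domain begin

interpretation sw: binomial_pair_domain G0 s r2 r1 "TYPE('b)" a Q d by (rule swap_domain)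

lemma nzd2: assumes "0 < cf r2 i" "xmon (ee i) * g \<in> K" shows "g \<in> K"
  using sw.nzd1[OF assms(1), of g] assms(2) K_swap by simp

lemma e_K: "(xmon r1 + xmon r2) * v \<in> K" by (rule bideal_gen)

text \<open>Modulo x_i + x_j the part of l in these two variables is (a_j - a_i) x_j, and the ratio
  1 is excluded.\<close>

lemma nzd_variables:
  assumes r: "r1 = ee i" "r2 = ee j" "l * v \<in> K" shows "v \<in> K"
proof (rule top_part_nzd[OF K, of "{i, j}" a v])
  have ij: "i \<noteq> j" using coprime[of i] r by auto
  show "hp {i, j} k p \<in> K" if "p \<in> K" for p k
    by (rule bideal_hp[OF _ _ that, of _ 1]) (simp_all add: r)
  fix v assume "linear_form (\<lambda>k. if k \<in> {i, j} then a k else 0) * v \<in> K"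
  then have "(const (a i) * xmon (ee i) + const (a j) * xmon (ee j)) * v - const (a i) * ((xmon r1 + xmon r2) * v) \<in> K"
    unfolding linear_form_two[OF ij] by (rule iK(6)[OF _ iK(3)[OF e_K]])
  moreover have "(const (a i) * xmon (ee i) + const (a j) * xmon (ee j)) * v - const (a i) * ((xmon r1 + xmon r2) * v)
      = xmon (ee j) * (const (a j - a i) * v)"
    by (simp add: r const_diff algebra_simps)
  ultimately have "xmon (ee j) * (const (a j - a i) * v) \<in> K" by simp
  then have "const (a j - a i) * v \<in> K" by (rule nzd2[rotated]) (simp add: r)
  then have "const (1 / (a j - a i)) * (const (a j - a i) * v) \<in> K" by (rule iK(3))
  moreover have "a i \<noteq> a j" using gen[of 1] by (auto simp: r)
  ultimately show "v \<in> K" by (simp add: mult.assoc[symmetric] const_mult[symmetric])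
qed (rule assms)

text \<open>Multiplying by the conjugate a_i x_i - a_j x_j leaves (a_i^2 + a_j^2) x_i^2 modulo the
  binomial, and the ratio -1 is excluded.\<close>

lemma nzd_squares:
  assumes r: "r1 = ee i + ee i" "r2 = ee j + ee j" "s = 0" "l * v \<in> K" shows "v \<in> K"
proof (rule top_part_nzd[OF K, of "{i, j}" a v])
  let ?x = "\<lambda>i. xmon (ee i) :: ('a, 'b) mpoly"
  have ij: "i \<noteq> j" using coprime[of i] r by (auto simp: lookup_add)
  show "hp {i, j} k p \<in> K" if "p \<in> K" for p k
    by (rule bideal_hp[OF _ _ that, of _ 2]) (simp_all add: r)
  fix v assume "linear_form (\<lambda>k. if k \<in> {i, j} then a k else 0) * v \<in> K"
  then have 1: "(const (a i) * ?x i + const (a j) * ?x j) * v \<in> K" unfolding linear_form_two[OF ij] .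
  have "(const (a i) * ?x i - const (a j) * ?x j) * ((const (a i) * ?x i + const (a j) * ?x j) * v)
      + const (a j * a j) * ((xmon r1 + xmon r2) * v) \<in> K"
    by (rule iK(2)[OF iK(3)[OF 1] iK(3)[OF e_K]])
  moreover have "(const (a i) * ?x i - const (a j) * ?x j) * ((const (a i) * ?x i + const (a j) * ?x j) * v)
      + const (a j * a j) * ((xmon r1 + xmon r2) * v) = ?x i * (?x i * (const (a i * a i + a j * a j) * v))"
    unfolding r xmon_add const_add const_mult by (rule two_squares)
  ultimately have "?x i * (?x i * (const (a i * a i + a j * a j) * v)) \<in> K" by simp
  then have "?x i * (const (a i * a i + a j * a j) * v) \<in> K" by (rule nzd1[rotated]) (simp add: r lookup_add)
  then have "const (a i * a i + a j * a j) * v \<in> K" by (rule nzd1[rotated]) (simp add: r lookup_add)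
  then have "const (1 / (a i * a i + a j * a j)) * (const (a i * a i + a j * a j) * v) \<in> K" by (rule iK(3))
  moreover have "a i * a i + a j * a j \<noteq> 0"
    using gen[of "- 1"] by (simp add: r eq_neg_iff_add_eq_0)
  ultimately show "v \<in> K" by (simp add: mult.assoc[symmetric] const_mult[symmetric])
qed (rule assms)

text \<open>As x_p^2 is not in \<open>G\<close>, x_p v vanishes modulo (K, f1), so x_p v = x_p x_q w
  modulo \<open>K\<close>. Cancelling x_p gives v = x_q w, and l w vanishes again: a descent on the
  degree.\<close>

lemma nzd_squarefree:
  assumes r: "r1 = ee p + ee q" "p \<noteq> q" "s = 0" and v: "homog k v" "l * v \<in> K" shows "v \<in> K"
proof -
  let ?x = "\<lambda>i. xmon (ee i) :: ('a, 'b) mpoly"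
  have p: "0 < cf r1 p" and q: "0 < cf r1 q" by (simp_all add: r lookup_add)
  have "ee p + ee p \<notin> G0"
  proof
    assume "ee p + ee p \<in> G0"
    then show False using var1[OF p] by (auto simp: Nb_def)
  qed
  moreover have "ee p + ee p \<noteq> r2" using coprime[of p] p by (auto simp: lookup_add)
  moreover have "ee p + ee p \<noteq> r1" unfolding r(1) ee2_eq_iff using r(2) by blast
  ultimately have pp: "ee p + ee p \<notin> G" by (simp add: r(3))
  have G_r: "G = insert r1 (insert r2 G0)" by (simp add: r(3))
  have K_sub: "y \<in> qideal G A" if "y \<in> K" for y unfolding G_r by (rule bideal_sub[OF that])
  have div: "\<exists>w. y - f1 * w \<in> K" if y: "y \<in> qideal G A" for y
    using bideal_split[OF wr refl, of y G0 A] y unfolding G_r by (simp add: r(3))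
  have loop: "?x p * v \<in> qideal G A" if lv: "l * v \<in> K" for v
  proof (rule ccontr)
    assume n: "?x p * v \<notin> qideal G A"
    define u where "u = restr (- Bs G A) (?x p * v)"
    have xu: "?x p * v - u \<in> qideal G A" unfolding u_def by (rule mideal_restr_compl)
    then have "u \<noteq> 0" using n by auto
    have "?x p * (l * v) - l * (?x p * v - u) \<in> qideal G A"
      by (rule mideal_diff[OF K_sub[OF iK(3)[OF lv]] qideal_mult[OF xu]])
    then have "l * u \<in> qideal G A" by (simp add: algebra_simps)
    then obtain m where m: "m \<in> ks u" "m + ee p \<in> Bs G A"
      using linear_form_top[of a p, OF a \<open>u \<noteq> 0\<close>] by blast
    have "m \<notin> Bs G A" "cf (?x p * v) m \<noteq> 0" using m(1) by (auto simp: u_def keys_restr in_keys_iff)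
    then have "1 \<le> cf m p" using cf_xmon_mult_0[of "ee p" m v] ee_divs_iff[of p m] by force
    then show False using qideal_loop[OF quad m(2) \<open>m \<notin> Bs G A\<close>] pp by blast
  qed
  \<comment> \<open>The shift by one makes n = 0 stand for degree -1, where v = 0.\<close>
  have "v \<in> K" if "homog (int n - 1) v" "l * v \<in> K" for n v
    using that
  proof (induction n arbitrary: v rule: less_induct)
    case (less n)
    show ?case
    proof (cases n)
      case 0
      then have "v = 0" using less.prems(1) hom_neg by fastforce
      then show ?thesis using iK(1) by simp
    next
      case (Suc n')
      have hx: "homog (1 + (int n - 1)) (?x p * v)" using hom_mult[OF hom_xmon[of UNIV "ee p"] less.prems(1)] by simp
      obtain w0 where w0: "?x p * v - f1 * w0 \<in> K" using div[OF loop[OF less.prems(2)]] by blast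
      obtain w where w: "homog (1 + (int n - 1) - 2) w" "?x p * v - f1 * w \<in> K"
        using hideal_homogenise[OF K hx f1_hom w0] by blast
      have "?x p * (v - ?x q * w) \<in> K" using w(2) by (simp add: r xmon_add algebra_simps)
      then have vw: "v - ?x q * w \<in> K" by (rule nzd1[OF p])
      have "l * v - l * (v - ?x q * w) \<in> K" by (rule iK(6)[OF less.prems(2) iK(3)[OF vw]])
      then have "?x q * (l * w) \<in> K" by (simp add: algebra_simps)
      then have "l * w \<in> K" by (rule nzd1[OF q])
      moreover have "homog (int n' - 1) w" using w(1) Suc by (simp add: algebra_simps)
      ultimately have "w \<in> K" using less.IH[of n' w] Suc by simp
      then have "(v - ?x q * w) + ?x q * w \<in> K" by (intro iK(2)[OF vw] iK(3))
      then show ?thesis by simp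
    qed
  qed
  note t = this
  show ?thesis
  proof (cases "k < 0")
    case True
    then show ?thesis using v(1) hom_neg iK(1) by metis
  next
    case False
    then show ?thesis using t[of "nat (k + 1)" v] v by simp
  qed
qed

end

context binomial_pair_domain begin

interpretation sw: binomial_pair_domain G0 s r2 r1 "TYPE('b)" a Q d by (rule swap_domain)

lemma l_nzd: assumes v: "homog k v" "l * v \<in> K" shows "v \<in> K"
proof -
  have "tdeg s + tdeg r1 = 2" "tdeg s + tdeg r2 = 2" using w by simp_all
  moreover have "tdeg r1 \<noteq> 0" using w(3) by (simp add: wd_eq_0)
  ultimately consider "tdeg r1 = 1" "tdeg r2 = 1" | "tdeg r1 = 2" "tdeg r2 = 2" "tdeg s = 0"
    by linarith
  then show ?thesis
  proof cases
    case 1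
    then obtain i j where "r1 = ee i" "r2 = ee j" using wd_1_ee by blast
    then show ?thesis using nzd_variables v by blast
  next
    case 2
    then have s: "s = 0" by (simp add: wd_eq_0)
    obtain i j i' j' where r: "r1 = ee i + ee j" "r2 = ee i' + ee j'" using wd_2_ee 2 by metis
    consider "i \<noteq> j" | "i' \<noteq> j'" | "i = j" "i' = j'" by blast
    then show ?thesis
    proof cases
      case 1
      then show ?thesis using nzd_squarefree[OF r(1) _ s v] by blast
    next
      case 2
      then show ?thesis using sw.nzd_squarefree[OF r(2) _ s v(1)] v(2) K_swap by simp
    next
      case 3
      then show ?thesis using nzd_squares s r v by blast
    qed
  qed
qed

lemma contradiction: False
proof -
  have nz: "f1 * v \<in> I" if "homog k v" "f1 * (l * v) \<in> I" for k v
    using l_nzd[OF that(1)] that(2) colon by blast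
  have "\<exists>M. \<forall>k\<ge>M. \<forall>p. homog k p \<longrightarrow> p \<in> I"
    by (rule ep.artinian[OF f1_hom split, of 0]) (use nz in blast)+
  then obtain M where M: "\<And>k p. M \<le> k \<Longrightarrow> homog k p \<Longrightarrow> p \<in> I" by blast
  obtain i where i: "0 < cf r1 i" using w(3) by (metis gr0I lookup_zero poly_mapping_eqI)
  let ?m = "Poly_Mapping.single i (nat M)"
  have "(xmon ?m :: ('a, 'b) mpoly) \<in> I" by (rule M[of "int (tdeg ?m)", OF _ hom_xmon]) simp
  then have m: "xmon ?m * 1 \<in> K" using colon iI(3)[of "xmon ?m" f1] by simp
  have "cf r2 i = 0" using coprime[of i] i by auto
  then have "1 \<in> K" using bideal_nzd_power[OF quad0 var1 var2 i _ m] by blast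
  then show False using bideal_proper[OF quad0 w(3,4)] by blast
qed

end

section \<open>The remaining case: (I : f1) is a monomial ideal\<close>

context binomial_pair begin

lemma nA: "r1 \<in> Bs G0 A \<or> r2 \<in> Bs G0 A"
proof (rule ccontr)
  assume "\<not> ?thesis"
  then have "binomial_pair_domain G0 s r1 r2 a Q d"
    using binomial_pair_axioms by (simp add: binomial_pair_domain_def binomial_pair_domain_axioms_def)
  then show False by (rule binomial_pair_domain.contradiction)
qed

lemma r_K: "xmon r1 \<in> K" "xmon r2 \<in> K"
proof -
  have e: "xmon r1 + xmon r2 \<in> K" using bideal_gen[of r1 r2 1] by simp
  consider "r1 \<in> Bs G0 A" | "r2 \<in> Bs G0 A" using nA by blast
  then have "xmon r1 \<in> K \<and> xmon r2 \<in> K"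
  proof cases
    case 1
    then have "xmon r1 \<in> K" by (intro bideal_base qideal_xmon)
    then show ?thesis using iK(6)[OF e, of "xmon r1"] by simp
  next
    case 2
    then have "xmon r2 \<in> K" by (intro bideal_base qideal_xmon)
    then show ?thesis using iK(6)[OF e, of "xmon r2"] by simp
  qed
  then show "xmon r1 \<in> K" "xmon r2 \<in> K" by blast+
qed

text \<open>All variables in (I : f1). Besides those of \<open>A\<close> this contains
  \<open>r1\<close> and \<open>r2\<close> when they are variables.\<close>

definition "A' = {i. f1 * xmon (ee i) \<in> I}"

lemma A_A': "A \<subseteq> A'" using f1_A by (auto simp: A'_def)

lemma r_A': assumes "r \<in> {r1, r2}" shows "r \<in> Bs G A'"
proof -
  have "tdeg s + tdeg r = 2" "tdeg r \<noteq> 0" using assms w wr by (auto simp: wd_eq_0)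
  then consider "tdeg r = 1" | "tdeg s = 0" by linarith
  then show ?thesis
  proof cases
    case 1
    then obtain i where i: "r = ee i" using wd_1_ee by blast
    then have "i \<in> A'" using assms r_K colon by (auto simp: A'_def)
    then show ?thesis unfolding i Bs_def by (intro CollectI disjI2 bexI[of _ i]) simp_all
  next
    case 2
    then have "r \<in> G" using assms by (auto simp: wd_eq_0)
    then show ?thesis by (rule Bs_gen)
  qed
qed

text \<open>Both terms of the binomial in \<open>K\<close> lie in \<open>K\<close> by
  \<open>r_K\<close>, so \<open>K\<close> is a monomial ideal.\<close>

lemma colon': "f1 * g \<in> I \<longleftrightarrow> g \<in> qideal G A'"
proof
  assume "f1 * g \<in> I"
  then obtain h where h: "g - (xmon r1 + xmon r2) * h \<in> qideal G0 A" using colon by (auto simp: bideal_def)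
  have "g - (xmon r1 + xmon r2) * h \<in> qideal G A'"
    by (rule qideal_mono[OF _ _ h]) (use A_A' in auto)
  moreover have "(xmon r1 + xmon r2) * h \<in> qideal G A'"
    by (intro qideal_mult2 mideal_add qideal_xmon r_A') simp_all
  ultimately have "(g - (xmon r1 + xmon r2) * h) + (xmon r1 + xmon r2) * h \<in> qideal G A'" by (rule mideal_add)
  then show "g \<in> qideal G A'" by simp
next
  assume g: "g \<in> qideal G A'"
  have "g \<in> {g. f1 * g \<in> I}"
  proof (rule qideal_least[OF colon_hideal _ _ g])
    show "xmon (ee i) \<in> {g. f1 * g \<in> I}" if "i \<in> A'" for i using that by (simp add: A'_def)
    fix g assume "g \<in> G"
    then consider "g = m1" | "g = m2" | "g \<in> G0" by blast
    then have "xmon g \<in> K"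
    proof cases
      case 3
      then show ?thesis by (intro bideal_base qideal_xmon Bs_gen)
    qed (use r_K in \<open>auto simp: xmon_add intro: iK(3)\<close>)
    then show "xmon g \<in> {g. f1 * g \<in> I}" using colon by blast
  qed
  then show "f1 * g \<in> I" by blast
qed

lemma artinian: "\<exists>M. \<forall>k\<ge>M. \<forall>p. homog k p \<longrightarrow> p \<in> I"
proof (rule ep.artinian[OF f1_hom split])
  fix k v assume k: "int (card (UNIV :: 'n set)) + 1 \<le> k" and v: "homog k v" "f1 * (l * v) \<in> I"
  have "v \<in> qideal G A'"
    by (rule qideal_large[of a, OF a quad v(1)]) (use k v(2) colon' in auto)
  then show "f1 * v \<in> I" using colon' by blast
qed

lemma sq: "ee i + ee i \<in> G" by (rule ep.squares[OF artinian])

lemma not_A': assumes "k \<notin> A'" "m \<in> {m1, m2}" shows "m + ee k \<notin> Bs G0 {}"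
  using assms A_A' by (auto simp: A_def)

lemma A'_I1: "m1 + ee j \<in> Bs G0 {} \<Longrightarrow> j \<in> A'" and A'_I2: "m2 + ee j \<in> Bs G0 {} \<Longrightarrow> j \<in> A'"
  using not_A'[of j m1] not_A'[of j m2] by auto

lemma Bs_G0_add: assumes "ee i + ee j \<in> G0" shows "t + (ee i + ee j) \<in> Bs G0 {}"
  unfolding Bs_def using assms by (intro CollectI disjI1 bexI) auto

lemma m12: "m1 \<noteq> m2"
proof
  assume "m1 = m2"
  then have "r1 = r2" by simp
  then have "cf r1 i = 0" for i using coprime[of i] by auto
  then have "r1 = 0" by (intro poly_mapping_eqI) simp
  then show False using w by simp
qed

text \<open>x_p^2 is in \<open>G\<close>. If it is in \<open>G0\<close>, it divides m1 x_p. If it is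
  \<open>m2\<close>, then x_q^2 is in \<open>G0\<close>, so x_q kills f1 and f2, and m1 x_p = m2
  x_q.\<close>

lemma squarefree_mem:
  assumes p: "m1 = ee p + ee q" "p \<noteq> q" shows "p \<in> A'"
proof -
  have np: "ee i + ee i \<noteq> m1" for i unfolding p(1) ee2_eq_iff using p(2) by blast
  consider "ee p + ee p \<in> G0" | "ee p + ee p = m2" using sq[of p] np by blast
  then show ?thesis
  proof cases
    case 1
    have "m1 + ee p = ee q + (ee p + ee p)" unfolding p(1) by (simp only: ac_simps)
    then show ?thesis using Bs_G0_add[OF 1] by (intro A'_I1) simp
  next
    case 2
    have "ee q + ee q \<noteq> m2" unfolding 2[symmetric] ee2_eq_iff using p(2) by blast
    then have q: "ee q + ee q \<in> G0" using sq[of q] np by blast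
    have "m1 + ee q = ee p + (ee q + ee q)" unfolding p(1) by (simp only: ac_simps)
    then have "q \<in> A'" using Bs_G0_add[OF q] by (intro A'_I1) simp
    then have "f2 * xmon (ee q) \<in> I" using f1_f2 by (simp add: A'_def)
    moreover have "m2 + ee q = m1 + ee p" unfolding 2[symmetric] p(1) by (simp only: ac_simps)
    ultimately show ?thesis by (simp add: A'_def xmon_add[symmetric])
  qed
qed

lemma squarefree_Nb:
  assumes p: "m1 = ee p + ee q" "p \<noteq> q" shows "Nb G p \<subseteq> A'"
proof
  fix j assume "j \<in> Nb G p"
  then consider "ee p + ee j \<in> G0" | "ee p + ee j = m1" | "ee p + ee j = m2" by (auto simp: Nb_def)
  then show "j \<in> A'"
  proof cases
    case 1
    have "m1 + ee j = ee q + (ee p + ee j)" unfolding p(1) by (simp only: ac_simps)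
    then show ?thesis using Bs_G0_add[OF 1] by (intro A'_I1) simp
  next
    case 2
    then have "j = q" unfolding p(1) ee2_eq_iff by blast
    moreover have "q \<in> A'" by (rule squarefree_mem[of q p]) (use p in \<open>auto simp: add.commute\<close>)
    ultimately show ?thesis by simp
  next
    case 3
    have "q \<in> A'" by (rule squarefree_mem[of q p]) (use p in \<open>auto simp: add.commute\<close>)
    then have "f2 * xmon (ee q) \<in> I" using f1_f2 by (simp add: A'_def)
    moreover have "m2 + ee q = m1 + ee j" unfolding 3[symmetric] p(1) by (simp only: ac_simps)
    ultimately show ?thesis by (simp add: A'_def xmon_add[symmetric])
  qed
qed

text \<open>By \<open>nA\<close> one of the two variables kills one of the squares modulo
  \<open>G0\<close>. The squares are not in \<open>G0\<close>, so the generator responsible is x_p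
  x_q.\<close>

lemma squares_edge:
  assumes p: "m1 = ee p + ee p" "m2 = ee q + ee q" shows "ee p + ee q \<in> G0"
proof -
  have pq: "p \<noteq> q" using m12 p by auto
  have "cf s i = 0" for i
  proof (rule ccontr)
    assume "cf s i \<noteq> 0"
    then have "cf m1 i \<noteq> 0" "cf m2 i \<noteq> 0" by (simp_all add: lookup_add)
    then show False unfolding p using pq by (simp add: lookup_add lookup_single when_def split: if_splits)
  qed
  then have s: "s = 0" by (intro poly_mapping_eqI) simp
  have "\<exists>i\<in>{p, q}. i \<in> A"
  proof -
    consider "r1 \<in> Bs G0 A" | "r2 \<in> Bs G0 A" using nA by blast
    then show ?thesis
    proof cases
      case 1
      then have "ee p + ee p \<in> Bs G0 A" "ee p + ee p \<notin> Bs G0 {}" using s p m by simp_all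
      then show ?thesis by (auto simp: Bs_def lookup_add lookup_single when_def split: if_splits)
    next
      case 2
      then have "ee q + ee q \<in> Bs G0 A" "ee q + ee q \<notin> Bs G0 {}" using s p m by simp_all
      then show ?thesis by (auto simp: Bs_def lookup_add lookup_single when_def split: if_splits)
    qed
  qed
  then obtain i j where i: "i \<in> {p, q}" "j \<in> {p, q}" "ee j + ee j + ee i \<in> Bs G0 {}"
    unfolding A_def p by blast
  then obtain g where g: "g \<in> G0" "g \<preceq> ee j + ee j + ee i" by (auto simp: Bs_def)
  obtain u v where uv: "g = ee u + ee v" using g(1) quad0 wd_2_ee by (metis quad_def)
  have sup: "u \<in> {i, j}" "v \<in> {i, j}"
    using g(2) unfolding uv ee2_divs by (auto simp: lookup_add lookup_single when_def split: if_splits)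
  have "u \<noteq> v"
  proof
    assume "u = v"
    then have "g = m1 \<or> g = m2" using sup i(1,2) unfolding uv p by auto
    then show False using g(1) m Bs_gen[of g G0 "{}"] by auto
  qed
  then have "g = ee p + ee q" using sup i(1,2) unfolding uv by (auto simp: add.commute)
  then show ?thesis using g(1) by simp
qed

lemma squares_mem:
  assumes p: "m1 = ee p + ee p" "m2 = ee q + ee q"
  shows "p \<in> A'" "Nb G p \<subseteq> A'"
proof -
  have pq: "p \<noteq> q" using m12 p by auto
  note e = squares_edge[OF p]
  have "m2 + ee p = ee q + (ee p + ee q)" unfolding p by (simp only: ac_simps)
  then show 1: "p \<in> A'" using Bs_G0_add[OF e] by (intro A'_I2) simp
  show "Nb G p \<subseteq> A'"
  proof
    fix j assume "j \<in> Nb G p"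
    then consider "ee p + ee j \<in> G0" | "ee p + ee j = ee p + ee p" | "ee p + ee j = ee q + ee q"
      by (auto simp: Nb_def p)
    then show "j \<in> A'"
    proof cases
      case 1
      have "m1 + ee j = ee p + (ee p + ee j)" unfolding p by (simp only: ac_simps)
      then show ?thesis using Bs_G0_add[OF 1] by (intro A'_I1) simp
    qed (use 1 pq in \<open>auto simp only: ee2_eq_iff\<close>)
  qed
qed

end

section \<open>Two special variables, reduction to linear Q, and the linear case\<close>

context binomial_pair begin

interpretation sw: binomial_pair G0 s r2 r1 "TYPE('k)" a Q d by (rule swap_pair)

lemma sw_A': "sw.A' = A'"
  unfolding sw.A'_def A'_def using f1_f2 bideal_commute[of G0 "{}" m1 m2] by auto

lemma sw_G: "sw.G = G" by (rule insert_commute)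

text \<open>The variables required by the descent, found inside the two monomials. The last conjunct
  records where they come from, for use in the linear case.\<close>

lemma distinguished_pair:
  "\<exists>z z'. z \<noteq> z' \<and> z \<in> A' \<and> z' \<in> A' \<and> Nb G z \<subseteq> A' \<and> Nb G z' \<subseteq> A' \<and> ee z + ee z' \<in> G \<and>
    (m1 = ee z + ee z' \<or> m2 = ee z + ee z' \<or> (m1 = ee z + ee z \<and> m2 = ee z' + ee z'))"
proof -
  obtain p q p' q' where r: "m1 = ee p + ee q" "m2 = ee p' + ee q'" using w(1,2) wd_2_ee by meson
  consider "p \<noteq> q" | "p' \<noteq> q'" | "p = q" "p' = q'" by blast
  then show ?thesis
  proof cases
    case 1
    have r': "m1 = ee q + ee p" "q \<noteq> p" using r 1 by (auto simp: add.commute)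
    have "ee p + ee q \<in> G" using r(1) by simp
    then show ?thesis
      using 1 r(1) squarefree_mem[OF r(1) 1] squarefree_mem[OF r'] squarefree_Nb[OF r(1) 1] squarefree_Nb[OF r']
      by (intro exI[of _ p] exI[of _ q]) blast
  next
    case 2
    have r': "m2 = ee q' + ee p'" "q' \<noteq> p'" using r 2 by (auto simp: add.commute)
    have "ee p' + ee q' \<in> G" using r(2) by simp
    then show ?thesis
      using 2 r(2) sw.squarefree_mem[OF r(2) 2] sw.squarefree_mem[OF r'] sw.squarefree_Nb[OF r(2) 2] sw.squarefree_Nb[OF r']
      unfolding sw_A' sw_G by (intro exI[of _ p'] exI[of _ q']) blast
  next
    case 3
    have r': "m1 = ee p + ee p" "m2 = ee p' + ee p'" using r 3 by auto
    have "p \<noteq> p'" using m12 r' by auto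
    then show ?thesis
      using squares_mem[OF r'] sw.squares_mem[OF r'(2,1)] squares_edge[OF r'] r' unfolding sw_A' sw_G
      by (intro exI[of _ p] exI[of _ p']) blast
  qed
qed

lemma d_1: "d = 1"
proof (rule ccontr)
  assume "d \<noteq> 1"
  then have d: "2 \<le> int d" using ep.d_pos by simp
  obtain M where M: "\<And>k p. M \<le> k \<Longrightarrow> homog k p \<Longrightarrow> p \<in> I" using artinian by blast
  obtain z z' where z: "z \<noteq> z'" "z \<in> A'" "z' \<in> A'" "Nb G z \<subseteq> A'" "Nb G z' \<subseteq> A'" "ee z + ee z' \<in> G"
    using distinguished_pair by blast
  have "f1 \<in> qideal G {}" by (intro qideal_xmon Bs_gen) simp
  then have "binomial_descent G a Q f1 I (int d) A' z z' M"
    using quad a d ep.Q I I_sub f1_hom split colon' ep.lQ ep.ex1 ep.ex2 z sq M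
    by unfold_locales auto
  then show False by (rule binomial_descent.contradiction)
qed

text \<open>Only the constant term of the cofactor of f1 + f2 reaches the two monomials, and it
  contributes equally to both.\<close>

lemma cf_I: assumes "p \<in> I" shows "cf p m1 = cf p m2"
proof -
  obtain h where h: "p - (f1 + f2) * h \<in> qideal G0 {}" using assms by (auto simp: bideal_def)
  have n: "\<not> m1 \<preceq> m2" "\<not> m2 \<preceq> m1" using wd_divs_eq w m12 by metis+
  have c1: "cf (f1 * h) m1 = cf h 0" "cf (f2 * h) m2 = cf h 0"
    using cf_xmon_mult_add[of m1 h 0] cf_xmon_mult_add[of m2 h 0] by simp_all
  have z: "cf (p - (f1 + f2) * h) mm = 0" if "mm \<in> {m1, m2}" for mm
    using h m that by (auto simp: mideal_def in_keys_iff)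
  have "cf p m1 = cf h 0" "cf p m2 = cf h 0"
    using z[of m1] z[of m2] c1 cf_xmon_mult_0[OF n(1), of h] cf_xmon_mult_0[OF n(2), of h]
    by (simp_all add: lookup_minus distrib_right lookup_add)
  then show ?thesis by simp
qed

text \<open>No element of \<open>G0\<close> divides m x_k, and m' does not involve \<open>k\<close>.
  So a generator that contains x_k and divides m x_k can only be \<open>m\<close>, which is then
  x_k^2 because that square is in \<open>G\<close>.\<close>

lemma outside_edge:
  assumes k: "k \<notin> A'" "m \<in> {m1, m2}" "m' \<in> {m1, m2}" "m = ee u + ee v" "m' = ee z + ee z'" "z \<noteq> k" "z' \<noteq> k"
    and mm: "G \<subseteq> insert m (insert m' G0)"
  shows "(u = k \<and> v = k) \<or> (ee u + ee k \<notin> G \<and> ee v + ee k \<notin> G)"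
proof -
  have n: "t = m" if t: "t = ee x + ee k" "t \<preceq> m + ee k" "t \<in> G" for t x
  proof -
    have "t \<noteq> m'" unfolding t(1) k(5) ee2_eq_iff using k(6,7) by blast
    moreover have "t \<notin> G0" using not_A'[OF k(1,2)] t(2) by (auto simp: Bs_def)
    ultimately show ?thesis using t(3) mm by blast
  qed
  show ?thesis
  proof (cases "u = k \<or> v = k")
    case True
    have "ee k + ee k \<preceq> m + ee k" using True unfolding k(4) divs_def by (auto simp: lookup_add)
    then have "ee k + ee k = m" using n sq[of k] by blast
    then show ?thesis unfolding k(4) ee2_eq_iff by blast
  next
    case False
    have "ee u + ee k \<preceq> m + ee k" "ee v + ee k \<preceq> m + ee k" unfolding k(4) divs_def by (simp_all add: lookup_add)
    moreover have "ee u + ee k \<noteq> m" "ee v + ee k \<noteq> m" unfolding k(4) ee2_eq_iff using False by blast+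
    ultimately show ?thesis using n by blast
  qed
qed

text \<open>If f1 kills all variables, cubics vanish and \<open>li.square_generated\<close> applies.
  A variable \<open>k\<close> not killed is joined to neither \<open>z\<close> nor
  \<open>z'\<close>, so c_z = c_z' = - c_k; \<open>cf_I\<close> and genericity then give c_k = 0,
  contradicting \<open>li.no_three_zeros\<close>.\<close>

lemma quadrics_generated: assumes "homog 2 q" shows "\<exists>w. q - l * w \<in> I"
proof -
  have "exact_pair G a Q I 1" using pair d_1 by simp
  then interpret li: exact_pair_linear G a Q I f1
    using f1_hom split sq by (intro exact_pair_linear.intro exact_pair_linear_axioms.intro) auto
  have all: "k \<in> A'" for k
  proof (rule ccontr)
    assume k: "k \<notin> A'"
    obtain z z' where z: "z \<noteq> z'" "z \<in> A'" "z' \<in> A'" "Nb G z \<subseteq> A'" "Nb G z' \<subseteq> A'"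
      and zz: "m1 = ee z + ee z' \<or> m2 = ee z + ee z' \<or> (m1 = ee z + ee z \<and> m2 = ee z' + ee z')"
      using distinguished_pair by blast
    have kz: "z \<noteq> k" "z' \<noteq> k" using z k by auto
    have "ee z + ee k \<notin> G" "ee z' + ee k \<notin> G" using z(4,5) k by (auto simp: Nb_def)
    then have "li.c z + li.c k = 0" "li.c z' + li.c k = 0" by (auto intro: li.c_add)
    then have c: "li.c z = - li.c k" "li.c z' = - li.c k" by (simp_all add: eq_neg_iff_add_eq_0)
    have mixed: "li.c k = 0"
      if h: "m \<in> {m1, m2}" "m' \<in> {m1, m2}" "m' = ee z + ee z'" "G \<subseteq> insert m (insert m' G0)"
        "cf (l * Q) m' = cf (l * Q) m" "\<And>t. t \<in> {1, -1, 2, -2, 1/2, -1/2} \<Longrightarrow> mval a m' \<noteq> t * mval a m" for m m'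
    proof -
      have "tdeg m = 2" using h(1) w by auto
      then obtain u v where uv: "m = ee u + ee v" using wd_2_ee by blast
      have L: "cf (l * Q) m' = - 2 * li.c k * mval a m'" unfolding h(3) li.cf_lQ using z(1) c by simp
      consider "u = k" "v = k" | "ee u + ee k \<notin> G" "ee v + ee k \<notin> G"
        using outside_edge[OF k h(1,2) uv h(3) kz h(4)] by blast
      \<comment> \<open>Relative to -2 c_k the factor is 1 for two distinct variables, 1/2 for the
        square of another variable and -1/2 for the square of x_k.\<close>
      then have "\<exists>t\<in>{1, 1/2, -1/2}. cf (l * Q) m = - 2 * li.c k * (t * mval a m)"
      proof cases
        case 1
        then have "cf (l * Q) m = - 2 * li.c k * ((-1/2) * mval a m)" unfolding uv li.cf_lQ by simp
        then show ?thesis by blast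
      next
        case 2
        then have "li.c u + li.c k = 0" "li.c v + li.c k = 0" by (auto intro: li.c_add)
        then have c': "li.c u = - li.c k" "li.c v = - li.c k" by (simp_all add: eq_neg_iff_add_eq_0)
        show ?thesis
        proof (cases "u = v")
          case True
          then have "cf (l * Q) m = - 2 * li.c k * ((1/2) * mval a m)" unfolding uv li.cf_lQ using c' by simp
          then show ?thesis by blast
        next
          case False
          then have "cf (l * Q) m = - 2 * li.c k * (1 * mval a m)" unfolding uv li.cf_lQ using c' by simp
          then show ?thesis by blast
        qed
      qed
      then obtain t where t: "t \<in> {1, 1/2, -1/2}" "cf (l * Q) m = - 2 * li.c k * (t * mval a m)" by blast
      have "- 2 * li.c k * mval a m' = - 2 * li.c k * (t * mval a m)" using h(5) L t(2) by simp
      then have "li.c k = 0 \<or> mval a m' = t * mval a m" by simp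
      then show ?thesis using h(6)[of t] t(1) by blast
    qed
    note val = cf_I[OF ep.lQ]
    consider "m1 = ee z + ee z'" | "m2 = ee z + ee z'" | "m1 = ee z + ee z" "m2 = ee z' + ee z'" using zz by blast
    then have "li.c k = 0"
    proof cases
      case 1
      show ?thesis by (rule mixed[of m2 m1, OF _ _ 1 _ val gen]) auto
    next
      case 2
      show ?thesis by (rule mixed[of m1 m2, OF _ _ 2 _ val[symmetric] sw.gen]) auto
    next
      case 3
      have L: "cf (l * Q) m1 = - li.c k * mval a m1" "cf (l * Q) m2 = - li.c k * mval a m2"
        unfolding 3 li.cf_lQ using c by simp_all
      have "- li.c k * mval a m1 = - li.c k * mval a m2" using val unfolding L .
      then have "li.c k = 0 \<or> mval a m1 = mval a m2" by (metis mult_cancel_left neg_equal_0_iff_equal)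
      moreover have "mval a m1 \<noteq> mval a m2" using gen[of 1] by (metis insertI1 mult_1)
      ultimately show ?thesis by blast
    qed
    then show False using li.no_three_zeros[OF z(1) kz] c by simp
  qed
  have "p \<in> I" if p: "homog 3 p" for p
  proof -
    obtain v0 where v0: "p - f1 * v0 \<in> I" using split[OF li.cubic[OF p]] by blast
    obtain v where v: "homog (3 - 2) v" "p - f1 * v \<in> I"
      using hideal_homogenise[OF I p f1_hom v0] by blast
    have "m \<in> Bs G A'" if "m \<in> ks v" for m
    proof -
      have "tdeg m = 1" using v(1) that by (auto simp: hom_def)
      then obtain j where j: "m = ee j" using wd_1_ee by blast
      show ?thesis unfolding j Bs_def using all by (intro CollectI disjI2 bexI[of _ j]) simp_all
    qed
    then have "f1 * v \<in> I" unfolding colon' by (auto simp: mideal_def)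
    then have "(p - f1 * v) + f1 * v \<in> I" by (rule iI(2)[OF v(2)])
    then show ?thesis by simp
  qed
  then show ?thesis by (rule li.square_generated[OF _ assms])
qed

end

subsection \<open>Genericity\<close>

lemma eval_poly_eq:
  fixes a :: "'n::finite \<Rightarrow> 'k::field"
  assumes "finite B" "ks p \<subseteq> B" shows "eval_poly p a = (\<Sum>m\<in>B. cf p m * mval a m)"
  unfolding eval_poly_def mval_def using assms by (intro sum.mono_neutral_left) (auto simp: in_keys_iff)

lemma eval_poly_add:
  fixes a :: "'n::finite \<Rightarrow> 'k::field"
  shows "eval_poly (p + q) a = eval_poly p a + eval_poly q a"
proof -
  let ?B = "ks p \<union> ks q"
  have "eval_poly (p + q) a = (\<Sum>m\<in>?B. cf (p + q) m * mval a m)"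
    by (rule eval_poly_eq) (simp_all add: keys_add)
  also have "\<dots> = (\<Sum>m\<in>?B. cf p m * mval a m) + (\<Sum>m\<in>?B. cf q m * mval a m)"
    by (simp add: lookup_add distrib_right sum.distrib)
  also have "\<dots> = eval_poly p a + eval_poly q a"
    by (simp add: eval_poly_eq[of ?B p] eval_poly_eq[of ?B q])
  finally show ?thesis .
qed

lemma eval_poly_sum:
  fixes a :: "'n::finite \<Rightarrow> 'k::field"
  shows "eval_poly (\<Sum>x\<in>S. f x) a = (\<Sum>x\<in>S. eval_poly (f x) a)"
  by (induction S rule: infinite_finite_induct) (simp_all add: eval_poly_add, simp_all add: eval_poly_def)

lemma eval_poly_term:
  fixes a :: "'n::finite \<Rightarrow> 'k::field"
  shows "eval_poly (const c * (xmon s * q)) a = c * mval a s * eval_poly q a"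
proof -
  let ?B = "(\<lambda>m. m + s) ` ks q"
  have "ks (const c * (xmon s * q)) \<subseteq> ?B"
  proof
    fix m assume "m \<in> ks (const c * (xmon s * q))"
    then have n: "cf (xmon s * q) m \<noteq> 0" by (auto simp: in_keys_iff)
    then obtain t where t: "m = t + s" by (metis cf_xmon_mult_0 divs_iff)
    then show "m \<in> ?B" using n by (simp add: in_keys_iff)
  qed
  then have "eval_poly (const c * (xmon s * q)) a = (\<Sum>m\<in>?B. cf (const c * (xmon s * q)) m * mval a m)"
    by (rule eval_poly_eq[rotated]) simp
  also have "\<dots> = (\<Sum>m\<in>ks q. cf (const c * (xmon s * q)) (m + s) * mval a (m + s))"
    by (subst sum.reindex) (simp_all add: inj_on_def)
  also have "\<dots> = c * mval a s * (\<Sum>m\<in>ks q. cf q m * mval a m)"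
    unfolding sum_distrib_left const_mult_cf cf_xmon_mult_add mval_add by (simp only: mult_ac)
  finally show ?thesis by (simp add: eval_poly_def mval_def)
qed

lemma eval_poly_mult:
  fixes a :: "'n::finite \<Rightarrow> 'k::field"
  shows "eval_poly (p * q) a = eval_poly p a * eval_poly q a"
proof -
  have "p * q = (\<Sum>m\<in>ks p. const (cf p m) * xmon m) * q" by (simp only: poly_expand[symmetric])
  also have "\<dots> = (\<Sum>m\<in>ks p. const (cf p m) * (xmon m * q))" by (simp add: sum_distrib_right mult.assoc)
  finally have "eval_poly (p * q) a = (\<Sum>m\<in>ks p. cf p m * mval a m * eval_poly q a)"
    by (simp add: eval_poly_sum eval_poly_term)
  then show ?thesis by (simp add: sum_distrib_right eval_poly_def mval_def)
qed

lemma eval_poly_1: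
  fixes a :: "'n::finite \<Rightarrow> 'k::field"
  shows "eval_poly 1 a = 1"
  by (simp add: eval_poly_def)

lemma eval_poly_prod:
  fixes a :: "'n::finite \<Rightarrow> 'k::field"
  shows "eval_poly (\<Prod>x\<in>S. f x) a = (\<Prod>x\<in>S. eval_poly (f x) a)"
  by (induction S rule: infinite_finite_induct) (simp_all add: eval_poly_mult eval_poly_1)

lemma eval_poly_xmon:
  fixes a :: "'n::finite \<Rightarrow> 'k::field"
  shows "eval_poly (const c * xmon s) a = c * mval a s"
  using eval_poly_term[of c s 1 a] by (simp add: eval_poly_1)

text \<open>All conditions together say that one product of polynomials does not vanish.\<close>

lemma zariski_open_generic:
  fixes m1 m2 :: "'n::finite \<Rightarrow>\<^sub>0 nat" and S :: "'k::field set"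
  assumes "finite S"
  shows "zariski_open {a. (\<forall>i. a i \<noteq> 0) \<and> (\<forall>t\<in>S. mval a m1 \<noteq> t * mval a m2)}"
proof -
  define u where "u = (\<Prod>i\<in>UNIV. const 1 * xmon (ee i) :: ('n, 'k) mpoly)"
  define v where "v = (\<Prod>t\<in>S. const 1 * xmon m1 + const (- t) * xmon m2 :: ('n, 'k) mpoly)"
  have "eval_poly u a = (\<Prod>i\<in>UNIV. a i)" for a
    unfolding u_def eval_poly_prod eval_poly_xmon by simp
  moreover have "eval_poly v a = (\<Prod>t\<in>S. mval a m1 - t * mval a m2)" for a
    unfolding v_def eval_poly_prod eval_poly_add eval_poly_xmon by simp
  ultimately have "eval_poly (u * v) a = (\<Prod>i\<in>UNIV. a i) * (\<Prod>t\<in>S. mval a m1 - t * mval a m2)" for a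
    by (simp add: eval_poly_mult)
  then have "{a. (\<forall>i. a i \<noteq> 0) \<and> (\<forall>t\<in>S. mval a m1 \<noteq> t * mval a m2)} = - {a. \<forall>q\<in>{u * v}. eval_poly q a = 0}"
    using assms by auto
  then show ?thesis unfolding zariski_open_def by blast
qed

text \<open>Squaring reduces t to t^2 in {1, 4, 1/4}, and odd numbers cannot differ by a factor 4.
  Characteristic zero transfers the equations to natural numbers.\<close>

lemma power_3_ne:
  fixes t :: "'k::field_char_0"
  assumes "u \<noteq> v" "t \<in> {1, -1, 2, -2, 1/2, -1/2}" shows "3 ^ u \<noteq> t * 3 ^ v"
proof
  assume e: "3 ^ u = t * 3 ^ v"
  have e2: "(3 ^ u * 3 ^ u :: 'k) = t * t * (3 ^ v * 3 ^ v)" unfolding e by (simp only: mult_ac)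
  have o: "odd (3 ^ k * 3 ^ k :: nat)" for k by simp
  have n: False if "(3 ^ i * 3 ^ i :: 'k) = 4 * (3 ^ j * 3 ^ j)" for i j
  proof -
    have "(of_nat (3 ^ i * 3 ^ i) :: 'k) = of_nat (4 * (3 ^ j * 3 ^ j))" using that by simp
    then have "3 ^ i * 3 ^ i = (4 * (3 ^ j * 3 ^ j) :: nat)" by (simp only: of_nat_eq_iff)
    then show False using o[of i] by simp
  qed
  consider "t * t = 1" | "t * t = 4" | "t * t * 4 = 1"
    using assms(2) by (elim insertE emptyE) simp_all
  then show False
  proof cases
    case 1
    then have "(of_nat (3 ^ u * 3 ^ u) :: 'k) = of_nat (3 ^ v * 3 ^ v)" using e2 by simp
    then have "(3 ^ u * 3 ^ u :: nat) = 3 ^ v * 3 ^ v" by (simp only: of_nat_eq_iff)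
    then have "(3::nat) ^ (u + u) = 3 ^ (v + v)" by (simp only: power_add)
    then have "u + u = v + v" by (rule power_inject_exp[THEN iffD1, rotated]) simp
    then show False using assms(1) by simp
  next
    case 2
    then show False using n[of u v] e2 by simp
  next
    case 3
    have "4 * (3 ^ u * 3 ^ u) = (t * t * 4) * (3 ^ v * 3 ^ v)" unfolding e2 by (simp only: mult_ac)
    then show False using n[of v u] unfolding 3 by simp
  qed
qed
lemma generic_point:
  fixes m1 m2 :: "'n::finite \<Rightarrow>\<^sub>0 nat"
  assumes "m1 \<noteq> m2"
  shows "\<exists>a :: 'n \<Rightarrow> 'k::field_char_0. (\<forall>i. a i \<noteq> 0) \<and>
    (\<forall>t\<in>{1, -1, 2, -2, 1/2, -1/2}. mval a m1 \<noteq> t * mval a m2)"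
proof -
  obtain i where i: "cf m1 i \<noteq> cf m2 i" using assms by (metis poly_mapping_eqI)
  \<comment> \<open>With 3 at one variable whose exponents differ, and 1 elsewhere, the monomials
    take distinct powers of 3 as values.\<close>
  define a :: "'n \<Rightarrow> 'k" where "a j = (if j = i then 3 else 1)" for j
  have v: "mval a m = 3 ^ cf m i" for m
  proof -
    have "mval a m = (\<Prod>j\<in>UNIV. if j = i then 3 ^ cf m i else 1)"
      unfolding mval_def a_def by (intro prod.cong) auto
    then show ?thesis by (simp add: prod.delta)
  qed
  have "mval a m1 \<noteq> t * mval a m2" if "t \<in> {1, -1, 2, -2, 1/2, -1/2}" for t
    unfolding v by (rule power_3_ne[OF i that])
  moreover have "\<forall>j. a j \<noteq> 0" by (simp add: a_def)
  ultimately show ?thesis by blast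
qed

subsection \<open>The quotient ring\<close>

lemma ring_of_type_algebra_simps [simp]:
  fixes p q :: "'a::comm_ring_1"
  shows "carrier (ring_of_type_algebra :: 'a ring) = UNIV"
    "p \<otimes>\<^bsub>ring_of_type_algebra\<^esub> q = p * q" "p \<oplus>\<^bsub>ring_of_type_algebra\<^esub> q = p + q"
    "\<zero>\<^bsub>ring_of_type_algebra\<^esub> = (0 :: 'a)" "\<one>\<^bsub>ring_of_type_algebra\<^esub> = (1 :: 'a)"
  by (simp_all add: ring_of_type_algebra_def)

lemma hideal_ideal:
  fixes I :: "('n::finite, 'k::field) mpoly set"
  assumes "hideal I" shows "ideal I mpoly_ring"
proof (rule idealI)
  show r: "ring (mpoly_ring :: ('n, 'k) mpoly ring)" by rule
  interpret ring "mpoly_ring :: ('n, 'k) mpoly ring" by (rule r)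
  show "subgroup I (add_monoid mpoly_ring)"
  proof (rule add.subgroupI)
    fix p q assume p: "p \<in> I"
    have "\<ominus>\<^bsub>mpoly_ring\<^esub> p = - p" by (rule minus_equality) simp_all
    then show "\<ominus>\<^bsub>mpoly_ring\<^esub> p \<in> I" using hidealD(7)[OF assms p] by simp
    assume "q \<in> I"
    then show "p \<oplus>\<^bsub>mpoly_ring\<^esub> q \<in> I" using hidealD(2)[OF assms p] by simp
  qed (use hidealD(1)[OF assms] in auto)
qed (use hidealD(3,4)[OF assms] in auto)

lemma Idl_monomials:
  "Idl\<^bsub>mpoly_ring\<^esub> (xmon ` G) = (qideal G {} :: ('n::finite, 'k::field) mpoly set)"
proof
  interpret ring "mpoly_ring :: ('n, 'k) mpoly ring" by rule
  show "Idl\<^bsub>mpoly_ring\<^esub> (xmon ` G) \<subseteq> (qideal G {} :: ('n, 'k) mpoly set)"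
    by (rule genideal_minimal[OF hideal_ideal[OF qideal_hideal]]) (auto intro!: qideal_xmon Bs_gen)
  show "qideal G {} \<subseteq> (Idl\<^bsub>mpoly_ring\<^esub> (xmon ` G) :: ('n, 'k) mpoly set)"
  proof
    fix p :: "('n, 'k) mpoly" assume p: "p \<in> qideal G {}"
    interpret J: ideal "Idl\<^bsub>mpoly_ring\<^esub> (xmon ` G) :: ('n, 'k) mpoly set" mpoly_ring
      by (rule genideal_ideal) simp
    have x: "const c * xmon m \<in> Idl\<^bsub>mpoly_ring\<^esub> (xmon ` G)" if m: "m \<in> Bs G {}" for c :: 'k and m
    proof -
      obtain g where g: "g \<in> G" "g \<preceq> m" using m by (auto simp: Bs_def)
      then obtain t where t: "m = t + g" using divs_iff by blast
      have "xmon ` G \<subseteq> (Idl\<^bsub>mpoly_ring\<^esub> (xmon ` G) :: ('n, 'k) mpoly set)" by (rule genideal_self) simp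
      then have x: "(xmon g :: ('n, 'k) mpoly) \<in> Idl\<^bsub>mpoly_ring\<^esub> (xmon ` G)" using g(1) by blast
      show ?thesis using J.I_l_closed[OF x, of "const c * xmon t"] by (simp add: t xmon_add mult.assoc)
    qed
    have "(\<Sum>m\<in>S. const (cf p m) * xmon m) \<in> Idl\<^bsub>mpoly_ring\<^esub> (xmon ` G)" if "finite S" "S \<subseteq> Bs G {}" for S
      using that
    proof (induction S rule: finite_induct)
      case empty
      then show ?case using J.zero_closed by simp
    next
      case (insert m S)
      then show ?case using J.a_closed[OF x[of m "cf p m"], of "\<Sum>m\<in>S. const (cf p m) * xmon m"] by simp
    qed
    from this[of "ks p"] p show "p \<in> Idl\<^bsub>mpoly_ring\<^esub> (xmon ` G)"
      by (simp only: poly_expand[symmetric] mideal_def mem_Collect_eq finite_keys)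
  qed
qed

lemma binomial_set_add:
  "qideal G {} <+>\<^bsub>mpoly_ring\<^esub> (PIdl\<^bsub>mpoly_ring\<^esub> (xmon m1 + xmon m2)) =
    (bideal G {} m1 m2 :: ('n::finite, 'k::field) mpoly set)"
proof -
  have "p \<in> qideal G {} <+>\<^bsub>mpoly_ring\<^esub> (PIdl\<^bsub>mpoly_ring\<^esub> (xmon m1 + xmon m2)) \<longleftrightarrow>
      (\<exists>q\<in>qideal G {}. \<exists>h. p = q + h * (xmon m1 + xmon m2))" for p :: "('n, 'k) mpoly"
    by (auto simp: set_add_def set_mult_def cgenideal_def)
  moreover have "(\<exists>q\<in>qideal G {}. \<exists>h. p = q + h * (xmon m1 + xmon m2)) \<longleftrightarrow> p \<in> bideal G {} m1 m2"
    for p :: "('n, 'k) mpoly"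
  proof
    assume "p \<in> bideal G {} m1 m2"
    then obtain h where h: "p - (xmon m1 + xmon m2) * h \<in> qideal G {}" by (auto simp: bideal_def)
    have "p = (p - (xmon m1 + xmon m2) * h) + h * (xmon m1 + xmon m2)" by (simp add: mult.commute)
    then show "\<exists>q\<in>qideal G {}. \<exists>h. p = q + h * (xmon m1 + xmon m2)" using h by blast
  next
    assume "\<exists>q\<in>qideal G {}. \<exists>h. p = q + h * (xmon m1 + xmon m2)"
    then obtain q h where "q \<in> qideal G {}" "p = q + h * (xmon m1 + xmon m2)" by blast
    then have "p - (xmon m1 + xmon m2) * h \<in> qideal G {}" by (simp add: mult.commute)
    then show "p \<in> bideal G {} m1 m2" unfolding bideal_def by blast
  qed
  ultimately show ?thesis by blast
qed

lemma homogeneous_part_hom: "homogeneous_part d = {p. homog (int d) p}"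
  by (simp add: homogeneous_part_def hom_def exponent_degree_wd)

locale quotient =
  fixes I :: "('n::finite, 'k::field) mpoly set"
  assumes hI: "hideal I"
begin

abbreviation "R \<equiv> mpoly_ring Quot I"
abbreviation "rc \<equiv> residue_class I"

sublocale I: ideal I mpoly_ring by (rule hideal_ideal[OF hI])

lemma rc_hom: "ring_hom_ring mpoly_ring R rc"
  using I.rcos_ring_hom_ring unfolding residue_class_def[abs_def] .

sublocale rc: ring_hom_ring mpoly_ring R rc by (rule rc_hom)

lemma rc_eq: "rc p = rc q \<longleftrightarrow> p - q \<in> I"
proof -
  have mem: "x \<in> rc p \<longleftrightarrow> x - p \<in> I" for x p
  proof -
    have "x \<in> rc p \<longleftrightarrow> (\<exists>i\<in>I. x = i + p)" by (auto simp: residue_class_def a_r_coset_def r_coset_def)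
    also have "\<dots> \<longleftrightarrow> x - p \<in> I" by (metis add_diff_cancel_right' diff_add_cancel)
    finally show ?thesis .
  qed
  show ?thesis
  proof
    assume "rc p = rc q"
    moreover have "p \<in> rc p" using mem hidealD(1)[OF hI] by simp
    ultimately show "p - q \<in> I" using mem by blast
  next
    assume pq: "p - q \<in> I"
    have "x - p \<in> I \<longleftrightarrow> x - q \<in> I" for x
      using hidealD(2)[OF hI _ pq, of "x - p"] hidealD(6)[OF hI _ pq, of "x - q"] by auto
    then show "rc p = rc q" using mem by blast
  qed
qed

lemma carrier_R: "carrier R = range rc"
  unfolding residue_class_def by (auto simp: FactRing_def A_RCOSETS_def' )

lemma rc_mult: "rc p \<otimes>\<^bsub>R\<^esub> rc q = rc (p * q)" and rc_add: "rc p \<oplus>\<^bsub>R\<^esub> rc q = rc (p + q)"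
  and rc_zero: "\<zero>\<^bsub>R\<^esub> = rc 0" and rc_one: "\<one>\<^bsub>R\<^esub> = rc 1"
  using rc.hom_mult[of p q] rc.hom_add[of p q] rc.hom_zero rc.hom_one by simp_all

lemma exact_zero_divisorsD:
  assumes "exact_zero_divisors R (rc p) (rc q)"
  shows "p * q \<in> I" "p * g \<in> I \<Longrightarrow> \<exists>w. g - q * w \<in> I" "q * g \<in> I \<Longrightarrow> \<exists>w. g - p * w \<in> I"
proof -
  have ann: "rc g \<in> annihilator R (rc p) \<longleftrightarrow> p * g \<in> I" for p g
    by (auto simp: annihilator_def carrier_R rc_mult rc_zero rc_eq mult.commute)
  have pi: "rc g \<in> PIdl\<^bsub>R\<^esub> (rc p) \<longleftrightarrow> (\<exists>w. g - p * w \<in> I)" for p g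
  proof -
    have "rc g \<in> PIdl\<^bsub>R\<^esub> (rc p) \<longleftrightarrow> (\<exists>w. rc g = rc w \<otimes>\<^bsub>R\<^esub> rc p)"
      unfolding cgenideal_def carrier_R by blast
    then show ?thesis by (simp add: rc_mult rc_eq mult.commute)
  qed
  have e: "annihilator R (rc p) = PIdl\<^bsub>R\<^esub> (rc q)" "annihilator R (rc q) = PIdl\<^bsub>R\<^esub> (rc p)"
    using assms by (simp_all add: exact_zero_divisors_def)
  have "\<exists>w. q - q * w \<in> I" using hidealD(1)[OF hI] by (intro exI[of _ 1]) simp
  then show "p * q \<in> I" using ann[of q p] pi[of q q] e(1) by simp
  show "p * g \<in> I \<Longrightarrow> \<exists>w. g - q * w \<in> I" using ann[of g p] pi[of g q] e(1) by simp
  show "q * g \<in> I \<Longrightarrow> \<exists>w. g - p * w \<in> I" using ann[of g q] pi[of g p] e(2) by simp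
qed

lemma scalars_subfield: assumes "1 \<notin> I" shows "subfield (scalars I) R"
proof -
  interpret k: field "ring_of_type_algebra :: 'k ring" by rule
  have "(\<lambda>c. rc (const c)) \<in> ring_hom (ring_of_type_algebra :: 'k ring) R"
    by (rule ring_hom_memI)
      (simp_all add: carrier_R const_mult const_add rc_mult rc_add rc_one)
  then interpret h: ring_hom_ring "ring_of_type_algebra :: 'k ring" R "\<lambda>c. rc (const c)"
    by (intro ring_hom_ringI2 k.ring_axioms rc.S.ring_axioms)
  have "\<one>\<^bsub>R\<^esub> \<noteq> \<zero>\<^bsub>R\<^esub>" using assms by (simp add: rc_one rc_zero rc_eq)
  then have "subfield ((\<lambda>c. rc (const c)) ` carrier ring_of_type_algebra) R"
    by (rule h.img_is_subfield(2)[OF k.carrier_is_subfield])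
  then show ?thesis by (simp add: scalars_def image_image)
qed

lemma combine_rc:
  "rc.S.combine (map (\<lambda>c. rc (const c)) cs) (map (\<lambda>u. rc (l * u)) us) =
    rc (l * sum_list (map2 (\<lambda>c u. const c * u) cs us))"
proof (induction cs us rule: list_induct2')
  case (4 c cs u us)
  then show ?case by (simp add: rc_mult rc_add distrib_left mult.left_commute)
qed (simp_all add: rc_zero)

end

section \<open>Linear forms from coefficient lists, and the dimension of the degree 2 piece\<close>

lemma hom_1_eqI:
  fixes p q :: "('n::finite, 'k::comm_ring_1) mpoly"
  assumes "homog 1 p" "homog 1 q" "\<And>i. cf p (ee i) = cf q (ee i)" shows "p = q"
proof (rule poly_mapping_eqI)
  fix m
  show "cf p m = cf q m"
  proof (cases "tdeg m = 1")
    case True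
    then show ?thesis using wd_1_ee assms(3) by metis
  next
    case False
    then have "m \<notin> ks p" "m \<notin> ks q" using assms(1,2) by (auto simp: hom_def)
    then show ?thesis by (simp add: in_keys_iff)
  qed
qed

abbreviation lincomb :: "'k::field list \<Rightarrow> 'n::finite list \<Rightarrow> ('n, 'k) mpoly"
  where "lincomb cs vs \<equiv> sum_list (map2 (\<lambda>c u. const c * u) cs (map (\<lambda>i. xmon (ee i)) vs))"

lemma hom_lincomb: "homog 1 (lincomb cs vs)"
proof (induction cs vs rule: list_induct2')
  case (4 c cs v vs)
  have "homog 1 (xmon (ee v))" using hom_xmon[of UNIV "ee v"] by simp
  then show ?case using 4 by (auto intro!: hom_add hom_const_mult)
qed simp_all

lemma cf_lincomb_0: "i \<notin> set vs \<Longrightarrow> cf (lincomb cs vs) (ee i) = 0"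
  by (induction cs vs rule: list_induct2') (auto simp: lookup_add cf_xmon_ee)

lemma cf_lincomb:
  "distinct vs \<Longrightarrow> j < length cs \<Longrightarrow> j < length vs \<Longrightarrow> cf (lincomb cs vs) (ee (vs ! j)) = cs ! j"
proof (induction cs vs arbitrary: j rule: list_induct2')
  case (4 c cs v vs)
  show ?case
  proof (cases j)
    case 0
    then show ?thesis using 4 by (simp add: lookup_add cf_xmon_ee cf_lincomb_0)
  next
    case (Suc k)
    then have "vs ! k \<noteq> v" using 4 by auto
    then show ?thesis using 4 Suc by (simp add: lookup_add cf_xmon_ee)
  qed
qed simp_all

text \<open>Multiplication by \<open>l\<close> identifies \<open>R\<^sub>1 / k Q\<close> with \<open>R\<^sub>2\<close>.\<close>
lemma (in exact_pair) dim_graded_piece_2: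
  assumes d: "d = 1" and gen: "\<And>q. homog 2 q \<Longrightarrow> \<exists>w. q - l * w \<in> I"
  shows "ring.dim (mpoly_ring Quot I) (scalars I) (graded_piece I 2) = card (UNIV :: 'n set) - 1"
proof -
  interpret q: quotient I by unfold_locales (rule I)
  have "1 \<notin> I" using low[of 1 0] by (auto simp: lookup_one)
  note K = q.scalars_subfield[OF this]
  have Q1: "homog 1 Q" using Q d by simp
  have "ks Q \<noteq> {}" using Q_notin iI(1) by auto
  \<comment> \<open>A variable occurring in Q. The products of l with the other variables will form
    the basis: modulo Q, which l kills, this variable is expressible through them.\<close>
  then obtain i0 where i0: "cf Q (ee i0) \<noteq> 0"
    using Q1 wd_1_ee unfolding hom_def by (metis equals0I in_keys_iff of_nat_eq_1_iff)
  obtain vs where vs: "set vs = UNIV - {i0}" "distinct vs"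
    using finite_distinct_list[of "UNIV - {i0}"] by auto
  define Us where "Us = map (\<lambda>u. q.rc (l * u)) (map (\<lambda>i. xmon (ee i)) vs)"
  have len: "length Us = card (UNIV :: 'n set) - 1"
    using distinct_card[OF vs(2)] vs(1) by (simp add: Us_def card_Diff_subset)
  have car: "set Us \<subseteq> carrier q.R" by (auto simp: Us_def q.carrier_R)
  have comb: "q.rc.S.combine (map (\<lambda>c. q.rc (const c)) cs) Us = q.rc (l * lincomb cs vs)" for cs
    unfolding Us_def by (rule q.combine_rc)
  have sc: "scalars I = range (\<lambda>c. q.rc (const c))" by (auto simp: scalars_def)
  have Ks: "\<exists>cs. Ks = map (\<lambda>c. q.rc (const c)) cs" if "set Ks \<subseteq> scalars I" for Ks
    unfolding ex_map_conv using that sc by blast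
  have "q.rc.S.independent (scalars I) Us"
  proof (rule q.rc.S.trivial_combine_imp_independent[OF K car])
    fix Ks assume "set Ks \<subseteq> scalars I" and z: "q.rc.S.combine Ks Us = \<zero>\<^bsub>q.R\<^esub>"
    then obtain cs where cs: "Ks = map (\<lambda>c. q.rc (const c)) cs" using Ks by blast
    define p where "p = lincomb cs vs"
    have p: "homog 1 p" unfolding p_def by (rule hom_lincomb)
    have "l * p \<in> I" using z unfolding cs comb by (simp add: q.rc_zero q.rc_eq p_def)
    then obtain w0 where "p - Q * w0 \<in> I" using ex1 by blast
    then obtain w where w: "homog (1 - 1) w" "p - Q * w \<in> I"
      using hideal_homogenise[OF I p Q1] by blast
    have wc: "w = const (cf w 0)" using hom_0_const w(1) by simp
    have cfp: "cf p (ee i) = cf w 0 * cf Q (ee i)" for i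
    proof -
      have "cf (p - Q * w) (ee i) = 0" by (rule low[OF w(2)]) simp
      moreover have "cf (Q * w) (ee i) = cf w 0 * cf Q (ee i)"
        by (subst wc) (simp add: mult.commute[of Q])
      ultimately show ?thesis by (simp add: lookup_minus)
    qed
    have "cf p (ee i0) = 0" unfolding p_def by (rule cf_lincomb_0) (simp add: vs)
    then have "cf w 0 = 0" using cfp[of i0] i0 by simp
    then have "cs ! j = 0" if "j < length cs" "j < length vs" for j
      using cfp[of "vs ! j"] cf_lincomb[OF vs(2) that] by (simp add: p_def)
    then show "set (take (length Us) Ks) \<subseteq> {\<zero>\<^bsub>q.R\<^esub>}"
      by (auto simp: in_set_conv_nth cs Us_def q.rc_zero)
  qed
  then have "q.rc.S.dimension (length Us) (scalars I) (q.rc.S.Span (scalars I) Us)"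
    by (rule q.rc.S.dimension_independent)
  moreover have "q.rc.S.Span (scalars I) Us = graded_piece I 2"
  proof
    show "q.rc.S.Span (scalars I) Us \<subseteq> graded_piece I 2"
    proof
      fix y assume "y \<in> q.rc.S.Span (scalars I) Us"
      then obtain cs where "y = q.rc (l * lincomb cs vs)"
        unfolding q.rc.S.Span_eq_combine_set[OF K car] using Ks comb by blast
      moreover have "homog (1 + 1) (l * lincomb cs vs)" by (rule hom_mult[OF hom_linear_form hom_lincomb])
      ultimately show "y \<in> graded_piece I 2" by (auto simp: graded_piece_def homogeneous_part_hom)
    qed
    show "graded_piece I 2 \<subseteq> q.rc.S.Span (scalars I) Us"
    proof
      fix y assume "y \<in> graded_piece I 2"
      then obtain g where g: "y = q.rc g" "homog 2 g" by (auto simp: graded_piece_def homogeneous_part_hom)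
      obtain w0 where "g - l * w0 \<in> I" using gen[OF g(2)] by blast
      then obtain w where w: "homog (2 - 1) w" "g - l * w \<in> I"
        using hideal_homogenise[OF I g(2) hom_linear_form] by blast
      \<comment> \<open>Subtracting this multiple of Q removes the variable \<open>i0\<close> from
        \<open>w\<close> without changing l w modulo \<open>I\<close>.\<close>
      define t where "t = cf w (ee i0) / cf Q (ee i0)"
      define w' where "w' = w - const t * Q"
      define cs where "cs = map (\<lambda>i. cf w' (ee i)) vs"
      have hw: "homog 1 w'" unfolding w'_def using w(1) by (intro hom_diff hom_const_mult Q1) simp
      have "w' = lincomb cs vs"
      proof (rule hom_1_eqI[OF hw hom_lincomb])
        fix i
        show "cf w' (ee i) = cf (lincomb cs vs) (ee i)"
        proof (cases "i = i0")
          case True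
          have "cf w' (ee i0) = 0" using i0 by (simp add: w'_def t_def lookup_minus)
          then show ?thesis using cf_lincomb_0[of i0 vs cs] True vs(1) by simp
        next
          case False
          then have "i \<in> set vs" using vs(1) by simp
          then obtain j where j: "j < length vs" "vs ! j = i" by (auto simp: in_set_conv_nth)
          then have "cf (lincomb cs vs) (ee i) = cs ! j" using cf_lincomb[OF vs(2), of j cs] by (simp add: cs_def)
          then show ?thesis using j by (simp add: cs_def)
        qed
      qed
      moreover have "(g - l * w) + const t * (l * Q) \<in> I" by (rule iI(2)[OF w(2) iI(3)[OF lQ]])
      moreover have "(g - l * w) + const t * (l * Q) = g - l * w'" by (simp add: w'_def algebra_simps)
      ultimately have "y = q.rc.S.combine (map (\<lambda>c. q.rc (const c)) cs) Us"
        using g(1) comb[of cs] q.rc_eq by simp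
      moreover have "set (map (\<lambda>c. q.rc (const c)) cs) \<subseteq> scalars I" by (auto simp: sc)
      ultimately show "y \<in> q.rc.S.Span (scalars I) Us"
        unfolding q.rc.S.Span_eq_combine_set[OF K car] by blast
    qed
  qed
  ultimately have "q.rc.S.dimension (card (UNIV :: 'n set) - 1) (scalars I) (graded_piece I 2)"
    by (simp only: len)
  then show ?thesis using q.rc.S.dimI[OF K] by (simp add: over_def)
qed

text \<open>The contrapositive form: for a point of the open set, an exact pair forces the excluded
  dimension.\<close>

lemma no_exact_pair:
  fixes a :: "'n::finite \<Rightarrow> 'k::field_char_0" and Q :: "('n, 'k) mpoly"
  assumes G: "quad G" "tdeg m1 = 2" "tdeg m2 = 2" "m1 \<noteq> m2"
    and a: "\<And>i. a i \<noteq> 0" "\<And>t. t \<in> {1, -1, 2, -2, 1/2, -1/2} \<Longrightarrow> mval a m1 \<noteq> t * mval a m2"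
    and Q: "homog (int d) Q"
    and ezd: "exact_zero_divisors (mpoly_ring Quot bideal G {} m1 m2)
      (residue_class (bideal G {} m1 m2) (linear_form a)) (residue_class (bideal G {} m1 m2) Q)"
  shows "ring.dim (mpoly_ring Quot bideal G {} m1 m2) (scalars (bideal G {} m1 m2 :: ('n, 'k) mpoly set))
    (graded_piece (bideal G {} m1 m2) 2) = card (UNIV :: 'n set) - 1"
proof -
  let ?I = "bideal G {} m1 m2 :: ('n, 'k) mpoly set" and ?G = "insert m1 (insert m2 G)"
  have hI: "hideal ?I" by (rule bideal_hideal[OF G(2,3)])
  interpret q: quotient ?I by unfold_locales (rule hI)
  note e = q.exact_zero_divisorsD[OF ezd]
  have quad: "quad ?G" using G by (auto simp: quad_def)
  have pair: "exact_pair ?G a Q ?I d"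
    by unfold_locales (use quad a(1) Q hI bideal_sub e in auto)
  interpret p: exact_pair ?G a Q ?I d by (rule pair)
  have "d = 1 \<and> (\<forall>q. homog 2 q \<longrightarrow> (\<exists>w. q - linear_form a * w \<in> ?I))"
  proof (cases "m1 \<in> G \<or> m2 \<in> G")
    case True
    note I = bideal_monomial[OF G(2,3) True, where 'k = 'k]
    show ?thesis using exact_pair_monomial pair unfolding I by blast
  next
    case False
    \<comment> \<open>Truncated subtraction makes \<open>s\<close> the componentwise minimum, the
      greatest common divisor, with cofactors \<open>r1\<close> and \<open>r2\<close>.\<close>
    define s where "s = m1 - (m1 - m2)"
    define r1 where "r1 = m1 - m2"
    define r2 where "r2 = m2 - m1"
    have m: "m1 = s + r1" "m2 = s + r2"
      by (rule poly_mapping_eqI, simp add: s_def r1_def r2_def lookup_add)+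
    have r: "r1 \<noteq> 0" "r2 \<noteq> 0"
    proof -
      have z: "w = v" if "v - w = 0" "tdeg v = tdeg w" for v w :: "'n \<Rightarrow>\<^sub>0 nat"
      proof -
        have "cf (v - w) i = 0" for i using that(1) by simp
        then have "v \<preceq> w" by (simp add: divs_def)
        then show ?thesis using wd_divs_eq that(2) by metis
      qed
      show "r1 \<noteq> 0" "r2 \<noteq> 0" using z[of m1 m2] z[of m2 m1] G by (auto simp: r1_def r2_def)
    qed
    have n: "m1 \<notin> Bs G {}" "m2 \<notin> Bs G {}" using False Bs_wd2[OF G(1)] G(2,3) by auto
    have c: "cf r1 i = 0 \<or> cf r2 i = 0" for i by (auto simp: r1_def r2_def)
    have "binomial_ideal G s r1 r2"
      by unfold_locales (use G(1-3) r n c in \<open>simp_all only: m[symmetric] not_False_eq_True\<close>)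
    then have "binomial_pair G s r1 r2 a Q d"
      by (intro binomial_pair.intro binomial_pair_axioms.intro) (use pair a(2) in \<open>simp_all only: m[symmetric] not_False_eq_True\<close>)
    then interpret b: binomial_pair G s r1 r2 "TYPE('k)" a Q d .
    show ?thesis using b.d_1 b.quadrics_generated unfolding m by blast
  qed
  then show ?thesis by (intro p.dim_graded_piece_2) auto
qed

theorem theorem4p3:
  fixes M J I :: "('n :: finite, 'k :: {alg_closed_field, field_char_0}) mpoly set"
    and f1 f2 :: "('n, 'k) mpoly"
    and R :: "('n, 'k) mpoly set ring"
  assumes "M \<subseteq> monomials 2"
    and "J = Idl\<^bsub>mpoly_ring\<^esub> M"
    and "f1 \<in> monomials 2" and "f2 \<in> monomials 2" and "f1 \<noteq> f2"
    and "I = J <+>\<^bsub>mpoly_ring\<^esub> (PIdl\<^bsub>mpoly_ring\<^esub> (f1 + f2))"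
    and "R = mpoly_ring Quot I"
    and "ring.dim R (scalars I) (graded_piece I 2) \<noteq> card (UNIV :: 'n set) - 1"
  shows "\<exists>U :: ('n \<Rightarrow> 'k) set. zariski_open U \<and> U \<noteq> {} \<and>
    (\<forall>a\<in>U. \<not> (\<exists>Q. (\<exists>d. Q \<in> graded_piece I d) \<and>
       exact_zero_divisors R (residue_class I (linear_form a)) Q))"
proof -
  define G where "G = {m. (xmon m :: ('n, 'k) mpoly) \<in> M}"
  have inj: "m = m'" if "(xmon m :: ('n, 'k) mpoly) = xmon m'" for m m'
    using arg_cong[OF that, of ks] by simp
  have mono: "\<exists>m. f = xmon m \<and> tdeg m = 2" if "f \<in> monomials 2" for f :: "('n, 'k) mpoly"
    using that by (auto simp: monomials_def xmon_def exponent_degree_wd)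
  have M: "M = xmon ` G" using mono assms(1) unfolding G_def by blast
  have G: "quad G" unfolding quad_def G_def using mono assms(1) inj by blast
  obtain m1 m2 where m: "f1 = xmon m1" "f2 = xmon m2" "tdeg m1 = 2" "tdeg m2 = 2"
    using mono assms(3,4) by blast
  have I: "I = bideal G {} m1 m2"
    unfolding assms(6) assms(2) M m(1,2) Idl_monomials by (rule binomial_set_add)
  let ?S = "{1, -1, 2, -2, 1/2, -1/2} :: 'k set"
  define U where "U = {a :: 'n \<Rightarrow> 'k. (\<forall>i. a i \<noteq> 0) \<and> (\<forall>t\<in>?S. mval a m1 \<noteq> t * mval a m2)}"
  have ne: "m1 \<noteq> m2" using assms(5) m by auto
  have "\<not> (\<exists>Q. (\<exists>d. Q \<in> graded_piece I d) \<and> exact_zero_divisors R (residue_class I (linear_form a)) Q)"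
    if a: "a \<in> U" for a
  proof
    assume "\<exists>Q. (\<exists>d. Q \<in> graded_piece I d) \<and> exact_zero_divisors R (residue_class I (linear_form a)) Q"
    then obtain d Q where Q: "homog (int d) Q"
      "exact_zero_divisors R (residue_class I (linear_form a)) (residue_class I Q)"
      by (auto simp: graded_piece_def homogeneous_part_hom)
    have "ring.dim R (scalars I) (graded_piece I 2) = card (UNIV :: 'n set) - 1"
      using no_exact_pair[OF G m(3,4) ne _ _ Q(1)] a Q(2) unfolding assms(7) I U_def by blast
    then show False using assms(8) by blast
  qed
  moreover have "zariski_open U" unfolding U_def by (rule zariski_open_generic) simp
  moreover have "U \<noteq> {}" using generic_point[OF ne, where 'k = 'k] unfolding U_def by blast
  ultimately show ?thesis by blast
qed

end
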